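(* Let $T>0$, $t\in[0,T]$, let $B^H$ be a fractional Brownian motion with Hurst parameter $H\in\left(\frac12,1\right)$, let $S(t)=e^{B^H(t)}$ be the corresponding geometric fractional Brownian motion, and let $f:\mathbb{R}\to\mathbb{R}$ be a convex function with left derivative $f'_-$. Then it holds almost surely that $$f\left(\frac{T-t}{T}S(t)+\frac1T\int_0^t S(s)\,ds\right)=f(S(0))+\int_0^t f'_-\left(\frac{T-s}{T}S(s)+\frac1T\int_0^s S(u)\,du\right)\frac{T-s}{T}S(s)\,dB^H(s),$$ where the stochastic integral on the right side is understood in the sense of the generalized Lebesgue-Stieltjes integral.
   Context: Setting: $(\Omega,\mathcal{F},(\mathcal{F}_t)_{t\ge0},\mathbb{P})$ is a complete filtered probability space. Fractional Brownian motion $(B^H(t))_{t\ge0}$ is a Gaussian process with $\mathbb{E}B^H(t)=B^H(0)$ (a constant) and $\mathrm{Cov}(B^H(t),B^H(s))=\frac12\left(t^{2H}+s^{2H}-|t-s|^{2H}\right)$; its trajectories on $[0,T]$ belong almost surely to the space $W_1^\beta([0,T])$ defined below for every $0<\beta<H$ (in particular they are continuous). Fractional Besov spaces: for $\beta\in(0,1)$ and measurable $f:[0,T]\to\mathbb{R}$, $f\in W_1^\beta([0,T])$ iff $\|f\|_{1,\beta}=\sup_{0\le s<t\le T}\left(\frac{|f(t)-f(s)|}{(t-s)^\beta}+\int_s^t\frac{|f(u)-f(s)|}{(u-s)^{\beta+1}}du\right)<\infty$, and $f\in W_2^\beta([0,T])$ iff $\|f\|_{2,\beta}=\int_0^T\frac{|f(t)|}{t^\beta}dt+\int_0^T\int_0^t\frac{|f(t)-f(s)|}{(t-s)^{\beta+1}}ds\,dt<\infty$.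 Fractional derivatives on $[0,t]$: for $\alpha\in(0,1)$, $(D^\alpha_{0+}f)(x)=\frac{1}{\Gamma(1-\alpha)}\frac{d}{dx}\int_0^x f(s)(x-s)^{-\alpha}ds$ and $(D^\alpha_{t-}f)(x)=\frac{-1}{\Gamma(1-\alpha)}\frac{d}{dx}\int_x^t f(s)(s-x)^{-\alpha}ds$. Generalized Lebesgue-Stieltjes integral: if for some $\beta\in(0,1)$ one has $f\in W_2^\beta([0,T])$ and $g\in W_1^{1-\beta}([0,T])$, then for $t\in(0,T]$ the Lebesgue integral $\int_0^t f\,dg:=\int_0^t (D^\beta_{0+}f)(x)\,(D^{1-\beta}_{t-}g_{t-})(x)\,dx$, with $g_{t-}(x)=g(t-)-g(x)$, exists and is called the generalized Lebesgue-Stieltjes integral of $f$ with respect to $g$; its value is the same for all admissible $\beta$. For $t=0$ the integral is $0$. Stochastic integrals with respect to $B^H$ are taken pathwise in this sense. *)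

theory Defs
  imports "HOL-Probability.Probability"
begin

section \<open>Complete filtered probability spaces\<close>

text \<open>
  The time index is the half-line of nonnegative reals; the values of a filtration or of a
  process at negative times are irrelevant. Completeness means that the measure is complete and
  that every \<open>\<F> t\<close> contains all null sets.
\<close>

definition complete_filtered_prob_space :: "'a measure \<Rightarrow> (real \<Rightarrow> 'a measure) \<Rightarrow> bool" where
  "complete_filtered_prob_space M \<F> \<longleftrightarrow>
     prob_space M \<and> complete_measure M \<and>
     (\<forall>t\<ge>0. subalgebra M (\<F> t) \<and> null_sets M \<subseteq> sets (\<F> t)) \<and>
     (\<forall>s t. 0 \<le> s \<and> s \<le> t \<longrightarrow> subalgebra (\<F> t) (\<F> s))"

section \<open>Fractional Besov spaces\<close>

definition norm_W1 :: "real \<Rightarrow> real \<Rightarrow> (real \<Rightarrow> real) \<Rightarrow> ennreal" where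
  "norm_W1 T \<beta> f =
     (SUP (s, t) \<in> {(s, t). 0 \<le> s \<and> s < t \<and> t \<le> T}.
        ennreal (\<bar>f t - f s\<bar> / (t - s) powr \<beta>) +
        (\<integral>\<^sup>+u\<in>{s..t}. ennreal (\<bar>f u - f s\<bar> / (u - s) powr (\<beta> + 1)) \<partial>lborel))"

definition W1 :: "real \<Rightarrow> real \<Rightarrow> (real \<Rightarrow> real) set" where
  "W1 T \<beta> = {f. f \<in> borel_measurable (restrict_space borel {0..T}) \<and> norm_W1 T \<beta> f < \<infinity>}"

definition norm_W2 :: "real \<Rightarrow> real \<Rightarrow> (real \<Rightarrow> real) \<Rightarrow> ennreal" where
  "norm_W2 T \<beta> f =
     (\<integral>\<^sup>+t\<in>{0..T}. ennreal (\<bar>f t\<bar> / t powr \<beta>) \<partial>lborel) +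
     (\<integral>\<^sup>+t\<in>{0..T}. (\<integral>\<^sup>+s\<in>{0..t}. ennreal (\<bar>f t - f s\<bar> / (t - s) powr (\<beta> + 1)) \<partial>lborel) \<partial>lborel)"

definition W2 :: "real \<Rightarrow> real \<Rightarrow> (real \<Rightarrow> real) set" where
  "W2 T \<beta> = {f. f \<in> borel_measurable (restrict_space borel {0..T}) \<and> norm_W2 T \<beta> f < \<infinity>}"

section \<open>Generalized Lebesgue-Stieltjes integral\<close>

definition frac_deriv_left :: "real \<Rightarrow> (real \<Rightarrow> real) \<Rightarrow> real \<Rightarrow> real" where
  "frac_deriv_left \<alpha> f x =
     1 / Gamma (1 - \<alpha>) * deriv (\<lambda>x. LINT s:{0..x}|lborel. f s * (x - s) powr (- \<alpha>)) x"

definition frac_deriv_right :: "real \<Rightarrow> real \<Rightarrow> (real \<Rightarrow> real) \<Rightarrow> real \<Rightarrow> real" where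
  "frac_deriv_right \<alpha> t f x =
     - 1 / Gamma (1 - \<alpha>) * deriv (\<lambda>x. LINT s:{x..t}|lborel. f s * (s - x) powr (- \<alpha>)) x"

definition gls_integrand :: "real \<Rightarrow> real \<Rightarrow> (real \<Rightarrow> real) \<Rightarrow> (real \<Rightarrow> real) \<Rightarrow> real \<Rightarrow> real" where
  "gls_integrand \<beta> t f g x =
     frac_deriv_left \<beta> f x * frac_deriv_right (1 - \<beta>) t (\<lambda>y. Lim (at_left t) g - g y) x"

text \<open>
  \<open>has_gls_integral T t f g I\<close> says that, as functions on \<open>{0..T}\<close>, \<open>f\<close> and \<open>g\<close> admit a
  generalized Lebesgue-Stieltjes integral over \<open>{0..t}\<close>, and that its value is \<open>I\<close>. The fractional
  derivatives exist only almost everywhere, so the outer integral is taken with respect to the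
  completed measure \<^const>\<open>lebesgue\<close>.
\<close>

definition has_gls_integral ::
    "real \<Rightarrow> real \<Rightarrow> (real \<Rightarrow> real) \<Rightarrow> (real \<Rightarrow> real) \<Rightarrow> real \<Rightarrow> bool" where
  "has_gls_integral T t f g I \<longleftrightarrow>
     (\<exists>\<beta>. 0 < \<beta> \<and> \<beta> < 1 \<and> f \<in> W2 T \<beta> \<and> g \<in> W1 T (1 - \<beta>) \<and>
        (if t = 0 then I = 0
         else set_integrable lebesgue {0..t} (gls_integrand \<beta> t f g) \<and>
              I = (LINT x:{0..t}|lebesgue. gls_integrand \<beta> t f g x)))"

section \<open>Fractional Brownian motion\<close>

text \<open>Constants count as (degenerate) Gaussian random variables.\<close>

definition gaussian_rv :: "'a measure \<Rightarrow> ('a \<Rightarrow> real) \<Rightarrow> bool" where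
  "gaussian_rv M X \<longleftrightarrow>
     X \<in> borel_measurable M \<and>
     ((\<exists>\<mu>. AE \<omega> in M. X \<omega> = \<mu>) \<or>
      (\<exists>\<mu> \<sigma>. \<sigma> > 0 \<and> distributed M lborel X (normal_density \<mu> \<sigma>)))"

definition gaussian_process :: "'a measure \<Rightarrow> (real \<Rightarrow> 'a \<Rightarrow> real) \<Rightarrow> bool" where
  "gaussian_process M X \<longleftrightarrow>
     (\<forall>J c. finite J \<and> J \<subseteq> {0..} \<longrightarrow> gaussian_rv M (\<lambda>\<omega>. \<Sum>t\<in>J. c t * X t \<omega>))"

definition covariance :: "'a measure \<Rightarrow> ('a \<Rightarrow> real) \<Rightarrow> ('a \<Rightarrow> real) \<Rightarrow> real" where
  "covariance M X Y =
     (LINT \<omega>|M. (X \<omega> - (LINT \<omega>'|M. X \<omega>')) * (Y \<omega> - (LINT \<omega>'|M. Y \<omega>')))"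

text \<open>
  The last conjunct is part of the convention: the mean and the covariance determine the
  trajectories only up to modification, and the process is taken with the regular ones.
\<close>

definition fractional_brownian_motion :: "'a measure \<Rightarrow> real \<Rightarrow> (real \<Rightarrow> 'a \<Rightarrow> real) \<Rightarrow> bool" where
  "fractional_brownian_motion M H B \<longleftrightarrow>
     gaussian_process M B \<and>
     (\<exists>b. (AE \<omega> in M. B 0 \<omega> = b) \<and> (\<forall>t\<ge>0. (LINT \<omega>|M. B t \<omega>) = b)) \<and>
     (\<forall>s\<ge>0. \<forall>t\<ge>0. covariance M (B t) (B s) =
        1 / 2 * (t powr (2 * H) + s powr (2 * H) - \<bar>t - s\<bar> powr (2 * H))) \<and>
     (\<forall>T>0. \<forall>\<beta>. 0 < \<beta> \<and> \<beta> < H \<longrightarrow> (AE \<omega> in M. (\<lambda>t. B t \<omega>) \<in> W1 T \<beta>))"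

definition geometric_fbm :: "(real \<Rightarrow> 'a \<Rightarrow> real) \<Rightarrow> real \<Rightarrow> 'a \<Rightarrow> real" where
  "geometric_fbm B t \<omega> = exp (B t \<omega>)"

end

theory Submission
  imports Defs
begin

text \<open>
  The generalized Lebesgue-Stieltjes integral of \<open>F\<close> against a path \<open>g\<close> that is Hoelder of order
  \<open>\<eta> > 1 - \<beta>\<close> is the limit, as \<open>e \<longlonglongrightarrow> 0\<close> with either sign, of
  \<open>1 / e * \<integral> F s * (g (s + e) - g s) ds\<close>, the path being frozen outside \<open>{0..t}\<close>. On the whole line the
  fractional derivatives are Marchaud derivatives, and the limit follows from Fubini's theorem and
  the Beta integral.

  Let \<open>X\<close> be the argument of \<open>f\<close> and \<open>\<phi> s = (T - s) / T * S s\<close>. Then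
  \<open>X (s + e) - X s = \<phi> s * (B (s + e) - B s) + O(\<bar>e\<bar> powr (2 * \<eta>))\<close> with \<open>2 * \<eta> > 1\<close>, and convexity gives
  \<open>f (X (s + e)) - f (X s) \<ge> f' (X s) * (X (s + e) - X s)\<close>. Dividing by \<open>e > 0\<close> and by \<open>e < 0\<close> bounds the
  integral from above and from below by \<open>f (X t) - f (X 0)\<close>, so no smoothing of \<open>f\<close> is needed.

  It remains to see that \<open>f' (X s) * \<phi> s\<close> lies in the space \<open>W2\<close> almost surely, although \<open>f'\<close> may jump.
  Splitting \<open>B u = \<rho> u * B s + Y u\<close> with \<open>Y\<close> independent of \<open>B s\<close> and \<open>\<rho> \<ge> 0\<close>, the variable \<open>X s\<close> is, given \<open>Y\<close>,
  an increasing function of the Gaussian variable \<open>B s\<close> with slope at least \<open>\<phi> s\<close>. Hence the mean of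
  \<open>\<phi> s * \<bar>f' (X t) - f' (X s)\<bar>\<close> is of order \<open>(t - s) powr \<eta> * s powr (- H)\<close>, the factor \<open>\<phi> s\<close> compensating
  the degeneration of the slope at \<open>s = T\<close>.
\<close>

section \<open>Power kernels and Lebesgue differentiation\<close>

text \<open>The analytic half lives on the whole line: kernels that vanish off the positive
  half-line carry the ranges of integration, so one-sided fractional operators become convolutions.
  The probabilistic half is shaped by what is known of the process. Independence of \<open>Y\<close>
  is established for finitely many times, so the integral inside \<open>X s\<close> is replaced by a
  Riemann sum whose error is pushed below the Hoelder bound for the increment of \<open>X\<close>;
  both then fit into one window. Exponential moments of the supremum of the path are avoided by
  working on events \<open>\<Omega> K\<close>, where the path is bounded by \<open>K\<close> with
  Hoelder constant \<open>K\<close>. They exhaust almost all paths, and on each of them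
  \<open>f'\<close> acts as a bounded monotone function. That they are events, and that a jointly
  measurable version of the process exists there, follows from continuity and a countable grid of
  times. The exponents satisfy \<open>1 - \<eta> < b < 1 / 2 < \<eta> < H\<close>: the lower bound
  on \<open>b\<close> serves the integrator, \<open>b < \<eta>\<close> makes
  \<open>(t - s) powr (\<eta> - b - 1)\<close> integrable, and \<open>s powr (- H)\<close> is
  integrable because \<open>H < 1\<close>.\<close>

definition power_kernel :: "real \<Rightarrow> real \<Rightarrow> real" where
  "power_kernel a r = (if 0 < r then r powr - a else 0)"

lemma power_kernel_nonneg [simp]: "0 \<le> power_kernel a r"
  by (simp add: power_kernel_def)

lemma power_kernel_nonpos [simp]: "r \<le> 0 \<Longrightarrow> power_kernel a r = 0"
  by (simp add: power_kernel_def)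

lemma measurable_power_kernel [measurable]:
  "power_kernel a \<in> borel_measurable borel"
  unfolding power_kernel_def by measurable

lemma nn_integral_power_kernel_atMost:
  assumes "a < 1" "0 \<le> c"
  shows "(\<integral>\<^sup>+r. ennreal (power_kernel a r * indicator {..c} r) \<partial>lborel) = c powr (1 - a) / (1 - a)"
proof -
  have "((\<lambda>r. r powr (-a)) has_integral (c powr (-a + 1) / (-a + 1))) {0..c}"
    using assms by (intro has_integral_powr_from_0) auto
  from nn_integral_has_integral_lebesgue[OF _ this]
  have "(\<integral>\<^sup>+r. ennreal (indicator {0..c} r * r powr (-a)) \<partial>lborel) = c powr (1 - a) / (1 - a)"
    by (simp add: add.commute)
  moreover have "(\<integral>\<^sup>+r. ennreal (indicator {0..c} r * r powr (-a)) \<partial>lborel) =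
    (\<integral>\<^sup>+r. ennreal (power_kernel a r * indicator {..c} r) \<partial>lborel)"
    by (intro nn_integral_cong_AE AE_I[where N = "{0}"])
      (auto simp: power_kernel_def indicator_def split: if_splits)
  ultimately show ?thesis by simp
qed

lemma nn_integral_power_kernel_atLeast:
  assumes "1 < a" "0 < w"
  shows "(\<integral>\<^sup>+r. ennreal (power_kernel a r * indicator {w<..} r) \<partial>lborel) = w powr (1 - a) / (a - 1)"
proof -
  have "((\<lambda>r. r powr (-a)) has_integral -(w powr (-a + 1)) / (-a + 1)) {w..}"
    using assms by (intro has_integral_powr_to_inf) auto
  from nn_integral_has_integral_lebesgue[OF _ this]
  have "(\<integral>\<^sup>+r. ennreal (indicator {w..} r * r powr (-a)) \<partial>lborel) = -(w powr (-a + 1)) / (-a + 1)"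
    by simp
  also have "-(w powr (-a + 1)) / (-a + 1) = w powr (1 - a) / (a - 1)"
    using assms by (simp add: field_simps)
  moreover have "(\<integral>\<^sup>+r. ennreal (indicator {w..} r * r powr (-a)) \<partial>lborel) =
    (\<integral>\<^sup>+r. ennreal (power_kernel a r * indicator {w<..} r) \<partial>lborel)"
    using assms by (intro nn_integral_cong_AE AE_I[where N = "{w}"])
      (auto simp: power_kernel_def indicator_def split: if_splits)
  ultimately show ?thesis by simp
qed

lemma integrable_pair_lborel:
  fixes f :: "real \<Rightarrow> real \<Rightarrow> real"
  assumes [measurable]: "case_prod f \<in> borel_measurable (lborel \<Otimes>\<^sub>M lborel)"
    and "(\<integral>\<^sup>+x. (\<integral>\<^sup>+y. ennreal \<bar>f x y\<bar> \<partial>lborel) \<partial>lborel) < \<infinity>"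
  shows "integrable (lborel \<Otimes>\<^sub>M lborel) (case_prod f)"
proof (rule integrableI_bounded)
  have "(\<integral>\<^sup>+p. ennreal (norm (case p of (x, y) \<Rightarrow> f x y)) \<partial>(lborel \<Otimes>\<^sub>M lborel)) =
    (\<integral>\<^sup>+x. (\<integral>\<^sup>+y. ennreal \<bar>f x y\<bar> \<partial>lborel) \<partial>lborel)"
    by (subst lborel.nn_integral_fst[symmetric]) (auto)
  then show "(\<integral>\<^sup>+p. ennreal (norm (case p of (x, y) \<Rightarrow> f x y)) \<partial>(lborel \<Otimes>\<^sub>M lborel)) < \<infinity>"
    using assms(2) by simp
qed simp

text \<open>\<open>integrable_ccontinuous_explicit\<close> controls averages over intervals starting
  at \<open>x\<close>, that is, right-hand difference quotients. The left-hand ones come from the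
  same statement for the reflected function \<open>w (- y)\<close>, whose exceptional null set is
  carried back by the reflection invariance of \<open>lborel\<close>.\<close>

lemma AE_has_derivative_indefinite_integral:
  fixes w :: "real \<Rightarrow> real"
  assumes w: "integrable lborel w"
  shows "AE x in lborel. ((\<lambda>x. LINT y|lborel. w y * indicator {..x} y) has_real_derivative w x) (at x)"
proof -
  have one_sided: "AE x in lborel. ((\<lambda>h. (LINT y|lborel. v y * indicator {x<..x + h} y) / h) \<longlongrightarrow> v x) (at_right 0)"
    if v: "integrable lborel v" for v :: "real \<Rightarrow> real"
  proof -
    have on: "v integrable_on cbox a b" for a b
      using v by (meson integrable_on_lborel integrable_on_subcbox subset_UNIV)
    obtain N where N: "negligible N"
      "\<And>x e. \<lbrakk>x \<notin> N; 0 < e\<rbrakk> \<Longrightarrow> \<exists>d>0. \<forall>h. 0 < h \<and> h < d \<longrightarrow>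
          norm (integral (cbox x (x + h *\<^sub>R One)) v /\<^sub>R h ^ DIM(real) - v x) < e"
      using integrable_ccontinuous_explicit[OF on] by metis
    have "((\<lambda>h. (LINT y|lborel. v y * indicator {x<..x + h} y) / h) \<longlongrightarrow> v x) (at_right 0)" if xN: "x \<notin> N" for x
    proof (rule tendstoI)
      fix e :: real assume "0 < e"
      then obtain d where "d > 0" and d: "\<And>h. 0 < h \<and> h < d \<Longrightarrow>
          norm (integral (cbox x (x + h *\<^sub>R One)) v /\<^sub>R h ^ DIM(real) - v x) < e"
        using N(2)[OF xN] by blast
      have int: "(LINT y|lborel. v y * indicator {x<..x + h} y) = integral {x..x + h} v" for h
      proof -
        have "set_integrable lborel {x..x + h} v"
          unfolding set_integrable_def using v by (intro integrable_mult_indicator) auto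
        then have "(LINT y:{x..x + h}|lborel. v y) = integral {x..x + h} v"
          by (rule set_borel_integral_eq_integral)
        moreover have "(LINT y:{x..x + h}|lborel. v y) = (LINT y|lborel. v y * indicator {x<..x + h} y)"
          unfolding set_lebesgue_integral_def using v
          by (intro integral_cong_AE) (auto intro!: AE_I[where N = "{x}"] simp: indicator_def split: if_splits)
        ultimately show ?thesis by simp
      qed
      have "dist ((LINT y|lborel. v y * indicator {x<..x + h} y) / h) (v x) < e" if "0 < h" "h < d" for h
        using d[of h] that by (simp add: int dist_real_def divide_inverse mult.commute cbox_interval)
      then show "\<forall>\<^sub>F h in at_right 0. dist ((LINT y|lborel. v y * indicator {x<..x + h} y) / h) (v x) < e"
        unfolding eventually_at_right_field using \<open>d > 0\<close> by (intro exI[of _ d]) auto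
    qed
    moreover have "AE x in lborel. x \<notin> N"
    proof -
      have "N \<in> null_sets lebesgue" using N(1) by (simp add: negligible_iff_null_sets)
      then show ?thesis
        by (metis AE_completion_iff AE_not_in)
    qed
    ultimately show ?thesis by (auto elim: eventually_mono)
  qed
  have diff: "(LINT y|lborel. w y * indicator {..b} y) - (LINT y|lborel. w y * indicator {..a} y)
      = (LINT y|lborel. w y * indicator {a<..b} y)" if "a \<le> b" for a b
  proof -
    have i: "integrable lborel (\<lambda>y. w y * indicator A y)" if "A \<in> sets lborel" for A
      using w that by (simp add: integrable_real_mult_indicator)
    have "(LINT y|lborel. w y * indicator {a<..b} y) =
        (LINT y|lborel. w y * indicator {..b} y - w y * indicator {..a} y)"
      using that by (intro Bochner_Integration.integral_cong) (auto simp: indicator_def)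
    then show ?thesis
      by (simp add: Bochner_Integration.integral_diff[OF i i])
  qed
  have r: "AE x in lborel. ((\<lambda>h. (LINT y|lborel. w (- y) * indicator {x<..x + h} y) / h) \<longlongrightarrow> w (- x)) (at_right 0)"
    using w by (intro one_sided) (simp add: lborel_integrable_real_affine[of w "-1" 0, simplified])
  have "AE x in lborel. ((\<lambda>h. (LINT y|lborel. w (- y) * indicator {-x<..h - x} y) / h) \<longlongrightarrow> w x) (at_right 0)"
  proof -
    have "distr lborel borel (uminus :: real \<Rightarrow> real) = lborel"
      using lborel_real_affine[of "-1" 0] by (simp add: density_1 cong: distr_cong)
         
    then have "AE x in distr lborel borel (uminus :: real \<Rightarrow> real). ((\<lambda>h. (LINT y|lborel. w (- y) * indicator {x<..x + h} y) / h) \<longlongrightarrow> w (- x)) (at_right 0)"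
      using r by (simp only:)
    from AE_distrD[OF _ this] show ?thesis
      by simp
  qed
  with one_sided[OF w] show ?thesis
  proof eventually_elim
    case (elim x)
    let ?W = "\<lambda>x. LINT y|lborel. w y * indicator {..x} y"
    have reflect: "(LINT y|lborel. w (- y) * indicator {-x<..h - x} y) = ?W x - ?W (x - h)" if "0 < h" for h
    proof -
      have "(LINT y|lborel. w (- y) * indicator {-x<..h - x} y) = (LINT y|lborel. w y * indicator {-x<..h - x} (-y))"
        by (subst lborel_integral_real_affine[of "-1" _ 0]) auto
      also have "\<dots> = (LINT y|lborel. w y * indicator {x - h<..x} y)"
        using w by (intro integral_cong_AE AE_I[where N = "{x, x - h}"] emeasure_lborel_countable)
           (auto simp: indicator_def emeasure_lborel_countable split: if_splits)
      finally show ?thesis using diff[of "x - h" x] that by simp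
    qed
    have "((\<lambda>h. (?W (x + h) - ?W x) / h) \<longlongrightarrow> w x) (at_right 0)"
      using elim(1) by (rule Lim_transform_eventually)
        (auto simp: eventually_at_right_field diff intro!: exI[of _ 1])
    moreover have "((\<lambda>h. (?W (x + h) - ?W x) / h) \<longlongrightarrow> w x) (at_left 0)"
    proof -
      have "((\<lambda>h. (?W (x + - h) - ?W x) / - h) \<longlongrightarrow> w x) (at_right 0)"
        using elim(2) by (rule Lim_transform_eventually)
          (auto simp: eventually_at_right_field reflect diff_divide_distrib intro!: exI[of _ 1])
      then show ?thesis by (simp add: at_left_minus[of 0] filterlim_filtermap)
    qed
    ultimately show ?case
      by (simp add: DERIV_def filterlim_split_at_real)
  qed
qed

section \<open>Marchaud derivatives\<close>

text \<open>Substituting \<open>v = r * t\<close> produces the factor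
  \<open>r * r powr (- a) * r powr (a - 1) = 1\<close>, so the value does not depend on
  \<open>r\<close>. Convolving the kernels of orders \<open>a\<close> and \<open>1 - a\<close> thus
  gives a constant on the positive half-line, which is why fractional integration inverts fractional
  differentiation.\<close>

lemma nn_integral_power_kernel_Beta:
  assumes "0 < a" "a < 1" "0 < r"
  shows "(\<integral>\<^sup>+v. ennreal (power_kernel a v * power_kernel (1 - a) (r - v)) \<partial>lborel) = Gamma a * Gamma (1 - a)"
proof -
  have "((\<lambda>t. t powr ((1 - a) - 1) * (1 - t) powr (a - 1)) has_integral Beta (1 - a) a) {0..1}"
    using assms by (intro has_integral_Beta_real) auto
  from nn_integral_has_integral_lebesgue[OF _ this]
  have B: "(\<integral>\<^sup>+t. ennreal (indicator {0..1} t * (t powr (- a) * (1 - t) powr (a - 1))) \<partial>lborel) = Beta (1 - a) a"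
    by simp
  have eq: "r * (power_kernel a (r * t) * power_kernel (1 - a) (r - r * t)) =
      indicator {0..1} t * (t powr (- a) * (1 - t) powr (a - 1))" for t
  proof (cases "0 < t \<and> t < 1")
    case True
    then have "r * t > 0" "r - r * t > 0" "r - r * t = r * (1 - t)"
      using assms by (auto simp: algebra_simps)
    moreover have "r powr (-a) * r powr (a - 1) = r powr (-1)"
      by (subst powr_add[symmetric]) simp
    then have key: "r * (r powr (-a) * r powr (a - 1)) = 1"
      using assms by (simp add: powr_minus_divide)
    then have "r * ((r powr (-a) * p) * (r powr (a - 1) * q)) = p * q" for p q
      by (metis (no_types, lifting) mult.assoc mult.left_commute mult.left_neutral)
    moreover have "r * (r * t) powr - a * (r * (1 - t)) powr - (1 - a) =
        r * ((r powr (-a) * t powr - a) * (r powr (a - 1) * (1 - t) powr (a - 1)))"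
      using True assms by (simp add: powr_mult)
    ultimately show ?thesis using True key
      by (simp add: power_kernel_def mult.assoc)
  next
    case False
    then have "r * t \<le> 0 \<or> r - r * t \<le> 0"
      using assms by (auto simp: not_less mult_le_0_iff)
    moreover have "indicator {0..1} t * (t powr (- a) * (1 - t) powr (a - 1)) = 0"
      using False by (auto simp: indicator_def not_less)
    ultimately show ?thesis by auto
  qed
  have "(\<integral>\<^sup>+v. ennreal (power_kernel a v * power_kernel (1 - a) (r - v)) \<partial>lborel) =
      ennreal r * (\<integral>\<^sup>+t. ennreal (power_kernel a (r * t) * power_kernel (1 - a) (r - r * t)) \<partial>lborel)"
    using assms by (subst nn_integral_real_affine[of _ r 0]) auto
  also have "\<dots> = (\<integral>\<^sup>+t. ennreal (r * (power_kernel a (r * t) * power_kernel (1 - a) (r - r * t))) \<partial>lborel)"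
    using assms by (subst nn_integral_cmult[symmetric]) (auto simp: ennreal_mult')
  also have "\<dots> = Beta (1 - a) a"
    unfolding eq by (rule B)
  also have "Beta (1 - a) a = Gamma a * Gamma (1 - a)"
    by (simp add: Beta_def mult.commute)
  finally show ?thesis .
qed

text \<open>The left-sided Marchaud derivative on the whole line, without the factor \<open>1 / Gamma (1 - b)\<close>.
  For \<open>u\<close> vanishing on the negative half-line it is the derivative of the convolution of \<open>u\<close> with
  \<open>power_kernel b\<close>.\<close>

definition marchaud :: "real \<Rightarrow> (real \<Rightarrow> real) \<Rightarrow> real \<Rightarrow> real" where
  "marchaud b u y = b * (LINT r|lborel. (u y - u (y - r)) * power_kernel (1 + b) r)"

lemma measurable_marchaud [measurable]:
  assumes [measurable]: "u \<in> borel_measurable borel"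
  shows "marchaud b u \<in> borel_measurable borel"
proof -
  have "(\<lambda>y. b * (LINT r|lborel. (u y - u (y - r)) * power_kernel (1 + b) r)) \<in> borel_measurable borel"
    by measurable
  then show ?thesis by (simp add: marchaud_def[abs_def])
qed

lemma lborel_integral_shift:
  fixes f :: "real \<Rightarrow> real"
  shows "(LINT y|lborel. f (y - r)) = (LINT y|lborel. f y)"
  using lborel_integral_real_affine[of 1 f "-r"] by simp

lemma nn_integral_power_kernel_reflect:
  "(\<integral>\<^sup>+y. ennreal (power_kernel a (x - y) * indicator {0..} y) \<partial>lborel) =
   (\<integral>\<^sup>+r. ennreal (power_kernel a r * indicator {..x} r) \<partial>lborel)"
  by (subst nn_integral_real_affine[of _ "-1" x]) (auto intro!: nn_integral_cong simp: indicator_def)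

lemma nn_integral_power_kernel_reflect_finite:
  assumes "a < 1"
  shows "(\<integral>\<^sup>+y. ennreal (power_kernel a (x - y) * indicator {0..} y) \<partial>lborel) < \<infinity>"
proof -
  have "(\<integral>\<^sup>+y. ennreal (power_kernel a (x - y) * indicator {0..} y) \<partial>lborel) \<le>
      (\<integral>\<^sup>+r. ennreal (power_kernel a r * indicator {..max 0 x} r) \<partial>lborel)"
    unfolding nn_integral_power_kernel_reflect
    by (intro nn_integral_mono) (auto simp: indicator_def intro!: ennreal_leI)
  also have "\<dots> < \<infinity>"
    using assms by (subst nn_integral_power_kernel_atMost) auto
  finally show ?thesis .
qed

text \<open>\<open>finite_seminorm\<close> is a Gagliardo-type condition for
  \<open>y \<le> X\<close>; it makes \<open>marchaud b u\<close> integrable on \<open>{..X}\<close>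
  and justifies Fubini there. In \<open>gls_integral_limit\<close> the function is an integrand cut
  off at \<open>t\<close> and \<open>X = t + 1\<close>, which leaves room for shifts below
  1.\<close>

locale marchaud_function =
  fixes u :: "real \<Rightarrow> real" and b X C :: real
  assumes measurable_u [measurable]: "u \<in> borel_measurable borel"
    and bounded_u: "\<And>x. \<bar>u x\<bar> \<le> C"
    and zero_u: "\<And>x. x < 0 \<Longrightarrow> u x = 0"
    and b_pos: "0 < b" and b_less_1: "b < 1"
    and finite_seminorm: "(\<integral>\<^sup>+y. (\<integral>\<^sup>+r. ennreal (\<bar>u y - u (y - r)\<bar> * power_kernel (1 + b) r * indicator {..X} y) \<partial>lborel) \<partial>lborel) < \<infinity>"
begin

lemma C_nonneg: "0 \<le> C"
  using bounded_u[of 0] by linarith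

lemma abs_u_le: "\<bar>u y\<bar> \<le> C * indicator {0..} y"
  using bounded_u[of y] zero_u[of y] by (auto simp: indicator_def not_le)

lemma integrable_u_atMost: "integrable lborel (\<lambda>y. u y * indicator {..x} y)"
proof (rule Bochner_Integration.integrable_bound)
  show "integrable lborel (\<lambda>y. C * indicator {0..max 0 x} y :: real)"
    by simp
  have "norm (u y * indicator {..x} y) \<le> norm (C * indicator {0..max 0 x} y :: real)" for y
    using abs_u_le[of y] C_nonneg by (auto simp: indicator_def split: if_splits)
  then show "AE y in lborel. norm (u y * indicator {..x} y) \<le> norm (C * indicator {0..max 0 x} y :: real)"
    by simp
qed simp

lemma nn_integral_u_power_kernel_finite:
  assumes "a < 1"
  shows "(\<integral>\<^sup>+y. ennreal (\<bar>u y\<bar> * power_kernel a (x - y)) \<partial>lborel) < \<infinity>"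
proof -
  have "(\<integral>\<^sup>+y. ennreal (\<bar>u y\<bar> * power_kernel a (x - y)) \<partial>lborel) \<le>
     (\<integral>\<^sup>+y. ennreal C * ennreal (power_kernel a (x - y) * indicator {0..} y) \<partial>lborel)"
  proof (rule nn_integral_mono)
    fix y
    have "\<bar>u y\<bar> * power_kernel a (x - y) \<le> C * indicator {0..} y * power_kernel a (x - y)"
      by (intro mult_right_mono abs_u_le) simp
    then show "ennreal (\<bar>u y\<bar> * power_kernel a (x - y)) \<le> ennreal C * ennreal (power_kernel a (x - y) * indicator {0..} y)"
      using C_nonneg by (auto simp: ennreal_mult'[symmetric] mult_ac intro!: ennreal_leI)
  qed
  also have "\<dots> = ennreal C * (\<integral>\<^sup>+y. ennreal (power_kernel a (x - y) * indicator {0..} y) \<partial>lborel)"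
    by (rule nn_integral_cmult) simp
  also have "\<dots> < \<infinity>"
    using nn_integral_power_kernel_reflect_finite[OF assms] by (simp add: ennreal_mult_less_top)
  finally show ?thesis .
qed

lemma integrable_difference:
  assumes "x \<le> X"
  shows "integrable (lborel \<Otimes>\<^sub>M lborel)
    (\<lambda>(y, r). (u y - u (y - r)) * power_kernel (1 + b) r * indicator {..x} y)"
proof (rule integrable_pair_lborel)
  have "(\<integral>\<^sup>+y. (\<integral>\<^sup>+r. ennreal \<bar>(u y - u (y - r)) * power_kernel (1 + b) r * indicator {..x} y\<bar> \<partial>lborel) \<partial>lborel) \<le>
     (\<integral>\<^sup>+y. (\<integral>\<^sup>+r. ennreal (\<bar>u y - u (y - r)\<bar> * power_kernel (1 + b) r * indicator {..X} y) \<partial>lborel) \<partial>lborel)"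
    using assms by (intro nn_integral_mono) (auto simp: abs_mult indicator_def)
  then show "(\<integral>\<^sup>+y. (\<integral>\<^sup>+r. ennreal \<bar>(u y - u (y - r)) * power_kernel (1 + b) r * indicator {..x} y\<bar> \<partial>lborel) \<partial>lborel) < \<infinity>"
    using finite_seminorm by (rule le_less_trans)
qed measurable

lemma integrable_marchaud:
  assumes "x \<le> X"
  shows "integrable lborel (\<lambda>y. marchaud b u y * indicator {..x} y)"
proof -
  have "integrable lborel (\<lambda>y. b * (LINT r|lborel. (u y - u (y - r)) * power_kernel (1 + b) r * indicator {..x} y))"
    using lborel_pair.integrable_fst'[OF integrable_difference[OF assms]] by (intro integrable_mult_right) simp
  then show ?thesis by (simp add: marchaud_def mult_ac)
qed

lemma marchaud_neg: "y < 0 \<Longrightarrow> marchaud b u y = 0"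
proof -
  assume "y < 0"
  then have "(u y - u (y - r)) * power_kernel (1 + b) r = 0" for r
    using zero_u[of y] zero_u[of "y - r"] by (cases "r > 0") auto
  then have "(\<lambda>r. (u y - u (y - r)) * power_kernel (1 + b) r) = (\<lambda>r. 0)"
    by blast
  then show ?thesis by (simp add: marchaud_def)
qed

text \<open>After exchanging the integrals, the integral of \<open>u y - u (y - r)\<close> over
  \<open>y \<le> x\<close> telescopes to that of \<open>u\<close> over the window
  \<open>{x - r<..x}\<close>. Exchanging back, a given \<open>y\<close> is hit by all
  \<open>r > x - y\<close>, over which \<open>r powr (- 1 - b)\<close> integrates to
  \<open>(x - y) powr (- b) / b\<close>; the factor \<open>b\<close> of \<open>marchaud\<close>
  cancels.\<close>

lemma integral_marchaud:
  assumes "x \<le> X"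
  shows "(LINT y|lborel. marchaud b u y * indicator {..x} y) = (LINT y|lborel. u y * power_kernel b (x - y))"
proof -
  let ?k = "power_kernel (1 + b)"
  let ?E = "\<lambda>y r. ?k r * u y * indicator {x - r<..x} y"
  let ?D = "\<lambda>y r. (u y - u (y - r)) * ?k r * indicator {..x} y"
  have inner: "(LINT y|lborel. ?D y r) =
      (LINT y|lborel. ?E y r)" for r
  proof (cases "0 < r")
    case True
    have shift: "(LINT y|lborel. u (y - r) * indicator {..x} y) = (LINT y|lborel. u y * indicator {..x - r} y)"
      using lborel_integral_shift[of "\<lambda>y. u y * indicator {..x - r} y" r]
      by (simp add: indicator_def)
    have i: "integrable lborel (\<lambda>y. u (y - r) * indicator {..x} y)"
      using lborel_integrable_real_affine[OF integrable_u_atMost[of "x - r"], of 1 "-r"]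
      by (simp add: indicator_def)
    have "(LINT y|lborel. ?D y r) =
       ?k r * (LINT y|lborel. u y * indicator {..x} y - u (y - r) * indicator {..x} y)"
      by (subst integral_mult_right_zero[symmetric]) (simp add: algebra_simps)
    also have "(LINT y|lborel. u y * indicator {..x} y - u (y - r) * indicator {..x} y) =
      (LINT y|lborel. u y * indicator {..x} y - u y * indicator {..x - r} y)"
      by (simp add: Bochner_Integration.integral_diff[OF integrable_u_atMost i] shift
          Bochner_Integration.integral_diff[OF integrable_u_atMost integrable_u_atMost])
    also have "\<dots> = (LINT y|lborel. u y * indicator {x - r<..x} y)"
      using True by (intro Bochner_Integration.integral_cong) (auto simp: indicator_def)
    finally show ?thesis by (simp add: mult.assoc)
  qed simp
  have "(LINT y|lborel. marchaud b u y * indicator {..x} y) =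
      b * (LINT y|lborel. LINT r|lborel. ?D y r)"
    by (simp add: marchaud_def mult_ac)
  also have "\<dots> = b * (LINT r|lborel. LINT y|lborel. ?D y r)"
    by (subst lborel_pair.Fubini_integral[OF integrable_difference[OF assms]]) simp
  also have "\<dots> = b * (LINT r|lborel. LINT y|lborel. ?E y r)"
    by (simp only: inner)
  also have "(LINT r|lborel. LINT y|lborel. ?E y r) =
     (LINT y|lborel. LINT r|lborel. ?E y r)"
  proof (rule lborel_pair.Fubini_integral)
    show "integrable (lborel \<Otimes>\<^sub>M lborel) (\<lambda>(y, r). ?E y r)"
    proof (rule integrable_pair_lborel)
      \<comment> \<open>At \<open>y = x\<close> every \<open>r > 0\<close> contributes and the inner
        integral may diverge, so this point is removed.\<close>
      have "AE y in lborel. y \<noteq> x"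
        by (rule AE_lborel_singleton)
      then have "AE y in lborel. (\<integral>\<^sup>+r. ennreal \<bar>?E y r\<bar> \<partial>lborel)
         \<le> ennreal (1 / b) * ennreal (\<bar>u y\<bar> * power_kernel b (x - y))"
      proof eventually_elim
        case (elim y)
        show ?case
        proof (cases "y < x")
          case True
          have "(\<integral>\<^sup>+r. ennreal \<bar>?E y r\<bar> \<partial>lborel) =
             (\<integral>\<^sup>+r. ennreal \<bar>u y\<bar> * ennreal (?k r * indicator {x - y<..} r) \<partial>lborel)"
            using True by (intro nn_integral_cong)
              (auto simp: ennreal_mult'[symmetric] abs_mult indicator_def)
          also have "\<dots> = ennreal \<bar>u y\<bar> * ennreal ((x - y) powr - b / b)"
            using True b_pos by (simp add: nn_integral_cmult nn_integral_power_kernel_atLeast)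
          also have "\<dots> = ennreal (1 / b) * ennreal (\<bar>u y\<bar> * power_kernel b (x - y))"
            using True b_pos by (simp add: ennreal_mult'[symmetric] power_kernel_def)
          finally show ?thesis by simp
        qed (use elim in \<open>auto simp: indicator_def\<close>)
      qed
      then have "(\<integral>\<^sup>+y. (\<integral>\<^sup>+r. ennreal \<bar>?E y r\<bar> \<partial>lborel) \<partial>lborel) \<le>
         (\<integral>\<^sup>+y. ennreal (1 / b) * ennreal (\<bar>u y\<bar> * power_kernel b (x - y)) \<partial>lborel)"
        by (rule nn_integral_mono_AE)
      also have "\<dots> = ennreal (1 / b) * (\<integral>\<^sup>+y. ennreal (\<bar>u y\<bar> * power_kernel b (x - y)) \<partial>lborel)"
        by (rule nn_integral_cmult) simp
      also have "\<dots> < \<infinity>"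
        using nn_integral_u_power_kernel_finite[OF b_less_1] by (simp add: ennreal_mult_less_top)
      finally show "(\<integral>\<^sup>+y. (\<integral>\<^sup>+r. ennreal \<bar>?E y r\<bar> \<partial>lborel) \<partial>lborel) < \<infinity>" .
    qed (simp add: indicator_def greaterThanAtMost_iff)
  qed
  also have "b * (LINT y|lborel. LINT r|lborel. ?E y r) =
      (LINT y|lborel. u y * power_kernel b (x - y))"
  proof -
    have "(LINT r|lborel. ?E y r) = u y * power_kernel b (x - y) / b" if "y \<noteq> x" for y
    proof (cases "y < x")
      case True
      have "(LINT r|lborel. ?E y r) =
          u y * (LINT r|lborel. ?k r * indicator {x - y<..} r)"
      proof -
        have "?E y r = u y * (?k r * indicator {x - y<..} r)" for r
          using True by (auto simp: indicator_def)
        then show ?thesis by (simp only: integral_mult_right_zero)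
      qed
      also have "(LINT r|lborel. ?k r * indicator {x - y<..} r) = (x - y) powr - b / b"
        using True b_pos by (intro integral_eq_nn_integral[THEN trans])
           (auto simp: nn_integral_power_kernel_atLeast)
      finally show ?thesis using True by (simp add: power_kernel_def)
    next
      case False
      then show ?thesis using that by (simp add: indicator_def)
    qed
    then have "(LINT y|lborel. LINT r|lborel. ?E y r) =
        (LINT y|lborel. u y * power_kernel b (x - y) / b)"
      by (intro integral_cong_AE eventually_mono[OF AE_lborel_singleton[of x]])
        (simp_all add: indicator_def)
    then show ?thesis using b_pos by simp
  qed
  finally show ?thesis .
qed

end

context marchaud_function
begin

abbreviation N :: "real \<Rightarrow> real" where
  "N y \<equiv> marchaud b u y * indicator {..X} y"

text \<open>\<open>integral_marchaud\<close> exhibits the convolution as an indefinite integral of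
  an integrable function on \<open>{..X}\<close>, so Lebesgue differentiation applies.\<close>

lemma AE_has_derivative_power_kernel_integral:
  "AE x in lborel. x < X \<longrightarrow>
     ((\<lambda>x. LINT y|lborel. u y * power_kernel b (x - y)) has_real_derivative marchaud b u x) (at x)"
  using AE_has_derivative_indefinite_integral[OF integrable_marchaud[OF order_refl]]
proof eventually_elim
  case (elim x)
  show ?case
  proof
    assume x: "x < X"
    show "((\<lambda>x. LINT y|lborel. u y * power_kernel b (x - y)) has_real_derivative marchaud b u x) (at x)"
    proof (rule has_field_derivative_transform_within_open)
      show "((\<lambda>x. LINT y|lborel. N y * indicator {..x} y) has_real_derivative marchaud b u x) (at x)"
        using elim x by simp
      show "(LINT y|lborel. N y * indicator {..z} y) = (LINT y|lborel. u y * power_kernel b (z - y))"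
        if "z \<in> {..<X}" for z
        unfolding integral_marchaud[OF less_imp_le, of z, symmetric, OF that[unfolded lessThan_iff]]
        using that by (intro Bochner_Integration.integral_cong) (auto simp: indicator_def)
    qed (use x in auto)
  qed
qed

text \<open>For the integrator the derivative is needed at every point, since a Lipschitz bound is
  drawn from it. Continuity of the Marchaud derivative allows the fundamental theorem of calculus in
  place of Lebesgue differentiation.\<close>

lemma has_derivative_power_kernel_integral:
  assumes cont: "continuous_on UNIV (marchaud b u)" and x: "x < X"
  shows "((\<lambda>x. LINT y|lborel. u y * power_kernel b (x - y)) has_real_derivative marchaud b u x) (at x)"
proof -
  \<comment> \<open>The lower limit is negative, so \<open>marchaud b u\<close> vanishes below it
    and no mass is lost; it is less than \<open>x\<close>, so \<open>x\<close> is interior to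
    \<open>{l..X}\<close>.\<close>
  define l where "l = min (-1) (x - 1)"
  have int: "(LINT y|lborel. u y * power_kernel b (z - y)) = integral {l..z} (marchaud b u)"
    if "z \<le> X" for z
  proof -
    have "(LINT y|lborel. u y * power_kernel b (z - y)) = (LINT y|lborel. marchaud b u y * indicator {..z} y)"
      using integral_marchaud[OF that] ..
    also have "\<dots> = (LINT y:{l..z}|lborel. marchaud b u y)"
      unfolding set_lebesgue_integral_def using marchaud_neg
      by (intro Bochner_Integration.integral_cong) (auto simp: indicator_def l_def)
    also have "\<dots> = integral {l..z} (marchaud b u)"
      using cont by (intro set_borel_integral_eq_integral borel_integrable_atLeastAtMost')
        (auto intro: continuous_on_subset)
    finally show ?thesis .
  qed
  have "((\<lambda>z. integral {l..z} (marchaud b u)) has_real_derivative marchaud b u x) (at x within {l..X})"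
    using x by (intro integral_has_real_derivative continuous_on_subset[OF cont]) (auto simp: l_def)
  then have "((\<lambda>z. integral {l..z} (marchaud b u)) has_real_derivative marchaud b u x) (at x)"
    using x by (subst (asm) at_within_interior) (auto simp: l_def)
  then show ?thesis
    by (rule has_field_derivative_transform_within_open[of _ _ _ "{..<X}"]) (use x int in auto)
qed

text \<open>The inversion formula: fractional integration of complementary order restores
  \<open>u\<close>. Since \<open>u\<close> is only measurable, both sides are compared through their
  integrals up to \<open>x\<close>, for every \<open>x < X\<close>, where Fubini,
  \<open>integral_marchaud\<close> and the Beta integral apply. Lebesgue differentiation then
  recovers almost every value.\<close>

lemma AE_power_kernel_integral_marchaud:
  "AE y in lborel. y < X \<longrightarrow>
     (LINT z|lborel. N z * power_kernel (1 - b) (y - z)) = Gamma b * Gamma (1 - b) * u y"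
proof -
  define a where "a = 1 - b"
  define c where "c = Gamma b * Gamma (1 - b)"
  have a: "0 < a" "a < 1" using b_pos b_less_1 by (auto simp: a_def)
  have c: "0 < c" using b_pos b_less_1 by (simp add: c_def)
  let ?k = "power_kernel a"
  let ?R = "\<lambda>x y v. u y * (?k v * power_kernel b (x - y - v))"
  let ?P = "\<lambda>x z y. N z * ?k (y - z) * indicator {..x} y"
  let ?G = "\<lambda>x z v. N z * ?k v * indicator {..x} (z + v)"
  define w where "w y = (LINT z|lborel. N z * ?k (y - z))" for y
  have intN: "integrable lborel N"
    by (rule integrable_marchaud) simp
  have Nneg: "N z = 0" if "z < 0" for z
    using marchaud_neg[OF that] by simp
  have [measurable]: "w \<in> borel_measurable borel"
    unfolding w_def by measurable
  have fin: "(\<integral>\<^sup>+z. (\<integral>\<^sup>+v. ennreal \<bar>?G X z v\<bar> \<partial>lborel) \<partial>lborel) < \<infinity>"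
  proof -
    define m where "m = (max 0 X) powr (1 - a) / (1 - a)"
    have "(\<integral>\<^sup>+v. ennreal \<bar>?G X z v\<bar> \<partial>lborel) \<le> ennreal m * ennreal \<bar>N z\<bar>" for z
    proof (cases "z < 0")
      case False
      have "(\<integral>\<^sup>+v. ennreal \<bar>?G X z v\<bar> \<partial>lborel) \<le>
         (\<integral>\<^sup>+v. ennreal \<bar>N z\<bar> * ennreal (?k v * indicator {..max 0 X} v) \<partial>lborel)"
        using False
        by (intro nn_integral_mono) (auto simp: ennreal_mult'[symmetric] abs_mult indicator_def intro!: ennreal_leI)
      also have "\<dots> = ennreal \<bar>N z\<bar> * ennreal m"
        using a by (subst nn_integral_cmult) (auto simp: nn_integral_power_kernel_atMost m_def)
      finally show ?thesis by (simp add: mult.commute)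
    qed (simp add: Nneg)
    then have "(\<integral>\<^sup>+z. (\<integral>\<^sup>+v. ennreal \<bar>?G X z v\<bar> \<partial>lborel) \<partial>lborel) \<le>
        (\<integral>\<^sup>+z. ennreal m * ennreal \<bar>N z\<bar> \<partial>lborel)"
      by (intro nn_integral_mono)
    also have "\<dots> = ennreal m * (\<integral>\<^sup>+z. ennreal \<bar>N z\<bar> \<partial>lborel)"
      by (rule nn_integral_cmult) simp
    also have "\<dots> < \<infinity>"
      using intN by (simp add: ennreal_mult_less_top integrable_iff_bounded)
    finally show ?thesis .
  qed
  have fin': "(\<integral>\<^sup>+z. (\<integral>\<^sup>+v. ennreal \<bar>?G x z v\<bar> \<partial>lborel) \<partial>lborel) < \<infinity>"
    if "x \<le> X" for x
    by (rule le_less_trans[OF _ fin]) (use that in \<open>auto intro!: nn_integral_mono simp: abs_mult indicator_def\<close>)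
  have shiftnn: "(\<integral>\<^sup>+y. ennreal \<bar>?P x z y\<bar> \<partial>lborel) =
      (\<integral>\<^sup>+v. ennreal \<bar>?G x z v\<bar> \<partial>lborel)" for x z
    by (subst nn_integral_real_affine[of _ 1 z]) auto
  have shift: "(LINT y|lborel. ?P x z y) =
      (LINT v|lborel. ?G x z v)" for x z
    by (subst lborel_integral_real_affine[of 1 _ z]) simp_all
  have int1: "integrable (lborel \<Otimes>\<^sub>M lborel) (\<lambda>(z, y). ?P x z y)" if "x \<le> X" for x
  proof (rule integrable_pair_lborel)
    show "(\<integral>\<^sup>+z. (\<integral>\<^sup>+y. ennreal \<bar>?P x z y\<bar> \<partial>lborel) \<partial>lborel) < \<infinity>"
      using fin'[OF that] by (simp only: shiftnn)
  qed (simp add: indicator_def)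
  have int2: "integrable (lborel \<Otimes>\<^sub>M lborel) (\<lambda>(z, v). ?G x z v)" if "x \<le> X" for x
    by (rule integrable_pair_lborel) (use fin'[OF that] in \<open>simp_all add: indicator_def\<close>)
  have int3: "integrable (lborel \<Otimes>\<^sub>M lborel) (\<lambda>(y, v). ?R x y v)" for x
  proof (rule integrable_pair_lborel)
    have "(\<integral>\<^sup>+v. ennreal \<bar>?R x y v\<bar> \<partial>lborel) \<le> ennreal (\<bar>u y * indicator {..x} y\<bar> * c)" for y
    proof (cases "y < x")
      case True
      have "(\<integral>\<^sup>+v. ennreal \<bar>?R x y v\<bar> \<partial>lborel) =
          ennreal \<bar>u y\<bar> * (\<integral>\<^sup>+v. ennreal (?k v * power_kernel b (x - y - v)) \<partial>lborel)"
        by (subst nn_integral_cmult[symmetric]) (auto simp: ennreal_mult'[symmetric] abs_mult)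
      also have "(\<integral>\<^sup>+v. ennreal (?k v * power_kernel b (x - y - v)) \<partial>lborel) = c"
        using nn_integral_power_kernel_Beta[of a "x - y"] a True by (simp add: a_def c_def mult.commute)
      finally show ?thesis using True by (simp add: ennreal_mult')
    next
      case False
      then have "?R x y v = 0" for v
        by (cases "v > 0") auto
      then have "(\<integral>\<^sup>+v. ennreal \<bar>?R x y v\<bar> \<partial>lborel) = (\<integral>\<^sup>+(v::real). 0 \<partial>lborel)"
        by (simp only: abs_zero ennreal_0)
      then show ?thesis by simp
    qed
    then have "(\<integral>\<^sup>+y. \<integral>\<^sup>+v. ennreal \<bar>?R x y v\<bar> \<partial>lborel \<partial>lborel) \<le>
        (\<integral>\<^sup>+y. ennreal (\<bar>u y * indicator {..x} y\<bar> * c) \<partial>lborel)"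
      by (intro nn_integral_mono)
    also have "\<dots> < \<infinity>"
      using integrable_u_atMost[of x] c by (simp add: integrable_iff_bounded ennreal_mult'' nn_integral_multc ennreal_mult_less_top)
    finally show "(\<integral>\<^sup>+y. \<integral>\<^sup>+v. ennreal \<bar>?R x y v\<bar> \<partial>lborel \<partial>lborel) < \<infinity>" .
  qed simp
  have beta: "(LINT v|lborel. ?R x y v) = u y * indicator {..<x} y * c" for x y
  proof (cases "y < x")
    case True
    have "(LINT v|lborel. ?k v * power_kernel b (x - y - v)) = c"
      using nn_integral_power_kernel_Beta[of a "x - y"] a True c
      by (intro integral_eq_nn_integral[THEN trans]) (auto simp: a_def c_def mult.commute)
    then show ?thesis using True by simp
  next
    case False
    then have "?R x y v = 0" for v
      by (cases "v > 0") auto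
    then have "(LINT v|lborel. ?R x y v) = (LINT (v::real)|lborel. 0)"
      by (simp only:)
    then show ?thesis using False by simp
  qed
  have wint: "integrable lborel (\<lambda>y. w y * indicator {..X} y)"
    using lborel_pair.integrable_snd[OF int1[OF order_refl]] by (simp add: w_def)
  have eq: "(LINT y|lborel. (w y * indicator {..X} y) * indicator {..x} y) =
      (LINT y|lborel. (c * (u y * indicator {..X} y)) * indicator {..x} y)" if x: "x < X" for x
  proof -
    have "(LINT y|lborel. (w y * indicator {..X} y) * indicator {..x} y) =
        (LINT y|lborel. LINT z|lborel. ?P x z y)"
      using x by (intro Bochner_Integration.integral_cong) (auto simp: w_def indicator_def)
    also have "\<dots> = (LINT z|lborel. LINT y|lborel. ?P x z y)"
      by (rule lborel_pair.Fubini_integral[OF int1]) (use x in simp)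
    also have "\<dots> = (LINT z|lborel. LINT v|lborel. ?G x z v)"
      by (simp only: shift)
    also have "\<dots> = (LINT v|lborel. LINT z|lborel. ?G x z v)"
      by (rule lborel_pair.Fubini_integral[OF int2, symmetric]) (use x in simp)
    also have "\<dots> = (LINT v|lborel. LINT y|lborel. ?R x y v)"
    proof (rule Bochner_Integration.integral_cong[OF refl])
      fix v
      \<comment> \<open>For fixed \<open>v > 0\<close> the constraint \<open>z + v \<le> x\<close>
        reads \<open>z \<le> x - v\<close>, and \<open>x - v < X\<close>, so
        \<open>integral_marchaud\<close> is available at \<open>x - v\<close>.\<close>
      show "(LINT z|lborel. ?G x z v) =
          (LINT y|lborel. ?R x y v)"
      proof (cases "v > 0")
        case True
        have "(LINT z|lborel. ?G x z v) =
            (LINT z|lborel. ?k v * (marchaud b u z * indicator {..x - v} z))"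
          using x True by (intro Bochner_Integration.integral_cong) (auto simp: indicator_def)
        also have "\<dots> = ?k v * (LINT y|lborel. u y * power_kernel b (x - v - y))"
          using x True by (simp add: integral_marchaud)
        also have "\<dots> = (LINT y|lborel. ?k v * (u y * power_kernel b (x - y - v)))"
        proof -
          have "x - v - y = x - y - v" for y by simp
          then show ?thesis by (simp only: integral_mult_right_zero)
        qed
        finally show ?thesis
          by (simp only: mult.left_commute)
      qed simp
    qed
    also have "\<dots> = (LINT y|lborel. LINT v|lborel. ?R x y v)"
      by (rule lborel_pair.Fubini_integral[OF int3])
    also have "\<dots> = (LINT y|lborel. u y * indicator {..<x} y * c)"
      by (simp only: beta)
    also have "\<dots> = (LINT y|lborel. (c * (u y * indicator {..X} y)) * indicator {..x} y)"
      using x by (intro integral_cong_AE eventually_mono[OF AE_lborel_singleton[of x]]) (auto simp: indicator_def)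
    finally show ?thesis .
  qed
  have uint: "integrable lborel (\<lambda>y. c * (u y * indicator {..X} y))"
    using integrable_u_atMost by (rule integrable_mult_right)
  show ?thesis
    using AE_has_derivative_indefinite_integral[OF wint] AE_has_derivative_indefinite_integral[OF uint]
  proof eventually_elim
    case (elim y)
    show ?case
    proof
      assume y: "y < X"
      have "((\<lambda>x. LINT y|lborel. (c * (u y * indicator {..X} y)) * indicator {..x} y)
          has_real_derivative w y * indicator {..X} y) (at y)"
        using elim(1) by (rule has_field_derivative_transform_within_open[of _ _ _ "{..<X}"]) (use y eq in auto)
      from DERIV_unique[OF this elim(2)] show "(LINT z|lborel. N z * power_kernel (1 - b) (y - z)) = Gamma b * Gamma (1 - b) * u y"
        using y by (simp add: w_def a_def c_def)
    qed
  qed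
qed

end

section \<open>Fractional derivatives of a frozen Hoelder path\<close>

locale holder_path =
  fixes g :: "real \<Rightarrow> real" and t L \<eta> a :: real
  assumes t_pos: "0 < t" and L_nonneg: "0 \<le> L"
    and a_pos: "0 < a" and a_less: "a < \<eta>" and a_less_1: "a < 1"
    and holder: "\<And>x y. \<bar>g x - g y\<bar> \<le> L * \<bar>x - y\<bar> powr \<eta>"
    and const_left: "\<And>x. x \<le> 0 \<Longrightarrow> g x = g 0" and const_right: "\<And>x. t \<le> x \<Longrightarrow> g x = g t"
begin

text \<open>Reversing time turns the right-sided fractional derivative of \<open>g(t) - g\<close> at \<open>x\<close> into the
  left-sided one of \<open>reversed\<close> at \<open>t - x\<close>.\<close>

definition reversed :: "real \<Rightarrow> real" where
  "reversed y = g t - g (t - y)"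

lemma continuous_g: "continuous_on UNIV g"
proof (rule continuous_at_imp_continuous_on, intro ballI)
  fix x
  have "((\<lambda>y. L * \<bar>y - x\<bar> powr \<eta>) \<longlongrightarrow> L * \<bar>x - x\<bar> powr \<eta>) (at x)"
    using a_pos a_less by (intro tendsto_intros) (auto intro!: always_eventually)
  then have "((\<lambda>y. g y - g x) \<longlongrightarrow> 0) (at x)"
    using holder by (intro Lim_null_comparison[of "\<lambda>y. g y - g x"]) (auto intro!: always_eventually)
  then show "isCont g x"
    by (simp add: isCont_def LIM_zero_iff)
qed

lemma measurable_g [measurable]: "g \<in> borel_measurable borel"
  using continuous_g by (rule borel_measurable_continuous_onI)

lemma measurable_reversed [measurable]: "reversed \<in> borel_measurable borel"
  unfolding reversed_def[abs_def] by measurable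

lemma continuous_reversed: "continuous_on UNIV reversed"
  unfolding reversed_def[abs_def]
  by (intro continuous_intros continuous_on_compose2[OF continuous_g]) auto

lemma reversed_nonpos: "y \<le> 0 \<Longrightarrow> reversed y = 0"
  using const_right[of "t - y"] by (simp add: reversed_def)

definition bnd :: real where "bnd = L * t powr \<eta>"

lemma bnd_nonneg: "0 \<le> bnd"
  using L_nonneg by (simp add: bnd_def)

lemma reversed_bounded: "\<bar>reversed y\<bar> \<le> bnd"
proof -
  define z where "z = max 0 (min t (t - y))"
  have "g (t - y) = g z"
    using const_left[of "t - y"] const_right[of "t - y"] t_pos
    by (auto simp: z_def max_def min_def)
  then have "\<bar>reversed y\<bar> \<le> L * \<bar>t - z\<bar> powr \<eta>"
    using holder[of t z] by (simp add: reversed_def)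
  also have "\<dots> \<le> L * t powr \<eta>"
    using L_nonneg a_pos a_less t_pos by (intro mult_left_mono powr_mono2) (auto simp: z_def)
  finally show ?thesis by (simp add: bnd_def)
qed

lemma reversed_holder: "\<bar>reversed x - reversed y\<bar> \<le> L * \<bar>x - y\<bar> powr \<eta>"
  using holder[of "t - y" "t - x"] by (simp add: reversed_def abs_minus_commute)

text \<open>A majorant of the integrand of \<open>marchaud a reversed y\<close>, uniform in
  \<open>y\<close>. Near 0 the Hoelder bound lowers the exponent to
  \<open>1 + a - \<eta> < 1\<close>; beyond 1 mere boundedness leaves the exponent
  \<open>1 + a > 1\<close>. Both pieces are integrable.\<close>

definition dominant :: "real \<Rightarrow> real" where
  "dominant r = L * (power_kernel (1 + a - \<eta>) r * indicator {..1} r) + 2 * bnd * (power_kernel (1 + a) r * indicator {1<..} r)"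

lemma dominant_nonneg: "0 \<le> dominant r"
  using L_nonneg bnd_nonneg by (simp add: dominant_def)

lemma integrable_dominant: "integrable lborel dominant"
  unfolding dominant_def[abs_def]
proof (intro Bochner_Integration.integrable_add integrable_mult_right)
  show "integrable lborel (\<lambda>r. power_kernel (1 + a - \<eta>) r * indicator {..1} r)"
    using nn_integral_power_kernel_atMost[of "1 + a - \<eta>" 1] a_less
    by (intro integrableI_bounded) (auto simp: abs_mult)
  show "integrable lborel (\<lambda>r. power_kernel (1 + a) r * indicator {1<..} r)"
    using nn_integral_power_kernel_atLeast[of "1 + a" 1] a_pos
    by (intro integrableI_bounded) (auto simp: abs_mult)
qed

lemma difference_le_dominant:
  "\<bar>(reversed y - reversed (y - r)) * power_kernel (1 + a) r\<bar> \<le> dominant r"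
proof (cases "0 < r \<and> r \<le> 1")
  case True
  have "\<bar>(reversed y - reversed (y - r)) * power_kernel (1 + a) r\<bar> \<le> L * r powr \<eta> * power_kernel (1 + a) r"
    using reversed_holder[of y "y - r"] True by (auto simp: abs_mult intro!: mult_right_mono)
  also have "\<dots> = L * power_kernel (1 + a - \<eta>) r"
    using True by (simp add: power_kernel_def powr_add[symmetric] algebra_simps)
  finally show ?thesis using True by (simp add: dominant_def)
next
  case False
  have "\<bar>reversed y - reversed (y - r)\<bar> \<le> 2 * bnd"
    using reversed_bounded[of y] reversed_bounded[of "y - r"] by linarith
  then have "\<bar>(reversed y - reversed (y - r)) * power_kernel (1 + a) r\<bar> \<le> 2 * bnd * power_kernel (1 + a) r"
    by (auto simp: abs_mult intro!: mult_right_mono)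
  then show ?thesis using False
    by (cases "r \<le> 0") (auto simp: dominant_def)
qed

lemma marchaud_reversed_bounded: "\<bar>marchaud a reversed y\<bar> \<le> a * (LINT r|lborel. dominant r)"
proof -
  have "norm (LINT r|lborel. (reversed y - reversed (y - r)) * power_kernel (1 + a) r) \<le> (LINT r|lborel. dominant r)"
  proof -
    have int: "integrable lborel (\<lambda>r. (reversed y - reversed (y - r)) * power_kernel (1 + a) r)"
      by (rule Bochner_Integration.integrable_bound[OF integrable_dominant])
        (use difference_le_dominant[of y] dominant_nonneg in auto)
    show ?thesis
      using difference_le_dominant[of y] int
      by (intro order_trans[OF integral_norm_bound integral_mono] integrable_norm integrable_dominant) auto
  qed
  then show ?thesis
    using a_pos by (simp add: marchaud_def abs_mult)
qed

lemma continuous_marchaud_reversed: "continuous_on UNIV (marchaud a reversed)"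
proof -
  have "isCont (\<lambda>y. LINT r|lborel. (reversed y - reversed (y - r)) * power_kernel (1 + a) r) x" for x
    unfolding continuous_at_sequentially comp_def
  proof (intro allI impI)
    fix X :: "nat \<Rightarrow> real" assume X: "X \<longlonglongrightarrow> x"
    have c: "(\<lambda>n. reversed (X n - r)) \<longlonglongrightarrow> reversed (x - r)" for r
      using continuous_reversed X
      by (intro continuous_on_tendsto_compose[of UNIV reversed]) (auto intro!: tendsto_intros)
    show "(\<lambda>n. LINT r|lborel. (reversed (X n) - reversed (X n - r)) * power_kernel (1 + a) r)
        \<longlonglongrightarrow> (LINT r|lborel. (reversed x - reversed (x - r)) * power_kernel (1 + a) r)"
    proof (rule integral_dominated_convergence[where w = dominant])
      show "AE r in lborel. (\<lambda>n. (reversed (X n) - reversed (X n - r)) * power_kernel (1 + a) r)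
          \<longlonglongrightarrow> (reversed x - reversed (x - r)) * power_kernel (1 + a) r"
        using c[of 0] c by (auto intro!: always_eventually tendsto_intros)
    qed (use difference_le_dominant integrable_dominant in auto)
  qed
  then have "isCont (\<lambda>y. marchaud a reversed y) x" for x
    unfolding marchaud_def by (intro continuous_intros)
  then show ?thesis
    by (auto intro: continuous_at_imp_continuous_on)
qed

lemma marchaud_function_reversed: "marchaud_function reversed a Y bnd"
proof
  let ?f = "\<lambda>y r. \<bar>reversed y - reversed (y - r)\<bar> * power_kernel (1 + a) r * indicator {..Y} y"
  have "(\<integral>\<^sup>+r. ennreal (?f y r) \<partial>lborel)
      \<le> (\<integral>\<^sup>+r. ennreal (dominant r) \<partial>lborel) * indicator {0..Y} y" for y
  proof (cases "0 \<le> y \<and> y \<le> Y")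
    case True
    then show ?thesis
      using difference_le_dominant[of y] by (auto simp: abs_mult intro!: nn_integral_mono ennreal_leI)
  next
    case False
    then have "?f y r = 0" for r
      using reversed_nonpos[of y] reversed_nonpos[of "y - r"] by (cases "0 < r") (auto simp: indicator_def)
    then have "(\<integral>\<^sup>+r. ennreal (?f y r) \<partial>lborel)
        = (\<integral>\<^sup>+(r::real). 0 \<partial>lborel)"
      by (simp only: ennreal_0)
    then show ?thesis by simp
  qed
  then have "(\<integral>\<^sup>+y. (\<integral>\<^sup>+r. ennreal (?f y r) \<partial>lborel) \<partial>lborel)
      \<le> (\<integral>\<^sup>+y. (\<integral>\<^sup>+r. ennreal (dominant r) \<partial>lborel) * indicator {0..Y} y \<partial>lborel)"
    by (intro nn_integral_mono)
  also have "\<dots> = (\<integral>\<^sup>+r. ennreal (dominant r) \<partial>lborel) * emeasure lborel {0..Y}"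
    by (simp add: nn_integral_cmult)
  also have "\<dots> < \<infinity>"
    using integrable_dominant dominant_nonneg by (simp add: integrable_iff_bounded ennreal_mult_less_top emeasure_lborel_Icc_eq)
  finally show "(\<integral>\<^sup>+y. (\<integral>\<^sup>+r. ennreal (?f y r) \<partial>lborel) \<partial>lborel) < \<infinity>" .
qed (use reversed_bounded reversed_nonpos a_pos a_less_1 in auto)

text \<open>At \<open>t - x\<close> with \<open>0 < x < t\<close> this is the integral over
  \<open>{x..t}\<close> whose derivative enters \<open>frac_deriv_right\<close> of order
  \<open>a\<close> for \<open>g t - g\<close>.\<close>

definition kernel_integral :: "real \<Rightarrow> real" where
  "kernel_integral z = (LINT y|lborel. reversed y * power_kernel a (z - y))"

lemma has_derivative_kernel_integral:
  "(kernel_integral has_real_derivative marchaud a reversed z) (at z)"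
proof -
  interpret marchaud_function reversed a "z + 1" bnd by (rule marchaud_function_reversed)
  show ?thesis
    unfolding kernel_integral_def[abs_def]
    by (rule has_derivative_power_kernel_integral[OF continuous_marchaud_reversed]) simp
qed

lemma measurable_kernel_integral [measurable]: "kernel_integral \<in> borel_measurable borel"
  unfolding kernel_integral_def[abs_def] by measurable

text \<open>The Lipschitz constant later dominates the difference quotients in
  \<open>gls_integral_limit\<close>.\<close>

lemma kernel_integral_lipschitz:
  "\<bar>kernel_integral x - kernel_integral y\<bar> \<le> a * (LINT r|lborel. dominant r) * \<bar>x - y\<bar>"
  using field_differentiable_bound[of UNIV kernel_integral "marchaud a reversed" "a * (LINT r|lborel. dominant r)" x y]
    has_derivative_kernel_integral marchaud_reversed_bounded
  by (simp add: has_field_derivative_at_within)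

end

text \<open>Let \<open>N\<close> be the truncated Marchaud derivative of \<open>u\<close> and
  \<open>K\<close> the kernel integral of the reversed path. Fubini moves the kernel inside
  \<open>K\<close> onto \<open>N\<close>, where the inversion formula turns it into
  \<open>u\<close>: the integral of \<open>N x * K (t - x - \<epsilon>)\<close> is \<open>c\<close>
  times that of \<open>u y * reversed (t - y - \<epsilon>)\<close>, and
  \<open>reversed (t - y - \<epsilon>) = g t - g (y + \<epsilon>)\<close>. In difference quotients
  with respect to \<open>\<epsilon>\<close>, one side converges through the derivative of
  \<open>K\<close> and the other consists of the quotients of \<open>g\<close>.\<close>

lemma gls_integral_limit:
  assumes "holder_path g t L \<eta> (1 - b)" and "marchaud_function u b (t + 1) C"
    and e: "e \<longlonglongrightarrow> 0" "\<And>n. e n \<noteq> 0" "\<And>n. \<bar>e n\<bar> < 1"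
  shows "(\<lambda>n. LINT y|lborel. u y * (g (y + e n) - g y) / e n) \<longlonglongrightarrow>
      (LINT x|lborel. marchaud b u x * marchaud (1 - b) (holder_path.reversed g t) (t - x) * indicator {0..t} x)
         / (Gamma b * Gamma (1 - b))"
    and "integrable lborel (\<lambda>x. marchaud b u x * marchaud (1 - b) (holder_path.reversed g t) (t - x) * indicator {0..t} x)"
proof -
  interpret h: holder_path g t L \<eta> "1 - b" by fact
  interpret u: marchaud_function u b "t + 1" C by fact
  let ?v = "holder_path.reversed g t" and ?K = "holder_path.kernel_integral g t (1 - b)"
  let ?k = "power_kernel (1 - b)"
  let ?N = "\<lambda>y. marchaud b u y * indicator {..t + 1} y"
  let ?p = "\<lambda>x. marchaud b u x * marchaud (1 - b) ?v (t - x) * indicator {0..t} x"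
  let ?q = "\<lambda>n x. ?N x * ((?K (t - x - e n) - ?K (t - x)) / e n)"
  let ?G = "\<lambda>\<epsilon> x w. ?N x * ?v (t - \<epsilon> - w) * ?k (w - x)"
  define c where "c = Gamma b * Gamma (1 - b)"
  have c: "0 < c" using u.b_pos u.b_less_1 by (simp add: c_def)
  have intN: "integrable lborel ?N"
    by (rule u.integrable_marchaud) simp
  have Nneg: "?N z = 0" if "z < 0" for z
    using u.marchaud_neg[OF that] by simp
  define D where "D = (1 - b) * (LINT r|lborel. h.dominant r)"
  have rep: "(LINT x|lborel. ?N x * ?K (t - x - \<epsilon>)) = c * (LINT y|lborel. u y * ?v (t - y - \<epsilon>))"
    and int_rep: "integrable lborel (\<lambda>x. ?N x * ?K (t - x - \<epsilon>))"
    if \<epsilon>: "\<bar>\<epsilon>\<bar> < 1" for \<epsilon>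
  proof -
    have sub: "(LINT w|lborel. ?G \<epsilon> x w) = ?N x * ?K (t - x - \<epsilon>)" for x
    proof -
      have "(LINT w|lborel. ?G \<epsilon> x w) =
          (LINT y|lborel. ?N x * (?v y * ?k (t - x - \<epsilon> - y)))"
        by (subst lborel_integral_real_affine[of "-1" _ "t - \<epsilon>"]) (simp_all add: algebra_simps)
      then show ?thesis by (simp only: integral_mult_right_zero h.kernel_integral_def)
    qed
    have int: "integrable (lborel \<Otimes>\<^sub>M lborel) (\<lambda>(x, w). ?G \<epsilon> x w)"
    proof (rule integrable_pair_lborel)
      \<comment> \<open>For \<open>x \<ge> 0\<close> and \<open>\<bar>\<epsilon>\<bar> < 1\<close>
        the argument \<open>t - \<epsilon> - x - r\<close> is negative once
        \<open>r > t + 1\<close>, and there \<open>reversed\<close> vanishes. So the kernel is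
        integrated over \<open>{..t + 1}\<close> only, with value \<open>m\<close>.\<close>
      define m where "m = (t + 1) powr b / b"
      have "(\<integral>\<^sup>+w. ennreal \<bar>?G \<epsilon> x w\<bar> \<partial>lborel) \<le> ennreal (h.bnd * m) * ennreal \<bar>?N x\<bar>" for x
      proof (cases "0 \<le> x")
        case True
        have "(\<integral>\<^sup>+w. ennreal \<bar>?G \<epsilon> x w\<bar> \<partial>lborel) =
            (\<integral>\<^sup>+r. ennreal \<bar>?N x * ?v (t - \<epsilon> - x - r) * ?k r\<bar> \<partial>lborel)"
          by (subst nn_integral_real_affine[of _ 1 x]) (simp_all add: algebra_simps)
        also have "\<dots> \<le> (\<integral>\<^sup>+r. ennreal (h.bnd * \<bar>?N x\<bar>) * ennreal (?k r * indicator {..t + 1} r) \<partial>lborel)"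
        proof (rule nn_integral_mono)
          fix r
          have "\<bar>?v (t - \<epsilon> - x - r)\<bar> \<le> h.bnd * indicator {..t + 1} r"
            using h.reversed_bounded[of "t - \<epsilon> - x - r"] h.reversed_nonpos[of "t - \<epsilon> - x - r"] \<epsilon> True
            by (auto simp: indicator_def)
          then have "\<bar>?N x\<bar> * \<bar>?v (t - \<epsilon> - x - r)\<bar> * ?k r \<le> \<bar>?N x\<bar> * (h.bnd * indicator {..t + 1} r) * ?k r"
            by (intro mult_right_mono mult_left_mono) auto
          then show "ennreal \<bar>?N x * ?v (t - \<epsilon> - x - r) * ?k r\<bar> \<le> ennreal (h.bnd * \<bar>?N x\<bar>) * ennreal (?k r * indicator {..t + 1} r)"
            using h.bnd_nonneg by (subst ennreal_mult'[symmetric]) (auto simp: abs_mult mult_ac intro!: ennreal_leI)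
        qed
        also have "\<dots> = ennreal (h.bnd * \<bar>?N x\<bar>) * ennreal m"
          using u.b_pos h.t_pos by (subst nn_integral_cmult) (auto simp: nn_integral_power_kernel_atMost m_def)
        finally show ?thesis
          using h.bnd_nonneg u.b_pos by (simp add: ennreal_mult'[symmetric] m_def mult_ac)
      qed (simp add: Nneg)
      then have "(\<integral>\<^sup>+x. \<integral>\<^sup>+w. ennreal \<bar>?G \<epsilon> x w\<bar> \<partial>lborel \<partial>lborel) \<le>
          (\<integral>\<^sup>+x. ennreal (h.bnd * m) * ennreal \<bar>?N x\<bar> \<partial>lborel)"
        by (intro nn_integral_mono)
      also have "\<dots> = ennreal (h.bnd * m) * (\<integral>\<^sup>+x. ennreal \<bar>?N x\<bar> \<partial>lborel)"
        by (rule nn_integral_cmult) simp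
      also have "\<dots> < \<infinity>"
        using intN by (simp add: ennreal_mult_less_top integrable_iff_bounded)
      finally show "(\<integral>\<^sup>+x. \<integral>\<^sup>+w. ennreal \<bar>?G \<epsilon> x w\<bar> \<partial>lborel \<partial>lborel) < \<infinity>" .
    qed simp
    show "integrable lborel (\<lambda>x. ?N x * ?K (t - x - \<epsilon>))"
      using lborel_pair.integrable_fst'[OF int] by (simp add: sub)
    have "(LINT x|lborel. ?N x * ?K (t - x - \<epsilon>)) = (LINT x|lborel. LINT w|lborel. ?G \<epsilon> x w)"
      by (simp only: sub)
    also have "\<dots> = (LINT w|lborel. LINT x|lborel. ?G \<epsilon> x w)"
      by (rule lborel_pair.Fubini_integral[OF int, symmetric])
    also have "\<dots> = (LINT w|lborel. c * (u w * ?v (t - w - \<epsilon>)))"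
    proof (rule integral_cong_AE)
      have eq: "(LINT x|lborel. ?G \<epsilon> x w) = ?v (t - w - \<epsilon>) * (LINT x|lborel. ?N x * ?k (w - x))" for w
      proof -
        have "t - \<epsilon> - w = t - w - \<epsilon>" by simp
        then have "?G \<epsilon> x w = ?v (t - w - \<epsilon>) * (?N x * ?k (w - x))" for x
          by (simp only: mult_ac)
        then show ?thesis by (simp only: integral_mult_right_zero)
      qed
      \<comment> \<open>The inversion formula holds below \<open>t + 1\<close>. From
        \<open>t + 1\<close> on, \<open>t - w - \<epsilon> < 0\<close> and both sides vanish: here
        the cut-off at \<open>t + 1\<close> meets the restriction to shifts below 1.\<close>
      show "AE w in lborel. (LINT x|lborel. ?G \<epsilon> x w) = c * (u w * ?v (t - w - \<epsilon>))"
        using u.AE_power_kernel_integral_marchaud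
      proof eventually_elim
        case (elim w)
        then show ?case
          unfolding eq using h.reversed_nonpos[of "t - w - \<epsilon>"] \<epsilon>
          by (cases "w < t + 1") (auto simp: c_def)
      qed
    qed simp_all
    finally show "(LINT x|lborel. ?N x * ?K (t - x - \<epsilon>)) = c * (LINT y|lborel. u y * ?v (t - y - \<epsilon>))"
      by simp
  qed
  have quot: "(\<lambda>n. LINT x|lborel. ?q n x)
      \<longlonglongrightarrow> (LINT x|lborel. ?N x * - marchaud (1 - b) ?v (t - x))"
  proof (rule integral_dominated_convergence[where w = "\<lambda>x. D * \<bar>?N x\<bar>"])
    show "AE x in lborel. norm (?q n x) \<le> D * \<bar>?N x\<bar>" for n
    proof (intro AE_I2)
      fix x
      have "\<bar>(?K (t - x - e n) - ?K (t - x)) / e n\<bar> \<le> D"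
        using h.kernel_integral_lipschitz[of "t - x - e n" "t - x"] e(2)[of n]
        by (simp add: D_def abs_divide divide_le_eq)
      then have "\<bar>?N x\<bar> * \<bar>(?K (t - x - e n) - ?K (t - x)) / e n\<bar> \<le> \<bar>?N x\<bar> * D"
        by (intro mult_left_mono) auto
      then show "norm (?q n x) \<le> D * \<bar>?N x\<bar>"
        by (simp only: real_norm_def abs_mult mult.commute)
    qed
    show "AE x in lborel. (\<lambda>n. ?q n x) \<longlonglongrightarrow> ?N x * - marchaud (1 - b) ?v (t - x)"
    proof (intro AE_I2 tendsto_mult_left)
      fix x
      \<comment> \<open>The argument of \<open>K\<close> moves by \<open>- e n\<close>, hence the
        minus sign in the limit. It is cancelled later, because an increment of \<open>g\<close> is
        minus the corresponding increment of \<open>reversed\<close>.\<close>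
      have "((\<lambda>d. (?K (t - x + d) - ?K (t - x)) / d) \<longlongrightarrow> marchaud (1 - b) ?v (t - x)) (at 0)"
        using h.has_derivative_kernel_integral[of "t - x"] by (simp add: DERIV_def)
      moreover have "filterlim (\<lambda>n. - e n) (at 0) sequentially"
        using tendsto_minus[OF e(1)] e(2) by (intro filterlim_atI) auto
      ultimately have "(\<lambda>n. (?K (t - x + - e n) - ?K (t - x)) / - e n) \<longlonglongrightarrow> marchaud (1 - b) ?v (t - x)"
        by (rule filterlim_compose)
      from tendsto_minus[OF this] show "(\<lambda>n. (?K (t - x - e n) - ?K (t - x)) / e n) \<longlonglongrightarrow> - marchaud (1 - b) ?v (t - x)"
        by simp
    qed
    show "integrable lborel (\<lambda>x. D * \<bar>?N x\<bar>)"
      using intN by simp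
  qed simp_all
  have eq: "(LINT x|lborel. ?q n x) =
      - c * (LINT y|lborel. u y * (g (y + e n) - g y) / e n)" for n
  proof -
    have int_uv: "integrable lborel (\<lambda>y. u y * ?v (t - y - \<epsilon>))" if "\<bar>\<epsilon>\<bar> < 1" for \<epsilon>
    proof (rule Bochner_Integration.integrable_bound)
      show "integrable lborel (\<lambda>y. C * h.bnd * indicator {0..t + 1} y :: real)"
        by (simp add: integrable_indicator_iff emeasure_lborel_Icc_eq)
      have "norm (u y * ?v (t - y - \<epsilon>)) \<le> norm (C * h.bnd * indicator {0..t + 1} y :: real)" for y
      proof -
        have "\<bar>?v (t - y - \<epsilon>)\<bar> \<le> h.bnd * indicator {..t + 1} y"
          using h.reversed_bounded[of "t - y - \<epsilon>"] h.reversed_nonpos[of "t - y - \<epsilon>"] that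
          by (auto simp: indicator_def)
        from mult_mono[OF u.abs_u_le[of y] this] show ?thesis
          using u.C_nonneg h.bnd_nonneg
          by (cases "0 \<le> y"; cases "y \<le> t + 1") (simp_all add: abs_mult)
      qed
      then show "AE y in lborel. norm (u y * ?v (t - y - \<epsilon>)) \<le> norm (C * h.bnd * indicator {0..t + 1} y :: real)"
        by (simp add: integrable_indicator_iff emeasure_lborel_Icc_eq)
    qed simp
    have "(LINT x|lborel. ?q n x) =
       (LINT x|lborel. (?N x * ?K (t - x - e n) - ?N x * ?K (t - x - 0)) / e n)"
      by (intro Bochner_Integration.integral_cong) (auto simp: algebra_simps diff_divide_distrib)
    also have "\<dots> = (c * (LINT y|lborel. u y * ?v (t - y - e n)) - c * (LINT y|lborel. u y * ?v (t - y - 0))) / e n"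
      by (subst integral_divide_zero, subst Bochner_Integration.integral_diff)
        (use int_rep[of "e n"] int_rep[of 0] rep[of "e n"] rep[of 0] e(3)[of n] in auto)
    also have "\<dots> = c * (LINT y|lborel. (u y * ?v (t - y - e n) - u y * ?v (t - y - 0)) / e n)"
      by (subst integral_divide_zero, subst Bochner_Integration.integral_diff)
        (use int_uv[of "e n"] int_uv[of 0] e(3)[of n] in \<open>auto simp: algebra_simps\<close>)
    also have "(LINT y|lborel. (u y * ?v (t - y - e n) - u y * ?v (t - y - 0)) / e n) =
        (LINT y|lborel. - (u y * (g (y + e n) - g y) / e n))"
      by (intro Bochner_Integration.integral_cong) (auto simp: h.reversed_def algebra_simps minus_divide_left)
    finally show ?thesis by simp
  qed
  \<comment> \<open>\<open>N\<close> vanishes for \<open>x < 0\<close>, and the derivative of the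
    reversed path at \<open>t - x\<close> vanishes for \<open>x > t\<close>, so the whole-line
    product lives on \<open>{0..t}\<close>.\<close>
  have lim: "(LINT x|lborel. ?N x * - marchaud (1 - b) ?v (t - x)) =
      - (LINT x|lborel. ?p x)"
    and same: "?N x * marchaud (1 - b) ?v (t - x) = ?p x" for x
  proof -
    have z: "marchaud (1 - b) ?v y = 0" if "y < 0" for y
      by (rule marchaud_function.marchaud_neg[OF h.marchaud_function_reversed that])
    show same: "?N x * marchaud (1 - b) ?v (t - x) = ?p x" for x
      using z[of "t - x"] Nneg[of x] by (auto simp: indicator_def)
    show "(LINT x|lborel. ?N x * - marchaud (1 - b) ?v (t - x)) =
      - (LINT x|lborel. ?p x)"
      unfolding same[symmetric] by simp
  qed
  have "(\<lambda>n. - (1 / c) * (- c * (LINT y|lborel. u y * (g (y + e n) - g y) / e n))) \<longlonglongrightarrow>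
     - (1 / c) * (- (LINT x|lborel. ?p x))"
    using quot unfolding eq lim by (intro tendsto_mult_left)
  then show "(\<lambda>n. LINT y|lborel. u y * (g (y + e n) - g y) / e n) \<longlonglongrightarrow>
      (LINT x|lborel. ?p x)
         / (Gamma b * Gamma (1 - b))"
    using c by (simp add: c_def[symmetric])
  have "integrable lborel (\<lambda>x. ?N x * marchaud (1 - b) ?v (t - x))"
  proof (rule Bochner_Integration.integrable_bound[where f = "\<lambda>x. D * ?N x"])
    have "norm (?N x * marchaud (1 - b) ?v (t - x)) \<le> norm (D * ?N x)" for x
    proof -
      have "\<bar>marchaud (1 - b) ?v (t - x)\<bar> \<le> \<bar>D\<bar>"
        using h.marchaud_reversed_bounded[of "t - x"] by (simp add: D_def)
      from mult_left_mono[OF this abs_ge_zero[of "?N x"]] show ?thesis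
        by (simp only: real_norm_def abs_mult mult.commute)
    qed
    then show "AE x in lborel. norm (?N x * marchaud (1 - b) ?v (t - x)) \<le> norm (D * ?N x)"
      by simp
  qed (use intN in simp_all)
  then show "integrable lborel (\<lambda>x. ?p x)"
    unfolding same .
qed

section \<open>The generalized Lebesgue-Stieltjes integral as a forward limit\<close>

definition stopped :: "real \<Rightarrow> (real \<Rightarrow> 'a) \<Rightarrow> real \<Rightarrow> 'a" where
  "stopped t g x = g (max 0 (min t x))"

lemma stopped_eq: "0 \<le> x \<Longrightarrow> x \<le> t \<Longrightarrow> stopped t g x = g x"
  by (simp add: stopped_def)

lemma W2_measurable:
  "F \<in> W2 T b \<Longrightarrow> (\<lambda>x. indicator {0..T} x * F x) \<in> borel_measurable borel"
  by (simp add: W2_def borel_measurable_restrict_space_iff)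

text \<open>The cut-off creates jumps at 0 and at \<open>t\<close>. Pairs inside
  \<open>{0..t}\<close> give \<open>A\<close>, the double integral of the \<open>W2\<close> norm.
  Differences across 0 give \<open>\<bar>F y\<bar> * y powr (- b) / b\<close>, which up to
  \<open>1 / b\<close> is \<open>B\<close>, its single integral. Differences across \<open>t\<close>
  give at most \<open>C / b * (y - t) powr (- b)\<close>, recorded by \<open>E\<close> and
  integrable on \<open>{t..t + 1}\<close> as \<open>b < 1\<close>.\<close>

lemma marchaud_function_truncated:
  assumes F: "F \<in> W2 T b" and b: "0 < b" "b < 1" and t: "0 < t" "t \<le> T"
    and bounded: "\<And>x. 0 \<le> x \<Longrightarrow> x \<le> T \<Longrightarrow> \<bar>F x\<bar> \<le> C"
  shows "marchaud_function (\<lambda>x. indicator {0..t} x * F x) b (t + 1) C"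
proof
  define u where "u x = indicator {0..t} x * F x" for x
  let ?d = "\<lambda>y r. \<bar>u y - u (y - r)\<bar> * power_kernel (1 + b) r * indicator {..t + 1} y"
  \<comment> \<open>\<open>F\<close> is measurable relative to \<open>{0..T}\<close>; its extension
    by zero is Borel on the line.\<close>
  define F0 where "F0 x = indicator {0..T} x * F x" for x
  have [measurable]: "F0 \<in> borel_measurable borel"
    using W2_measurable[OF F] by (simp add: F0_def[abs_def])
  have "u = (\<lambda>x. indicator {0..t} x * F0 x)"
    using t by (auto simp: u_def F0_def indicator_def)
  then show u_meas [measurable]: "(\<lambda>x. indicator {0..t} x * F x) \<in> borel_measurable borel"
    by (simp add: u_def[abs_def])
  then have [measurable]: "u \<in> borel_measurable borel" by (simp add: u_def[abs_def])
  have C: "0 \<le> C" using bounded[of 0] t by linarith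
  have u_le: "\<bar>u x\<bar> \<le> C" for x
    using bounded[of x] C t by (simp add: u_def indicator_def)
  then show "\<bar>indicator {0..t} x * F x\<bar> \<le> C" for x by (simp add: u_def)
  show "indicator {0..t} x * F x = 0" if "x < 0" for x using that by simp
  define A where "A y = (\<integral>\<^sup>+s. ennreal (\<bar>F0 y - F0 s\<bar> / (y - s) powr (b + 1)) * indicator {0..y} s * indicator {0..T} y \<partial>lborel)" for y
  define B where "B y = ennreal (\<bar>F0 y\<bar> / y powr b) * indicator {0..T} y" for y
  define E where "E y = ennreal (power_kernel b (y - t) * indicator {..1} (y - t))" for y
  have [measurable]: "A \<in> borel_measurable borel" "B \<in> borel_measurable borel" "E \<in> borel_measurable borel"
  proof -
    have "A = (\<lambda>y. \<integral>\<^sup>+s. (if 0 \<le> s \<and> s \<le> y \<and> 0 \<le> y \<and> y \<le> T then ennreal (\<bar>F0 y - F0 s\<bar> / (y - s) powr (b + 1)) else 0) \<partial>lborel)"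
      unfolding A_def[abs_def] by (intro ext nn_integral_cong) (simp add: indicator_def)
    then show "A \<in> borel_measurable borel" by simp
    show "B \<in> borel_measurable borel" "E \<in> borel_measurable borel"
      unfolding B_def[abs_def] E_def[abs_def] by simp_all
  qed
  have "(\<integral>\<^sup>+y. A y \<partial>lborel) = (\<integral>\<^sup>+t\<in>{0..T}. (\<integral>\<^sup>+s\<in>{0..t}. ennreal (\<bar>F t - F s\<bar> / (t - s) powr (b + 1)) \<partial>lborel) \<partial>lborel)"
  proof (rule nn_integral_cong)
    fix y
    have "A y = (\<integral>\<^sup>+s. ennreal (\<bar>F y - F s\<bar> / (y - s) powr (b + 1)) * indicator {0..y} s * indicator {0..T} y \<partial>lborel)"
      unfolding A_def by (intro nn_integral_cong) (auto simp: F0_def indicator_def)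
    then show "A y = (\<integral>\<^sup>+s\<in>{0..y}. ennreal (\<bar>F y - F s\<bar> / (y - s) powr (b + 1)) \<partial>lborel) * indicator {0..T} y"
      by (cases "y \<in> {0..T}") simp_all
  qed
  moreover have "(\<integral>\<^sup>+y. B y \<partial>lborel) = (\<integral>\<^sup>+t\<in>{0..T}. ennreal (\<bar>F t\<bar> / t powr b) \<partial>lborel)"
    by (intro nn_integral_cong) (auto simp: B_def F0_def indicator_def)
  ultimately have AB: "(\<integral>\<^sup>+y. A y \<partial>lborel) < \<infinity>" "(\<integral>\<^sup>+y. B y \<partial>lborel) < \<infinity>"
    using F by (auto simp: W2_def norm_W2_def)
  have Efin: "(\<integral>\<^sup>+y. E y \<partial>lborel) < \<infinity>"
    unfolding E_def using b by (subst nn_integral_real_affine[of _ 1 t]) (auto simp: nn_integral_power_kernel_atMost)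
  have "AE y in lborel. y \<noteq> 0 \<and> y \<noteq> t"
    using AE_lborel_singleton[of 0] AE_lborel_singleton[of t] by eventually_elim simp
  then have "AE y in lborel. (\<integral>\<^sup>+r. ennreal (?d y r) \<partial>lborel)
      \<le> A y + ennreal (1 / b) * B y + ennreal (C / b) * E y"
  proof eventually_elim
    case (elim y)
    consider "y < 0" | "0 < y" "y < t" | "t < y" "y \<le> t + 1" | "t + 1 < y"
      using elim t by linarith
    then show ?case
    proof cases
      case 1
      then have "?d y r = 0" for r
        by (cases "0 < r") (auto simp: u_def)
      then have "(\<integral>\<^sup>+r. ennreal (?d y r) \<partial>lborel) = (\<integral>\<^sup>+(r::real). 0 \<partial>lborel)"
        by (simp only: ennreal_0)
      then show ?thesis by simp
    next
      case 2
      have "(\<integral>\<^sup>+r. ennreal (?d y r) \<partial>lborel) =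
         (\<integral>\<^sup>+r. ennreal (\<bar>F0 y - F0 (y - r)\<bar> * power_kernel (1 + b) r) * indicator {0..y} (y - r)
            + ennreal \<bar>F0 y\<bar> * ennreal (power_kernel (1 + b) r * indicator {y<..} r) \<partial>lborel)"
        using 2 t by (intro nn_integral_cong)
          (auto simp: u_def F0_def indicator_def ennreal_mult'[symmetric])
      also have "\<dots> = (\<integral>\<^sup>+r. ennreal (\<bar>F0 y - F0 (y - r)\<bar> * power_kernel (1 + b) r) * indicator {0..y} (y - r) \<partial>lborel)
            + ennreal \<bar>F0 y\<bar> * ennreal (y powr - b / b)"
        using 2 b by (subst nn_integral_add) (auto simp: nn_integral_cmult nn_integral_power_kernel_atLeast)
      also have "(\<integral>\<^sup>+r. ennreal (\<bar>F0 y - F0 (y - r)\<bar> * power_kernel (1 + b) r) * indicator {0..y} (y - r) \<partial>lborel) =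
          (\<integral>\<^sup>+s. ennreal (\<bar>F0 y - F0 s\<bar> * power_kernel (1 + b) (y - s)) * indicator {0..y} s \<partial>lborel)"
        by (subst nn_integral_real_affine[of _ "-1" y]) auto
      also have "\<dots> = A y"
        unfolding A_def
        proof (intro nn_integral_cong)
          fix s
          have "(y - s) powr - (1 + b) = 1 / (y - s) powr (b + 1)"
            by (simp only: powr_minus_divide add.commute)
          then show "ennreal (\<bar>F0 y - F0 s\<bar> * power_kernel (1 + b) (y - s)) * indicator {0..y} s =
              ennreal (\<bar>F0 y - F0 s\<bar> / (y - s) powr (b + 1)) * indicator {0..y} s * indicator {0..T} y"
            using 2 t by (auto simp: indicator_def power_kernel_def)
        qed
      also have "ennreal \<bar>F0 y\<bar> * ennreal (y powr - b / b) = ennreal (1 / b) * B y"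
        using 2 t b by (simp add: B_def ennreal_mult'[symmetric] powr_minus_divide)
      finally show ?thesis by simp
    next
      case 3
      have "(\<integral>\<^sup>+r. ennreal (?d y r) \<partial>lborel) \<le>
         (\<integral>\<^sup>+r. ennreal C * ennreal (power_kernel (1 + b) r * indicator {y - t<..} r) \<partial>lborel)"
      proof (rule nn_integral_mono_AE, rule eventually_mono[OF AE_lborel_singleton[of "y - t"]])
        fix r assume r: "r \<noteq> y - t"
        have "\<bar>u y - u (y - r)\<bar> \<le> C * indicator {y - t<..} r"
          using 3 u_le[of "y - r"] r by (auto simp: u_def indicator_def)
        from mult_right_mono[OF this power_kernel_nonneg[of "1 + b" r]]
        show "ennreal (?d y r) \<le> ennreal C * ennreal (power_kernel (1 + b) r * indicator {y - t<..} r)"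
          using C 3 by (auto simp: ennreal_mult'[symmetric] mult_ac intro!: ennreal_leI)
      qed
      also have "\<dots> = ennreal C * ennreal ((y - t) powr - b / b)"
        using 3 b by (simp add: nn_integral_cmult nn_integral_power_kernel_atLeast)
      also have "\<dots> = ennreal (C / b) * E y"
        using 3 b C by (simp add: E_def power_kernel_def ennreal_mult'[symmetric])
      finally show ?thesis by (simp add: add_increasing)
    qed simp
  qed
  then have "(\<integral>\<^sup>+y. (\<integral>\<^sup>+r. ennreal (?d y r) \<partial>lborel) \<partial>lborel)
      \<le> (\<integral>\<^sup>+y. A y + ennreal (1 / b) * B y + ennreal (C / b) * E y \<partial>lborel)"
    by (rule nn_integral_mono_AE)
  also have "\<dots> = (\<integral>\<^sup>+y. A y \<partial>lborel) + ennreal (1 / b) * (\<integral>\<^sup>+y. B y \<partial>lborel) + ennreal (C / b) * (\<integral>\<^sup>+y. E y \<partial>lborel)"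
    by (simp add: nn_integral_add nn_integral_cmult)
  also have "\<dots> < \<infinity>"
    using AB Efin by (simp add: ennreal_mult_less_top)
  finally show "(\<integral>\<^sup>+y. (\<integral>\<^sup>+r. ennreal (\<bar>indicator {0..t} y * F y - indicator {0..t} (y - r) * F (y - r)\<bar> * power_kernel (1 + b) r * indicator {..t + 1} y) \<partial>lborel) \<partial>lborel) < \<infinity>"
    by (simp add: u_def)
qed (use b in auto)

lemma holder_path_stopped:
  assumes t: "0 < t" "t \<le> T" and L: "0 \<le> L" and a: "0 < a" "a < \<eta>" "a < 1"
    and holder: "\<And>x y. 0 \<le> x \<Longrightarrow> x \<le> T \<Longrightarrow> 0 \<le> y \<Longrightarrow> y \<le> T \<Longrightarrow> \<bar>g x - g y\<bar> \<le> L * \<bar>x - y\<bar> powr \<eta>"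
  shows "holder_path (stopped t g) t L \<eta> a"
proof
  fix x y
  have "\<bar>stopped t g x - stopped t g y\<bar> \<le> L * \<bar>max 0 (min t x) - max 0 (min t y)\<bar> powr \<eta>"
    unfolding stopped_def using t by (intro holder) auto
  also have "\<dots> \<le> L * \<bar>x - y\<bar> powr \<eta>"
    using L a by (intro mult_left_mono powr_mono2) auto
  finally show "\<bar>stopped t g x - stopped t g y\<bar> \<le> L * \<bar>x - y\<bar> powr \<eta>" .
qed (use t L a in \<open>auto simp: stopped_def\<close>)

text \<open>Near an interior point the integrals in \<open>frac_deriv_left\<close> and
  \<open>frac_deriv_right\<close> agree with whole-line convolutions, so their derivatives are
  Marchaud derivatives: for almost every \<open>x\<close> in the case of \<open>F\<close>, for every
  \<open>x\<close> in the case of \<open>g\<close>. The minus sign of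
  \<open>frac_deriv_right\<close> cancels the one from differentiating in
  \<open>t - x\<close>.\<close>

lemma gls_integrand_eq_marchaud:
  assumes t: "0 < t" "t \<le> T"
    and "holder_path (stopped t g) t L \<eta> (1 - b)" and "marchaud_function (\<lambda>x. indicator {0..t} x * F x) b (t + 1) C"
  shows "AE x in lborel. 0 < x \<and> x < t \<longrightarrow> gls_integrand b t F g x =
    marchaud b (\<lambda>x. indicator {0..t} x * F x) x * marchaud (1 - b) (holder_path.reversed (stopped t g) t) (t - x) / (Gamma b * Gamma (1 - b))"
proof -
  interpret h: holder_path "stopped t g" t L \<eta> "1 - b" by fact
  interpret u: marchaud_function "\<lambda>x. indicator {0..t} x * F x" b "t + 1" C by fact
  let ?u = "\<lambda>x. indicator {0..t} x * F x"
  have Lim: "Lim (at_left t) g = g t"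
  proof (rule tendsto_Lim)
    have "(stopped t g \<longlongrightarrow> stopped t g t) (at_left t)"
      using continuous_on_interior[OF h.continuous_g, of t]
      by (rule Lim_at_imp_Lim_at_within[OF isContD]) simp
    moreover have "\<forall>\<^sub>F x in at_left t. stopped t g x = g x"
      using t by (auto simp: eventually_at_left_field stopped_eq intro!: exI[of _ 0])
    ultimately have "(g \<longlongrightarrow> stopped t g t) (at_left t)"
      by (rule Lim_transform_eventually)
    then show "(g \<longlongrightarrow> g t) (at_left t)"
      using t by (simp add: stopped_eq)
  qed simp
  show ?thesis
    using u.AE_has_derivative_power_kernel_integral
  proof (eventually_elim, intro impI)
    fix x assume elim: "x < t + 1 \<longrightarrow> ((\<lambda>x. LINT y|lborel. ?u y * power_kernel b (x - y)) has_real_derivative marchaud b ?u x) (at x)"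
      and x: "0 < x \<and> x < t"
    have "((\<lambda>x. LINT s:{0..x}|lborel. F s * (x - s) powr - b) has_real_derivative marchaud b ?u x) (at x)"
    proof (rule has_field_derivative_transform_within_open)
      show "((\<lambda>x. LINT y|lborel. ?u y * power_kernel b (x - y)) has_real_derivative marchaud b ?u x) (at x)"
        using elim x by simp
      show "(LINT y|lborel. ?u y * power_kernel b (z - y)) = (LINT s:{0..z}|lborel. F s * (z - s) powr - b)"
        if "z \<in> {0<..<t}" for z
        unfolding set_lebesgue_integral_def using that
        by (intro Bochner_Integration.integral_cong) (auto simp: indicator_def power_kernel_def)
    qed (use x in auto)
    then have l: "frac_deriv_left b F x = 1 / Gamma (1 - b) * marchaud b ?u x"
      unfolding frac_deriv_left_def by (simp add: DERIV_imp_deriv)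
    have "((\<lambda>x. LINT s:{x..t}|lborel. (Lim (at_left t) g - g s) * (s - x) powr - (1 - b))
        has_real_derivative - marchaud (1 - b) h.reversed (t - x)) (at x)"
    proof (rule has_field_derivative_transform_within_open)
      have "((\<lambda>x. h.kernel_integral (t - x)) has_real_derivative marchaud (1 - b) h.reversed (t - x) * -1) (at x)"
        by (rule DERIV_chain2[OF h.has_derivative_kernel_integral]) (auto intro!: derivative_eq_intros)
      then show "((\<lambda>x. h.kernel_integral (t - x)) has_real_derivative - marchaud (1 - b) h.reversed (t - x)) (at x)"
        by simp
      show "h.kernel_integral (t - z) = (LINT s:{z..t}|lborel. (Lim (at_left t) g - g s) * (s - z) powr - (1 - b))"
        if z: "z \<in> {0<..<t}" for z
      proof -
        have "h.kernel_integral (t - z) = (LINT s|lborel. h.reversed (t - s) * power_kernel (1 - b) (s - z))"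
          unfolding h.kernel_integral_def
          by (subst lborel_integral_real_affine[of "-1" _ t]) (auto simp: algebra_simps)
        also have "\<dots> = (LINT s:{z..t}|lborel. (Lim (at_left t) g - g s) * (s - z) powr - (1 - b))"
          unfolding set_lebesgue_integral_def
        proof (intro Bochner_Integration.integral_cong refl)
          fix s
          show "h.reversed (t - s) * power_kernel (1 - b) (s - z) =
              indicator {z..t} s *\<^sub>R ((Lim (at_left t) g - g s) * (s - z) powr - (1 - b))"
            using z h.reversed_nonpos[of "t - s"] t
            by (cases "z \<le> s \<and> s \<le> t")
              (auto simp: Lim power_kernel_def h.reversed_def stopped_eq indicator_def)
        qed
        finally show ?thesis .
      qed
    qed (use x in auto)
    then have r: "frac_deriv_right (1 - b) t (\<lambda>y. Lim (at_left t) g - g y) x = 1 / Gamma b * marchaud (1 - b) h.reversed (t - x)"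
      unfolding frac_deriv_right_def by (simp add: DERIV_imp_deriv)
    show "gls_integrand b t F g x = marchaud b ?u x * marchaud (1 - b) h.reversed (t - x) / (Gamma b * Gamma (1 - b))"
      unfolding gls_integrand_def l r by simp
  qed
qed

theorem has_gls_integral_forward_limit:
  assumes F: "F \<in> W2 T b" and g: "g \<in> W1 T (1 - b)" and b: "0 < b" "b < 1" and t: "0 < t" "t \<le> T"
    and bounded: "\<And>x. 0 \<le> x \<Longrightarrow> x \<le> T \<Longrightarrow> \<bar>F x\<bar> \<le> C"
    and L: "0 \<le> L" and \<eta>: "1 - b < \<eta>"
    and holder: "\<And>x y. 0 \<le> x \<Longrightarrow> x \<le> T \<Longrightarrow> 0 \<le> y \<Longrightarrow> y \<le> T \<Longrightarrow> \<bar>g x - g y\<bar> \<le> L * \<bar>x - y\<bar> powr \<eta>"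
  obtains I where "has_gls_integral T t F g I"
    and "\<And>e. \<lbrakk>e \<longlonglongrightarrow> 0; \<And>n. e n \<noteq> 0; \<And>n. \<bar>e n\<bar> < 1\<rbrakk> \<Longrightarrow>
      (\<lambda>n. LINT y|lborel. indicator {0..t} y * F y * (stopped t g (y + e n) - stopped t g y) / e n) \<longlonglongrightarrow> I"
proof -
  have h: "holder_path (stopped t g) t L \<eta> (1 - b)"
    using b by (intro holder_path_stopped[OF t L _ \<eta>] holder) linarith+
  have u: "marchaud_function (\<lambda>x. indicator {0..t} x * F x) b (t + 1) C"
    by (intro marchaud_function_truncated[OF F b t] bounded)
  let ?G = "\<lambda>x. marchaud b (\<lambda>x. indicator {0..t} x * F x) x * marchaud (1 - b) (holder_path.reversed (stopped t g) t) (t - x) * indicator {0..t} x"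
  define c where "c = Gamma b * Gamma (1 - b)"
  define I where "I = (LINT x|lborel. ?G x) / c"
  \<comment> \<open>An admissible sequence of shifts; the summand 2 keeps them below 1.\<close>
  have "(\<lambda>n. 1 / (real n + 2)) \<longlonglongrightarrow> 0"
    using LIMSEQ_ignore_initial_segment[OF lim_inverse_n, of 2] by (simp add: divide_inverse add.commute)
  from gls_integral_limit(2)[OF h u this]
  have int: "integrable lborel ?G" by simp
  then have int': "integrable lebesgue (\<lambda>x. ?G x / c)"
    by (intro integrable_divide) (simp add: integrable_completion borel_measurable_integrable)
  have ae: "AE x in lborel. 0 < x \<and> x < t \<longrightarrow> gls_integrand b t F g x = ?G x / c"
    using gls_integrand_eq_marchaud[OF t h u]
  proof (eventually_elim, intro impI)
    fix x assume x: "0 < x \<and> x < t \<longrightarrow> gls_integrand b t F g x =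
        marchaud b (\<lambda>x. indicator {0..t} x * F x) x * marchaud (1 - b) (holder_path.reversed (stopped t g) t) (t - x) / (Gamma b * Gamma (1 - b))"
      and "0 < x \<and> x < t"
    then show "gls_integrand b t F g x = ?G x / c"
      unfolding c_def by simp
  qed
  obtain N where N: "\<And>x. x \<in> space lborel - N \<Longrightarrow> 0 < x \<and> x < t \<longrightarrow> gls_integrand b t F g x = ?G x / c"
    "N \<in> null_sets lborel"
    by (rule AE_E3[OF ae], rule that)
  \<comment> \<open>The integrand built from \<open>deriv\<close> is not shown to be Borel
    measurable. Agreement outside the negligible set \<open>N'\<close>, which contains the
    endpoints, transfers both integrability and the value to it on the completed measure.\<close>
  define N' where "N' = N \<union> {0, t}"
  have N': "negligible N'"
    using N(2) by (simp add: N'_def negligible_iff_null_sets null_sets_completionI)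
  have eq: "gls_integrand b t F g x = ?G x / c" if "x \<in> {0..t} - N'" for x
  proof -
    have "x \<in> space lborel - N" "0 < x \<and> x < t" using that by (auto simp: N'_def)
    then show ?thesis using N(1) by blast
  qed
  have si: "set_integrable lebesgue {0..t} (\<lambda>x. ?G x / c)"
    unfolding set_integrable_def using int' by (intro integrable_mult_indicator) auto
  have si': "set_integrable lebesgue {0..t} (gls_integrand b t F g)"
    by (rule absolutely_integrable_spike[OF si N' eq])
  have "(LINT x:{0..t}|lebesgue. gls_integrand b t F g x) = integral {0..t} (gls_integrand b t F g)"
    by (rule set_lebesgue_integral_eq_integral(2)[OF si'])
  also have "\<dots> = integral {0..t} (\<lambda>x. ?G x / c)"
    by (rule integral_spike[OF N' eq[symmetric]])
  also have "\<dots> = (LINT x:{0..t}|lebesgue. ?G x / c)"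
    by (rule set_lebesgue_integral_eq_integral(2)[OF si, symmetric])
  also have "\<dots> = (LINT x|lebesgue. ?G x / c)"
    unfolding set_lebesgue_integral_def by (intro Bochner_Integration.integral_cong) (auto simp: indicator_def)
  also have "\<dots> = I"
    using int by (simp add: I_def integral_completion borel_measurable_integrable)
  finally have "has_gls_integral T t F g I"
    unfolding has_gls_integral_def using F g b t si' by (intro exI[of _ b]) simp
  moreover have "(\<lambda>n. LINT y|lborel. indicator {0..t} y * F y * (stopped t g (y + e n) - stopped t g y) / e n) \<longlonglongrightarrow> I"
    if "e \<longlonglongrightarrow> 0" "\<And>n. e n \<noteq> 0" "\<And>n. \<bar>e n\<bar> < 1" for e
    using gls_integral_limit(1)[OF h u that] by (simp add: I_def c_def)
  ultimately show ?thesis by (rule that)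
qed

section \<open>The chain rule for convex functions\<close>

text \<open>Chord slopes of a convex function increase with either endpoint. Letting a chord shrink
  to \<open>x\<close> from the left compares \<open>f' x\<close> with the slope of the chord to
  \<open>y\<close>, on whichever side \<open>y\<close> lies.\<close>

lemma convex_left_derivative_subgradient:
  fixes f f' :: "real \<Rightarrow> real"
  assumes f: "convex_on UNIV f" and f': "(f has_real_derivative f' x) (at_left x)"
  shows "f x + f' x * (y - x) \<le> f y"
proof -
  have lim: "((\<lambda>z. (f z - f x) / (z - x)) \<longlongrightarrow> f' x) (at_left x)"
    using f' by (simp add: has_field_derivative_iff)
  consider "y < x" | "y = x" | "x < y" by linarith
  then show ?thesis
  proof cases
    case 1
    have "(f y - f x) / (y - x) \<le> f' x"
    proof (rule tendsto_lowerbound[OF lim])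
      show "\<forall>\<^sub>F z in at_left x. (f y - f x) / (y - x) \<le> (f z - f x) / (z - x)"
        unfolding eventually_at_left_field
      proof (intro exI[of _ y] conjI allI impI 1)
        fix z assume z: "y < z" "z < x"
        have "(f y - f x) / (y - x) \<le> (f z - f x) / (z - x)"
          using convex_on_slope_le[OF f _ _ z] by simp
        then show "(f y - f x) / (y - x) \<le> (f z - f x) / (z - x)" .
      qed
    qed simp
    then show ?thesis using 1 by (simp add: divide_le_eq)
  next
    case 3
    have "f' x \<le> (f y - f x) / (y - x)"
    proof (rule tendsto_upperbound[OF lim])
      show "\<forall>\<^sub>F z in at_left x. (f z - f x) / (z - x) \<le> (f y - f x) / (y - x)"
        unfolding eventually_at_left_field
      proof (intro exI[of _ "x - 1"] conjI allI impI)
        fix z assume z: "z < x"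
        have "(f z - f x) / (z - x) \<le> (f z - f y) / (z - y)" "(f z - f y) / (z - y) \<le> (f x - f y) / (x - y)"
          using convex_on_slope_le[OF f _ _ z 3] by auto
        then show "(f z - f x) / (z - x) \<le> (f y - f x) / (y - x)"
          by (metis minus_diff_eq minus_divide_divide order_trans)
      qed simp
    qed simp
    then show ?thesis using 3 by (simp add: le_divide_eq)
  qed simp
qed

lemma convex_left_derivative_mono:
  fixes f f' :: "real \<Rightarrow> real"
  assumes f: "convex_on UNIV f" and f': "\<And>x. (f has_real_derivative f' x) (at_left x)"
  shows "mono f'"
proof (rule monoI)
  fix x y :: real assume "x \<le> y"
  show "f' x \<le> f' y"
  proof (cases "x = y")
    case False
    have "(f' x - f' y) * (y - x) \<le> 0"
      using convex_left_derivative_subgradient[OF f f', where x = x and y = y]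
        convex_left_derivative_subgradient[OF f f', where x = y and y = x] by (simp add: algebra_simps)
    then show ?thesis using False \<open>x \<le> y\<close> by (simp add: mult_le_0_iff)
  qed simp
qed

text \<open>In terms of a primitive \<open>W\<close> of \<open>w\<close>, shifting
  \<open>{0..t}\<close> changes the integral only by increments of \<open>W\<close> at the two ends,
  and each of these quotients tends to the value of \<open>w\<close> there.\<close>

lemma average_increment_tendsto:
  fixes w :: "real \<Rightarrow> real"
  assumes w: "continuous_on UNIV w" and t: "0 < t"
    and e: "e \<longlonglongrightarrow> 0" "\<And>n. e n \<noteq> 0" "\<And>n. \<bar>e n\<bar> < 1"
  shows "(\<lambda>n. (LINT y|lborel. indicator {0..t} y * (w (y + e n) - w y)) / e n) \<longlonglongrightarrow> w t - w 0"
proof -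
  \<comment> \<open>Starting at -1 keeps \<open>0 + e n\<close> within the range of the primitive,
    since \<open>\<bar>e n\<bar> < 1\<close>.\<close>
  define W where "W z = integral {-1..z} w" for z
  have int: "w integrable_on {a..b}" for a b
    by (intro integrable_continuous_interval continuous_on_subset[OF w]) simp
  have W: "(W has_real_derivative w z) (at z)" if "-1 < z" for z
  proof -
    have "(W has_real_derivative w z) (at z within {-1..z + 1})"
      unfolding W_def[abs_def] using that
      by (intro integral_has_real_derivative continuous_on_subset[OF w]) auto
    then show ?thesis using that by (subst (asm) at_within_interior) auto
  qed
  have e0: "filterlim e (at 0) sequentially"
    using e by (intro filterlim_atI) auto
  have quot: "(\<lambda>n. (W (z + e n) - W z) / e n) \<longlonglongrightarrow> w z" if "-1 < z" for z
    using W[OF that] e0 unfolding DERIV_def by (rule filterlim_compose)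
  have "(LINT y|lborel. indicator {0..t} y * (w (y + d) - w y)) = (W (t + d) - W t) - (W (0 + d) - W 0)" if "\<bar>d\<bar> < 1" for d
  proof -
    have si: "integrable lborel (\<lambda>y. indicator {a..b} y * w y)" for a b
      using borel_integrable_atLeastAtMost'[of a b w] continuous_on_subset[OF w]
      unfolding set_integrable_def by simp
    have val: "(LINT y|lborel. indicator {a..b} y * w y) = W b - W a" if "-1 \<le> a" "a \<le> b" for a b
    proof -
      have "(LINT y:{a..b}|lborel. w y) = integral {a..b} w"
        by (intro set_borel_integral_eq_integral borel_integrable_atLeastAtMost' continuous_on_subset[OF w]) simp
      then show ?thesis
        using Henstock_Kurzweil_Integration.integral_combine[OF that int]
        by (simp add: set_lebesgue_integral_def W_def)
    qed
    have "indicator {0..t} y * w (y + d) = indicator {d..t + d} (d + y) * w (d + y)" for y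
      by (simp add: indicator_def add.commute)
    then have shift: "integrable lborel (\<lambda>y. indicator {0..t} y * w (y + d))"
      "(LINT y|lborel. indicator {0..t} y * w (y + d)) = (LINT y|lborel. indicator {d..t + d} y * w y)"
      using lborel_integrable_real_affine[of "\<lambda>y. indicator {d..t + d} y * w y" 1 d] si
        lborel_integral_real_affine[of 1 "\<lambda>y. indicator {d..t + d} y * w y" d] by simp_all
    have "(LINT y|lborel. indicator {0..t} y * (w (y + d) - w y)) =
        (LINT y|lborel. indicator {0..t} y * w (y + d) - indicator {0..t} y * w y)"
      by (simp only: right_diff_distrib)
    also have "\<dots> = (LINT y|lborel. indicator {d..t + d} y * w y) - (LINT y|lborel. indicator {0..t} y * w y)"
      by (subst Bochner_Integration.integral_diff[OF shift(1) si]) (simp only: shift)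
    finally show ?thesis
      using t that by (simp add: val)
  qed
  then have "(\<lambda>n. (LINT y|lborel. indicator {0..t} y * (w (y + e n) - w y)) / e n) =
     (\<lambda>n. (W (t + e n) - W t) / e n - (W (0 + e n) - W 0) / e n)"
    using e(3) by (simp add: diff_divide_distrib)
  then show ?thesis
    using tendsto_diff[OF quot[of t] quot[of 0]] t by simp
qed

theorem gls_chain_rule_convex:
  fixes f f' :: "real \<Rightarrow> real"
  assumes f: "convex_on UNIV f" and f': "\<And>x. (f has_real_derivative f' x) (at_left x)"
    and F: "(\<lambda>s. f' (x s) * \<phi> s) \<in> W2 T b" and g: "g \<in> W1 T (1 - b)" and b: "0 < b" "b < 1" and t: "0 < t" "t \<le> T"
    and bounded: "\<And>s. 0 \<le> s \<Longrightarrow> s \<le> T \<Longrightarrow> \<bar>f' (x s)\<bar> \<le> C" "\<And>s. 0 \<le> s \<Longrightarrow> s \<le> T \<Longrightarrow> \<bar>\<phi> s\<bar> \<le> C'"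
    and L: "0 \<le> L" and \<eta>: "1 - b < \<eta>" "1 / 2 < \<eta>"
    and holder: "\<And>u v. 0 \<le> u \<Longrightarrow> u \<le> T \<Longrightarrow> 0 \<le> v \<Longrightarrow> v \<le> T \<Longrightarrow> \<bar>g u - g v\<bar> \<le> L * \<bar>u - v\<bar> powr \<eta>"
    and x: "continuous_on {0..T} x"
    and R: "0 \<le> R"
      "\<And>u v. 0 \<le> u \<Longrightarrow> u \<le> T \<Longrightarrow> 0 \<le> v \<Longrightarrow> v \<le> T \<Longrightarrow> \<bar>x v - x u - \<phi> u * (g v - g u)\<bar> \<le> R * \<bar>v - u\<bar> powr (2 * \<eta>)"
  shows "has_gls_integral T t (\<lambda>s. f' (x s) * \<phi> s) g (f (x t) - f (x 0))"
proof -
  let ?F = "\<lambda>s. f' (x s) * \<phi> s" and ?g = "stopped t g"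
  let ?p = "\<lambda>d y. indicator {0..t} y * ?F y * (?g (y + d) - ?g y)"
  define w where "w = f \<circ> stopped t x"
  have C: "0 \<le> C" "0 \<le> C'" using bounded[of 0] t by linarith+
  have Fb: "\<bar>?F s\<bar> \<le> C * C'" if "0 \<le> s" "s \<le> T" for s
    using bounded[OF that] by (auto simp: abs_mult intro!: mult_mono)
  obtain I where I: "has_gls_integral T t ?F g I"
    and lim: "\<And>e. \<lbrakk>e \<longlonglongrightarrow> 0; \<And>n. e n \<noteq> 0; \<And>n. \<bar>e n\<bar> < 1\<rbrakk> \<Longrightarrow>
      (\<lambda>n. LINT y|lborel. indicator {0..t} y * ?F y * (?g (y + e n) - ?g y) / e n) \<longlonglongrightarrow> I"
    by (rule has_gls_integral_forward_limit[OF F g b t Fb L \<eta>(1) holder], assumption+, rule that, assumption, blast)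
  have wc: "continuous_on UNIV w"
    unfolding w_def stopped_def[abs_def] comp_def
    by (rule continuous_on_compose2[OF convex_on_continuous[OF open_UNIV f]],
        rule continuous_on_compose2[OF x]) (use t in \<open>auto intro!: continuous_intros\<close>)
  have [measurable]: "w \<in> borel_measurable borel" "?g \<in> borel_measurable borel"
    "(\<lambda>y. indicator {0..t} y * ?F y) \<in> borel_measurable borel"
  proof -
    show "w \<in> borel_measurable borel"
      using wc by (rule borel_measurable_continuous_onI)
    have "holder_path ?g t L \<eta> (1 - b)"
      by (rule holder_path_stopped[OF t L _ \<eta>(1) _ holder]) (use b in auto)
    then show "?g \<in> borel_measurable borel"
      by (rule holder_path.measurable_g)
    show "(\<lambda>y. indicator {0..t} y * ?F y) \<in> borel_measurable borel"
    proof -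
      have "(\<lambda>y. indicator {0..t} y * ?F y) = (\<lambda>y. indicator {0..t} y * (indicator {0..T} y * ?F y))"
        using t by (auto simp: indicator_def)
      also have "\<dots> \<in> borel_measurable borel"
        by (rule borel_measurable_times[OF _ W2_measurable[OF F]]) simp
      finally show ?thesis .
    qed
  qed
  have clamp: "0 \<le> max 0 (min t y)" "max 0 (min t y) \<le> T" for y
    using t by auto
  have gb: "\<bar>?g u - ?g v\<bar> \<le> L * T powr \<eta>" for u v
  proof -
    have "\<bar>?g u - ?g v\<bar> \<le> L * \<bar>max 0 (min t u) - max 0 (min t v)\<bar> powr \<eta>"
      unfolding stopped_def by (intro holder clamp)
    also have "\<dots> \<le> L * T powr \<eta>"
      using L \<eta> t by (intro mult_left_mono powr_mono2) auto
    finally show ?thesis .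
  qed
  define P where "P d = (LINT y|lborel. ?p d y)" for d
  define Q where "Q d = (LINT y|lborel. indicator {0..t} y * (w (y + d) - w y))" for d
  \<comment> \<open>The sign of \<open>d\<close> is free here. The subgradient inequality bounds the
    increment of \<open>f\<close> from below, and exchanging the increment of \<open>x\<close> for
    \<open>\<phi> y\<close> times that of \<open>g\<close> costs at most
    \<open>C * R * \<bar>d\<bar> powr (2 * \<eta>)\<close> at each point of
    \<open>{0..t}\<close>.\<close>
  have key: "P d - C * R * t * \<bar>d\<bar> powr (2 * \<eta>) \<le> Q d" for d
  proof -
    have intP: "integrable lborel (\<lambda>y. ?p d y)"
    proof (rule Bochner_Integration.integrable_bound)
      show "integrable lborel (\<lambda>y. (C * C' * (L * T powr \<eta>)) * indicator {0..t} y :: real)"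
        by (simp add: integrable_indicator_iff emeasure_lborel_Icc_eq)
      have "norm (?p d y) \<le> norm ((C * C' * (L * T powr \<eta>)) * indicator {0..t} y)" for y
      proof (cases "y \<in> {0..t}")
        case True
        then have "\<bar>?F y\<bar> * \<bar>?g (y + d) - ?g y\<bar> \<le> (C * C') * (L * T powr \<eta>)"
          using Fb[of y] gb[of "y + d" y] t C by (intro mult_mono) auto
        then show ?thesis using True C L by (simp add: abs_mult)
      qed simp
      then show "AE y in lborel. norm (?p d y) \<le> norm ((C * C' * (L * T powr \<eta>)) * indicator {0..t} y)"
        by simp
    qed simp
    have intQ: "integrable lborel (\<lambda>y. indicator {0..t} y * (w (y + d) - w y))"
    proof -
      have "continuous_on {0..t} (\<lambda>y. w (y + d) - w y)"
        by (intro continuous_intros continuous_on_compose2[OF wc]) auto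
      then show ?thesis
        using borel_integrable_atLeastAtMost'[of 0 t "\<lambda>y. w (y + d) - w y"] by (simp add: set_integrable_def)
    qed
    have pt: "?p d y - C * R * \<bar>d\<bar> powr (2 * \<eta>) * indicator {0..t} y
        \<le> indicator {0..t} y * (w (y + d) - w y)" for y
    proof (cases "y \<in> {0..t}")
      case True
      \<comment> \<open>The stopped functions at \<open>y + d\<close> take their values at the
        clamped time \<open>v\<close>, which lies in \<open>{0..T}\<close> and is no farther from
        \<open>y\<close> than \<open>\<bar>d\<bar>\<close>, so the remainder bound applies.\<close>
      define v where "v = max 0 (min t (y + d))"
      have v: "0 \<le> v" "v \<le> T" "\<bar>v - y\<bar> \<le> \<bar>d\<bar>" using t True by (auto simp: v_def)
      have y: "0 \<le> y" "y \<le> T" using True t by auto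
      have "f' (x y) * (x v - x y) \<le> f (x v) - f (x y)"
        using convex_left_derivative_subgradient[OF f f', where x = "x y" and y = "x v"] by simp
      moreover have "f' (x y) * (\<phi> y * (g v - g y)) - f' (x y) * (x v - x y) \<le> C * R * \<bar>d\<bar> powr (2 * \<eta>)"
      proof -
        have "f' (x y) * (\<phi> y * (g v - g y)) - f' (x y) * (x v - x y) \<le> \<bar>f' (x y)\<bar> * \<bar>x v - x y - \<phi> y * (g v - g y)\<bar>"
          by (simp add: abs_mult[symmetric] algebra_simps) 
        also have "\<dots> \<le> C * (R * \<bar>v - y\<bar> powr (2 * \<eta>))"
          using bounded(1)[OF y] R(2)[OF y v(1,2)] C by (intro mult_mono) auto
        also have "\<dots> \<le> C * (R * \<bar>d\<bar> powr (2 * \<eta>))"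
          using v(3) \<eta> C R(1) by (intro mult_left_mono powr_mono2) auto
        finally show ?thesis by (simp add: mult.assoc)
      qed
      ultimately have "?F y * (g v - g y) - C * R * \<bar>d\<bar> powr (2 * \<eta>) \<le> f (x v) - f (x y)"
        by (simp add: mult.assoc)
      moreover have "?g (y + d) = g v" "?g y = g y" "w (y + d) = f (x v)" "w y = f (x y)"
        using True by (auto simp: stopped_def v_def w_def)
      ultimately show ?thesis using True by simp
    qed simp
    have "P d - C * R * t * \<bar>d\<bar> powr (2 * \<eta>) =
        (LINT y|lborel. ?p d y - C * R * \<bar>d\<bar> powr (2 * \<eta>) * indicator {0..t} y)"
      unfolding P_def using intP t
      by (subst Bochner_Integration.integral_diff)
        (simp_all add: integrable_indicator_iff emeasure_lborel_Icc_eq mult_ac)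
    also have "\<dots> \<le> Q d"
      unfolding Q_def using intP intQ pt
      by (intro integral_mono Bochner_Integration.integrable_diff integrable_mult_right)
        (simp_all add: integrable_indicator_iff emeasure_lborel_Icc_eq)
    finally show ?thesis .
  qed
  have limQ: "(\<lambda>n. Q (e n) / e n) \<longlonglongrightarrow> f (x t) - f (x 0)"
    if e: "e \<longlonglongrightarrow> 0" "\<And>n. e n \<noteq> 0" "\<And>n. \<bar>e n\<bar> < 1" for e
    using average_increment_tendsto[OF wc t(1) e] t by (simp add: Q_def w_def stopped_eq)
  have limP: "(\<lambda>n. P (e n) / e n) \<longlonglongrightarrow> I"
    if e: "e \<longlonglongrightarrow> 0" "\<And>n. e n \<noteq> 0" "\<And>n. \<bar>e n\<bar> < 1" for e
    using lim[OF e] by (simp add: P_def)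
  define e where "e n = 1 / (real n + 2)" for n
  have "e \<longlonglongrightarrow> 0"
    using LIMSEQ_ignore_initial_segment[OF lim_inverse_n, of 2] by (simp add: e_def[abs_def] divide_inverse add.commute)
  then have e: "e \<longlonglongrightarrow> 0" "\<And>n. 0 < e n" "\<And>n. e n < 1"
    by (simp_all add: e_def)
  have ne: "(\<lambda>n. - e n) \<longlonglongrightarrow> 0" using tendsto_minus[OF e(1)] by simp
  have err: "(\<lambda>n. C * R * t * e n powr (2 * \<eta> - 1)) \<longlonglongrightarrow> 0"
    using tendsto_mult_left[OF tendsto_zero_powrI[OF e(1) tendsto_const, of "2 * \<eta> - 1"], of "C * R * t"] \<eta> e(2)
    by (simp add: less_imp_le)
  have pe: "e n powr (2 * \<eta>) / e n = e n powr (2 * \<eta> - 1)" for n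
    using e(2)[of n] by (simp add: powr_diff)
  have "I - 0 \<le> f (x t) - f (x 0)"
  proof (rule tendsto_le[OF _ limQ tendsto_diff[OF limP err]])
    show "\<forall>\<^sub>F n in sequentially. P (e n) / e n - C * R * t * e n powr (2 * \<eta> - 1) \<le> Q (e n) / e n"
    proof (intro always_eventually allI)
      fix n
      show "P (e n) / e n - C * R * t * e n powr (2 * \<eta> - 1) \<le> Q (e n) / e n"
        using divide_right_mono[OF key[of "e n"], of "e n"] e(2)[of n] by (simp add: diff_divide_distrib pe[symmetric])
    qed
  qed (use e in \<open>auto simp: less_imp_neq[symmetric] abs_of_pos\<close>)
  moreover have "f (x t) - f (x 0) \<le> I + 0"
  proof (rule tendsto_le[OF _ tendsto_add[OF limP err] limQ])
    show "\<forall>\<^sub>F n in sequentially. Q (- e n) / - e n \<le> P (- e n) / - e n + C * R * t * e n powr (2 * \<eta> - 1)"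
    proof (intro always_eventually allI)
      fix n
      show "Q (- e n) / - e n \<le> P (- e n) / - e n + C * R * t * e n powr (2 * \<eta> - 1)"
        using divide_right_mono[OF key[of "- e n"], of "e n"] e(2)[of n] by (simp add: diff_divide_distrib pe[symmetric])
    qed
  qed (use e ne in \<open>auto simp: less_imp_neq[symmetric] abs_of_pos\<close>)
  ultimately show ?thesis using I by simp
qed

section \<open>The averaged price along a Hoelder path\<close>

definition averaged_price :: "real \<Rightarrow> (real \<Rightarrow> real) \<Rightarrow> real \<Rightarrow> real" where
  "averaged_price T g s = (T - s) / T * exp (g s) + 1 / T * (LINT u:{0..s}|lborel. exp (g u))"

definition price_weight :: "real \<Rightarrow> (real \<Rightarrow> real) \<Rightarrow> real \<Rightarrow> real" where
  "price_weight T g s = (T - s) / T * exp (g s)"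

locale bounded_holder_path =
  fixes g :: "real \<Rightarrow> real" and T K L \<eta> :: real
  assumes T_pos: "0 < T" and L_nonneg: "0 \<le> L" and \<eta>_pos: "0 < \<eta>" and \<eta>_less_1: "\<eta> < 1"
    and bounded: "\<And>u. 0 \<le> u \<Longrightarrow> u \<le> T \<Longrightarrow> \<bar>g u\<bar> \<le> K"
    and holder: "\<And>u v. 0 \<le> u \<Longrightarrow> u \<le> T \<Longrightarrow> 0 \<le> v \<Longrightarrow> v \<le> T \<Longrightarrow> \<bar>g u - g v\<bar> \<le> L * \<bar>u - v\<bar> powr \<eta>"
begin

lemma exp_le: "0 \<le> u \<Longrightarrow> u \<le> T \<Longrightarrow> exp (g u) \<le> exp K"
  using bounded[of u] by simp

lemma exp_increment_le: "exp y - exp x \<le> exp y * (y - x)" for x y :: real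
  using exp_ge_add_one_self[of "x - y"] exp_gt_zero[of y] 
  by (simp add: exp_diff field_simps)

lemma exp_holder:
  assumes "0 \<le> u" "u \<le> T" "0 \<le> v" "v \<le> T"
  shows "\<bar>exp (g u) - exp (g v)\<bar> \<le> exp K * L * \<bar>u - v\<bar> powr \<eta>"
proof -
  have "\<bar>exp (g u) - exp (g v)\<bar> \<le> exp K * \<bar>g u - g v\<bar>"
  proof (cases "g u \<le> g v")
    case True
    have "exp (g v) - exp (g u) \<le> exp (g v) * (g v - g u)" by (rule exp_increment_le)
    also have "\<dots> \<le> exp K * (g v - g u)" using True exp_le assms by (intro mult_right_mono) auto
    finally show ?thesis using True by (simp add: abs_minus_commute)
  next
    case False
    have "exp (g u) - exp (g v) \<le> exp (g u) * (g u - g v)" by (rule exp_increment_le)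
    also have "\<dots> \<le> exp K * (g u - g v)" using False exp_le assms by (intro mult_right_mono) auto
    finally show ?thesis using False by simp
  qed
  also have "\<dots> \<le> exp K * (L * \<bar>u - v\<bar> powr \<eta>)"
    using holder assms by (intro mult_left_mono) auto
  finally show ?thesis by simp
qed

text \<open>Two tangent inequalities place the remainder between 0 and
  \<open>(exp (g v) - exp (g u)) * (g v - g u)\<close>, a product of two Hoelder increments; hence
  the exponent \<open>2 * \<eta>\<close>.\<close>

lemma exp_remainder:
  assumes "0 \<le> u" "u \<le> T" "0 \<le> v" "v \<le> T"
  shows "\<bar>exp (g v) - exp (g u) - exp (g u) * (g v - g u)\<bar> \<le> exp K * L\<^sup>2 * \<bar>v - u\<bar> powr (2 * \<eta>)"
proof -
  have "0 \<le> exp (g v) - exp (g u) - exp (g u) * (g v - g u)"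
    using exp_increment_le[of "g u" "g v"] by (simp add: algebra_simps)
  moreover have "exp (g v) - exp (g u) - exp (g u) * (g v - g u) \<le> (exp (g v) - exp (g u)) * (g v - g u)"
    using exp_increment_le[of "g v" "g u"] by (simp add: algebra_simps)
  ultimately have "\<bar>exp (g v) - exp (g u) - exp (g u) * (g v - g u)\<bar> \<le> \<bar>exp (g v) - exp (g u)\<bar> * \<bar>g v - g u\<bar>"
    unfolding abs_mult[symmetric] by linarith
  also have "\<dots> \<le> (exp K * L * \<bar>v - u\<bar> powr \<eta>) * (L * \<bar>v - u\<bar> powr \<eta>)"
    using exp_holder holder assms L_nonneg by (intro mult_mono) auto
  also have "\<dots> = exp K * L\<^sup>2 * (\<bar>v - u\<bar> powr \<eta> * \<bar>v - u\<bar> powr \<eta>)"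
    by (simp add: power2_eq_square)
  also have "\<bar>v - u\<bar> powr \<eta> * \<bar>v - u\<bar> powr \<eta> = \<bar>v - u\<bar> powr (2 * \<eta>)"
    by (simp add: powr_add[symmetric])
  finally show ?thesis .
qed

lemma continuous_g: "continuous_on {0..T} g"
proof (rule continuous_on_eq[of _ "stopped T g"])
  have "holder_path (stopped T g) T L \<eta> (\<eta> / 2)"
    using T_pos \<eta>_pos \<eta>_less_1 by (intro holder_path_stopped[OF T_pos order_refl L_nonneg] holder) auto
  then show "continuous_on {0..T} (stopped T g)"
    by (intro continuous_on_subset[OF holder_path.continuous_g]) auto
qed (simp add: stopped_eq)

lemma continuous_exp_g: "continuous_on {0..T} (\<lambda>u. exp (g u))"
  by (intro continuous_intros continuous_g)

lemma integral_exp: "0 \<le> s \<Longrightarrow> s \<le> T \<Longrightarrow> (LINT u:{0..s}|lborel. exp (g u)) = integral {0..s} (\<lambda>u. exp (g u))"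
  by (intro set_borel_integral_eq_integral borel_integrable_atLeastAtMost' continuous_on_subset[OF continuous_exp_g]) auto

text \<open>Subtracting \<open>z * exp (g v)\<close> from the integral up to \<open>z\<close> leaves
  a function with derivative \<open>exp (g z) - exp (g v)\<close>, small by Hoelder continuity. The
  comparison value sits at \<open>v\<close> because the change of the weight \<open>T - s\<close>
  multiplies \<open>exp (g v)\<close> in \<open>averaged_price_increment\<close>.\<close>

lemma integral_exp_remainder:
  assumes "0 \<le> u" "u \<le> T" "0 \<le> v" "v \<le> T"
  shows "\<bar>integral {0..v} (\<lambda>u. exp (g u)) - integral {0..u} (\<lambda>u. exp (g u)) - (v - u) * exp (g v)\<bar>
    \<le> exp K * L * \<bar>v - u\<bar> powr \<eta> * \<bar>v - u\<bar>"
proof -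
  define I where "I z = integral {0..z} (\<lambda>u. exp (g u))" for z
  let ?S = "{min u v..max u v}"
  have "norm ((I v - v * exp (g v)) - (I u - u * exp (g v))) \<le> exp K * L * \<bar>v - u\<bar> powr \<eta> * norm (v - u)"
  proof (rule field_differentiable_bound[of ?S _ "\<lambda>z. exp (g z) - exp (g v)"])
    fix z assume z: "z \<in> ?S"
    then have z': "0 \<le> z" "z \<le> T" "\<bar>z - v\<bar> \<le> \<bar>v - u\<bar>" using assms by auto
    have "(I has_real_derivative exp (g z)) (at z within {0..T})"
      unfolding I_def[abs_def] using z' by (intro integral_has_real_derivative continuous_exp_g) auto
    then have "(I has_real_derivative exp (g z)) (at z within ?S)"
      by (rule has_field_derivative_subset) (use assms in auto)
    then show "((\<lambda>z. I z - z * exp (g v)) has_real_derivative exp (g z) - exp (g v)) (at z within ?S)"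
      by (auto intro!: derivative_eq_intros)
    have "\<bar>exp (g z) - exp (g v)\<bar> \<le> exp K * L * \<bar>z - v\<bar> powr \<eta>"
      using z' assms by (intro exp_holder)
    also have "\<dots> \<le> exp K * L * \<bar>v - u\<bar> powr \<eta>"
      using z' L_nonneg \<eta>_pos by (intro mult_left_mono powr_mono2) auto
    finally show "norm (exp (g z) - exp (g v)) \<le> exp K * L * \<bar>v - u\<bar> powr \<eta>" by simp
  qed auto
  then show ?thesis by (simp add: I_def algebra_simps)
qed

text \<open>The decreasing weight contributes \<open>- (v - u) / T * exp (g v)\<close>, which
  cancels the leading part of the increment of the integral. So the averaged price has no drift of
  first order in time.\<close>

lemma averaged_price_increment:
  assumes "0 \<le> u" "u \<le> T" "0 \<le> v" "v \<le> T"
  shows "averaged_price T g v - averaged_price T g u = (T - u) / T * (exp (g v) - exp (g u)) +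
    1 / T * (integral {0..v} (\<lambda>u. exp (g u)) - integral {0..u} (\<lambda>u. exp (g u)) - (v - u) * exp (g v))"
  using T_pos assms by (simp add: averaged_price_def integral_exp field_simps)

lemma weight_le_1: "0 \<le> u \<Longrightarrow> u \<le> T \<Longrightarrow> 0 \<le> (T - u) / T \<and> (T - u) / T \<le> 1"
  using T_pos by simp

lemma averaged_price_holder:
  assumes uv: "0 \<le> u" "u \<le> T" "0 \<le> v" "v \<le> T"
  shows "\<bar>averaged_price T g v - averaged_price T g u\<bar> \<le> 2 * exp K * L * \<bar>v - u\<bar> powr \<eta>"
proof -
  let ?J = "integral {0..v} (\<lambda>u. exp (g u)) - integral {0..u} (\<lambda>u. exp (g u)) - (v - u) * exp (g v)"
  let ?E = "exp K * L * \<bar>v - u\<bar> powr \<eta>"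
  have E: "0 \<le> ?E" using L_nonneg by simp
  have a: "\<bar>(T - u) / T * (exp (g v) - exp (g u))\<bar> \<le> 1 * ?E"
    unfolding abs_mult using weight_le_1[OF uv(1,2)] exp_holder[OF uv(3,4,1,2)] by (intro mult_mono) auto
  have b: "\<bar>1 / T * ?J\<bar> \<le> ?E"
  proof -
    have "\<bar>?J\<bar> \<le> ?E * \<bar>v - u\<bar>" by (rule integral_exp_remainder[OF uv])
    also have "\<dots> \<le> ?E * T" using uv E by (intro mult_left_mono) auto
    finally show ?thesis using T_pos by (simp add: abs_mult divide_le_eq)
  qed
  have "\<bar>averaged_price T g v - averaged_price T g u\<bar> \<le> 1 * ?E + ?E"
    unfolding averaged_price_increment[OF uv] by (rule order_trans[OF abs_triangle_ineq add_mono[OF a b]])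
  then show ?thesis by (simp add: mult_ac)
qed

lemma averaged_price_remainder:
  assumes uv: "0 \<le> u" "u \<le> T" "0 \<le> v" "v \<le> T"
  shows "\<bar>averaged_price T g v - averaged_price T g u - price_weight T g u * (g v - g u)\<bar> \<le>
    (exp K * L\<^sup>2 + exp K * L * T powr (1 - \<eta>) / T) * \<bar>v - u\<bar> powr (2 * \<eta>)"
proof -
  let ?J = "integral {0..v} (\<lambda>u. exp (g u)) - integral {0..u} (\<lambda>u. exp (g u)) - (v - u) * exp (g v)"
  let ?p = "\<bar>v - u\<bar> powr (2 * \<eta>)"
  have eq: "averaged_price T g v - averaged_price T g u - price_weight T g u * (g v - g u) =
      (T - u) / T * (exp (g v) - exp (g u) - exp (g u) * (g v - g u)) + 1 / T * ?J"
  proof -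
    have "q * a + J - q * c * d = q * (a - c * d) + J" for q a c d J :: real
      by (simp add: algebra_simps)
    then show ?thesis unfolding averaged_price_increment[OF uv] price_weight_def .
  qed
  have a: "\<bar>(T - u) / T * (exp (g v) - exp (g u) - exp (g u) * (g v - g u))\<bar> \<le> 1 * (exp K * L\<^sup>2 * ?p)"
    unfolding abs_mult[of "(T - u) / T"] using weight_le_1[OF uv(1,2)] exp_remainder[OF uv] by (intro mult_mono) auto
  have b: "\<bar>1 / T * ?J\<bar> \<le> exp K * L * T powr (1 - \<eta>) / T * ?p"
  proof -
    \<comment> \<open>\<open>1 + \<eta> = 2 * \<eta> + (1 - \<eta>)\<close>, and the surplus power
      of \<open>\<bar>v - u\<bar>\<close> is at most \<open>T powr (1 - \<eta>)\<close>.\<close>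
    have "\<bar>v - u\<bar> powr \<eta> * \<bar>v - u\<bar> = ?p * \<bar>v - u\<bar> powr (1 - \<eta>)"
      by (simp add: powr_mult_base mult.commute[of "_ powr _" "\<bar>v - u\<bar>"] powr_add[symmetric] add.commute)
    also have "\<dots> \<le> ?p * T powr (1 - \<eta>)"
      using uv \<eta>_less_1 by (intro mult_left_mono powr_mono2) auto
    finally have "exp K * L * (\<bar>v - u\<bar> powr \<eta> * \<bar>v - u\<bar>) \<le> exp K * L * (?p * T powr (1 - \<eta>))"
      using L_nonneg by (intro mult_left_mono) auto
    with integral_exp_remainder[OF uv] have "\<bar>?J\<bar> \<le> exp K * L * (?p * T powr (1 - \<eta>))"
      by (simp only: mult.assoc)
    then have "\<bar>?J\<bar> / T \<le> exp K * L * (?p * T powr (1 - \<eta>)) / T"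
      using T_pos by (intro divide_right_mono) auto
    then show ?thesis using T_pos by (simp add: abs_mult mult_ac)
  qed
  show ?thesis
    unfolding eq using order_trans[OF abs_triangle_ineq add_mono[OF a b]] by (simp only: distrib_right mult_1)
qed

lemma continuous_averaged_price: "continuous_on {0..T} (averaged_price T g)"
proof (rule continuous_on_eq)
  show "continuous_on {0..T} (\<lambda>s. (T - s) / T * exp (g s) + 1 / T * integral {0..s} (\<lambda>u. exp (g u)))"
    using T_pos by (intro continuous_intros continuous_exp_g indefinite_integral_continuous_1
        integrable_continuous_interval) auto
qed (simp add: averaged_price_def integral_exp)

lemma averaged_price_bounds:
  assumes "0 \<le> s" "s \<le> T"
  shows "0 \<le> averaged_price T g s" "averaged_price T g s \<le> 2 * exp K"
proof -
  have int: "(\<lambda>u. exp (g u)) integrable_on {0..s}"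
    using assms by (intro integrable_continuous_interval continuous_on_subset[OF continuous_exp_g]) auto
  have "0 \<le> integral {0..s} (\<lambda>u. exp (g u))"
    by (rule integral_nonneg[OF int]) simp
  then show "0 \<le> averaged_price T g s"
    using assms T_pos by (simp add: averaged_price_def integral_exp)
  have "integral {0..s} (\<lambda>u. exp (g u)) \<le> integral {0..s} (\<lambda>u. exp K)"
    using assms exp_le by (intro integral_le[OF int]) auto
  also have "\<dots> \<le> T * exp K"
    using assms by simp
  finally have "1 / T * integral {0..s} (\<lambda>u. exp (g u)) \<le> exp K"
    using T_pos by (simp add: divide_le_eq mult.commute)
  moreover have "(T - s) / T * exp (g s) \<le> 1 * exp K"
    using weight_le_1[OF assms] exp_le[OF assms] by (intro mult_mono) auto
  ultimately show "averaged_price T g s \<le> 2 * exp K"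
    using assms by (simp add: averaged_price_def integral_exp)
qed

lemma price_weight_bounds:
  assumes "0 \<le> s" "s \<le> T"
  shows "0 \<le> price_weight T g s" "price_weight T g s \<le> exp K"
proof -
  show "0 \<le> price_weight T g s"
    unfolding price_weight_def using weight_le_1[OF assms] by (intro mult_nonneg_nonneg) auto
  have "(T - s) / T * exp (g s) \<le> 1 * exp K"
    using weight_le_1[OF assms] exp_le[OF assms] by (intro mult_mono) auto
  then show "price_weight T g s \<le> exp K"
    by (simp add: price_weight_def)
qed

lemma continuous_price_weight: "continuous_on {0..T} (price_weight T g)"
  unfolding price_weight_def[abs_def] using T_pos by (intro continuous_intros continuous_exp_g) auto

lemma price_weight_holder:
  assumes uv: "0 \<le> u" "u \<le> T" "0 \<le> v" "v \<le> T"
  shows "\<bar>price_weight T g v - price_weight T g u\<bar> \<le> (exp K * L + exp K * T powr (1 - \<eta>) / T) * \<bar>v - u\<bar> powr \<eta>"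
proof -
  have eq: "price_weight T g v - price_weight T g u =
      (T - u) / T * (exp (g v) - exp (g u)) - (v - u) / T * exp (g v)"
    using T_pos by (simp add: price_weight_def field_simps)
  have a: "\<bar>(T - u) / T * (exp (g v) - exp (g u))\<bar> \<le> 1 * (exp K * L * \<bar>v - u\<bar> powr \<eta>)"
    unfolding abs_mult using weight_le_1[OF uv(1,2)] exp_holder[OF uv(3,4,1,2)] by (intro mult_mono) auto
  have b: "\<bar>(v - u) / T * exp (g v)\<bar> \<le> exp K * T powr (1 - \<eta>) / T * \<bar>v - u\<bar> powr \<eta>"
  proof -
    have "\<bar>v - u\<bar> = \<bar>v - u\<bar> powr \<eta> * \<bar>v - u\<bar> powr (1 - \<eta>)"
      by (cases "u = v") (simp_all add: powr_add[symmetric])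
    also have "\<dots> \<le> \<bar>v - u\<bar> powr \<eta> * T powr (1 - \<eta>)"
      using uv \<eta>_less_1 by (intro mult_left_mono powr_mono2) auto
    finally have "\<bar>v - u\<bar> * exp (g v) \<le> (\<bar>v - u\<bar> powr \<eta> * T powr (1 - \<eta>)) * exp K"
      using exp_le[OF uv(3,4)] by (intro mult_mono) auto
    then show ?thesis
      using T_pos by (simp add: abs_mult divide_le_cancel mult_ac)
  qed
  show ?thesis
    unfolding eq using order_trans[OF abs_triangle_ineq4 add_mono[OF a b]] by (simp only: distrib_right mult_1)
qed

end

text \<open>The increment of the product is split as \<open>\<bar>\<phi> s\<bar> * \<bar>H t - H
  s\<bar> + \<bar>H t\<bar> * \<bar>\<phi> t - \<phi> s\<bar>\<close>. This keeps the weight at the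
  earlier time \<open>s\<close>, the form in which the Gaussian estimate controls the rough factor
  \<open>H\<close>. The second term is of order \<open>(t - s) powr \<eta>\<close>, integrable
  against the kernel since \<open>b < \<eta>\<close>.\<close>

lemma W2_product:
  fixes H \<phi> :: "real \<Rightarrow> real"
  assumes T: "0 < T" and b: "0 < b" "b < \<eta>" "b < 1"
    and meas: "(\<lambda>s. indicator {0..T} s * H s) \<in> borel_measurable borel" "(\<lambda>s. indicator {0..T} s * \<phi> s) \<in> borel_measurable borel"
    and bounded: "\<And>s. 0 \<le> s \<Longrightarrow> s \<le> T \<Longrightarrow> \<bar>H s\<bar> \<le> C" "\<And>s. 0 \<le> s \<Longrightarrow> s \<le> T \<Longrightarrow> \<bar>\<phi> s\<bar> \<le> C'"
    and D: "0 \<le> D"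
    and holder: "\<And>s t. 0 \<le> s \<Longrightarrow> s \<le> T \<Longrightarrow> 0 \<le> t \<Longrightarrow> t \<le> T \<Longrightarrow> \<bar>\<phi> t - \<phi> s\<bar> \<le> D * \<bar>t - s\<bar> powr \<eta>"
    and fin: "(\<integral>\<^sup>+t. \<integral>\<^sup>+s. ennreal (\<bar>\<phi> s\<bar> * \<bar>H t - H s\<bar> * power_kernel (b + 1) (t - s)) * indicator {0..T} s * indicator {0..T} t \<partial>lborel \<partial>lborel) < \<infinity>"
  shows "(\<lambda>s. H s * \<phi> s) \<in> W2 T b"
proof -
  let ?d = "\<lambda>t s. \<bar>H t * \<phi> t - H s * \<phi> s\<bar>"
  define H0 where "H0 s = indicator {0..T} s * H s" for s
  define p0 where "p0 s = indicator {0..T} s * \<phi> s" for s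
  have [measurable]: "H0 \<in> borel_measurable borel" "p0 \<in> borel_measurable borel"
    using meas by (simp_all add: H0_def[abs_def] p0_def[abs_def])
  have C: "0 \<le> C" "0 \<le> C'" using bounded[of 0] T by linarith+
  have "(\<lambda>x. indicator {0..T} x *\<^sub>R (H x * \<phi> x)) = (\<lambda>x. H0 x * p0 x)"
    by (auto simp: H0_def p0_def indicator_def)
  then have m: "(\<lambda>s. H s * \<phi> s) \<in> borel_measurable (restrict_space borel {0..T})"
    by (simp add: borel_measurable_restrict_space_iff)
  have "(\<integral>\<^sup>+t\<in>{0..T}. ennreal (\<bar>H t * \<phi> t\<bar> / t powr b) \<partial>lborel) \<le>
      (\<integral>\<^sup>+t. ennreal (C * C') * ennreal (power_kernel b t * indicator {..T} t) \<partial>lborel)"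
  proof (rule nn_integral_mono)
    fix t
    show "ennreal (\<bar>H t * \<phi> t\<bar> / t powr b) * indicator {0..T} t \<le> ennreal (C * C') * ennreal (power_kernel b t * indicator {..T} t)"
    proof (cases "0 < t \<and> t \<le> T")
      case True
      then have "\<bar>H t * \<phi> t\<bar> \<le> C * C'"
        unfolding abs_mult using bounded C by (intro mult_mono) auto
      then have "\<bar>H t * \<phi> t\<bar> * t powr - b \<le> C * C' * t powr - b"
        by (intro mult_right_mono) auto
      then show ?thesis using True C
        by (subst ennreal_mult'[symmetric]) (auto simp: power_kernel_def powr_minus_divide intro!: ennreal_leI)
    qed (auto simp: indicator_def)
  qed
  also have "\<dots> = ennreal (C * C') * ennreal (T powr (1 - b) / (1 - b))"
    using b T by (subst nn_integral_cmult) (auto simp: nn_integral_power_kernel_atMost)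
  also have "\<dots> < \<infinity>" by (simp add: ennreal_mult_less_top)
  finally have 1: "(\<integral>\<^sup>+t\<in>{0..T}. ennreal (\<bar>H t * \<phi> t\<bar> / t powr b) \<partial>lborel) < \<infinity>" .
  define A where "A t s = ennreal (\<bar>p0 s\<bar> * \<bar>H0 t - H0 s\<bar> * power_kernel (b + 1) (t - s)) * indicator {0..T} s * indicator {0..T} t" for t s
  define E where "E t s = ennreal (C * D) * ennreal (power_kernel (1 + b - \<eta>) (t - s) * indicator {0..T} s * indicator {0..T} t)" for t s
  have [measurable]: "case_prod A \<in> borel_measurable (lborel \<Otimes>\<^sub>M lborel)" "case_prod E \<in> borel_measurable (lborel \<Otimes>\<^sub>M lborel)"
    unfolding A_def[abs_def] E_def[abs_def] by measurable
  have "(\<integral>\<^sup>+t\<in>{0..T}. (\<integral>\<^sup>+s\<in>{0..t}. ennreal (?d t s / (t - s) powr (b + 1)) \<partial>lborel) \<partial>lborel) \<le>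
     (\<integral>\<^sup>+t. \<integral>\<^sup>+s. A t s + E t s \<partial>lborel \<partial>lborel)"
  proof (rule nn_integral_mono)
    fix t
    show "(\<integral>\<^sup>+s\<in>{0..t}. ennreal (?d t s / (t - s) powr (b + 1)) \<partial>lborel) * indicator {0..T} t \<le>
      (\<integral>\<^sup>+s. A t s + E t s \<partial>lborel)"
    proof (cases "t \<in> {0..T}")
      case t: True
      have "(\<integral>\<^sup>+s\<in>{0..t}. ennreal (?d t s / (t - s) powr (b + 1)) \<partial>lborel) \<le> (\<integral>\<^sup>+s. A t s + E t s \<partial>lborel)"
      proof (rule nn_integral_mono)
        fix s
        show "ennreal (?d t s / (t - s) powr (b + 1)) * indicator {0..t} s \<le> A t s + E t s"
        proof (cases "0 \<le> s \<and> s < t")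
          case s: True
          define k where "k = (t - s) powr - (b + 1)"
          have k: "0 \<le> k" "power_kernel (b + 1) (t - s) = k" using s by (simp_all add: k_def power_kernel_def)
          have kD: "(t - s) powr \<eta> * k = power_kernel (1 + b - \<eta>) (t - s)"
            using s by (simp add: k_def power_kernel_def powr_add[symmetric] algebra_simps)
          have "?d t s \<le> \<bar>\<phi> s\<bar> * \<bar>H t - H s\<bar> + \<bar>H t\<bar> * \<bar>\<phi> t - \<phi> s\<bar>"
            unfolding abs_mult[symmetric] by (simp add: algebra_simps abs_if)
          also have "\<bar>H t\<bar> * \<bar>\<phi> t - \<phi> s\<bar> \<le> C * (D * \<bar>t - s\<bar> powr \<eta>)"
            using bounded(1)[of t] holder[of s t] s t C by (intro mult_mono) auto
          finally have "?d t s * k \<le> (\<bar>\<phi> s\<bar> * \<bar>H t - H s\<bar> + C * (D * \<bar>t - s\<bar> powr \<eta>)) * k"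
            using k by (intro mult_right_mono) auto
          also have "\<dots> = \<bar>\<phi> s\<bar> * \<bar>H t - H s\<bar> * k + C * D * power_kernel (1 + b - \<eta>) (t - s)"
            using s by (simp add: kD[symmetric] distrib_right mult.assoc)
          finally have "ennreal (?d t s * k) \<le>
              ennreal (\<bar>\<phi> s\<bar> * \<bar>H t - H s\<bar> * k + C * D * power_kernel (1 + b - \<eta>) (t - s))"
            by (rule ennreal_leI)
          also have "\<dots> = ennreal (\<bar>\<phi> s\<bar> * \<bar>H t - H s\<bar> * k) + ennreal (C * D * power_kernel (1 + b - \<eta>) (t - s))"
            using C D k(1) by (intro ennreal_plus) auto
          finally have "ennreal (?d t s * k) \<le>
              ennreal (\<bar>\<phi> s\<bar> * \<bar>H t - H s\<bar> * k) + ennreal (C * D * power_kernel (1 + b - \<eta>) (t - s))" .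
          moreover have "?d t s / (t - s) powr (b + 1) = ?d t s * k"
            by (simp only: k_def powr_minus_divide) simp
          ultimately show ?thesis
            using s t C D by (simp add: A_def E_def H0_def p0_def k ennreal_mult'[symmetric])
        qed (auto simp: indicator_def)
      qed
      then show ?thesis using t by simp
    qed simp
  qed
  also have "\<dots> = (\<integral>\<^sup>+t. \<integral>\<^sup>+s. A t s \<partial>lborel \<partial>lborel) + (\<integral>\<^sup>+t. \<integral>\<^sup>+s. E t s \<partial>lborel \<partial>lborel)"
    by (simp add: nn_integral_add)
  also have "\<dots> < \<infinity>"
  proof -
    have "(\<integral>\<^sup>+t. \<integral>\<^sup>+s. A t s \<partial>lborel \<partial>lborel) =
        (\<integral>\<^sup>+t. \<integral>\<^sup>+s. ennreal (\<bar>\<phi> s\<bar> * \<bar>H t - H s\<bar> * power_kernel (b + 1) (t - s)) * indicator {0..T} s * indicator {0..T} t \<partial>lborel \<partial>lborel)"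
      by (intro nn_integral_cong) (auto simp: A_def H0_def p0_def indicator_def)
    with fin have "(\<integral>\<^sup>+t. \<integral>\<^sup>+s. A t s \<partial>lborel \<partial>lborel) < \<infinity>" by simp
    moreover have "(\<integral>\<^sup>+t. \<integral>\<^sup>+s. E t s \<partial>lborel \<partial>lborel) < \<infinity>"
    proof -
      define m where "m = T powr (\<eta> - b) / (\<eta> - b)"
      have "(\<integral>\<^sup>+s. E t s \<partial>lborel) \<le> ennreal (C * D * m) * indicator {0..T} t" for t
      proof (cases "t \<in> {0..T}")
        case True
        have "(\<integral>\<^sup>+s. E t s \<partial>lborel) \<le> (\<integral>\<^sup>+s. ennreal (C * D) * ennreal (power_kernel (1 + b - \<eta>) (t - s) * indicator {0..} s) \<partial>lborel)"
          using True by (intro nn_integral_mono) (auto simp: E_def indicator_def)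
        also have "\<dots> = ennreal (C * D) * (\<integral>\<^sup>+r. ennreal (power_kernel (1 + b - \<eta>) r * indicator {..t} r) \<partial>lborel)"
          by (simp add: nn_integral_cmult nn_integral_power_kernel_reflect)
        also have "\<dots> = ennreal (C * D) * ennreal (t powr (\<eta> - b) / (\<eta> - b))"
          using True b by (subst nn_integral_power_kernel_atMost) auto
        also have "\<dots> \<le> ennreal (C * D) * ennreal m"
          using True b by (intro mult_left_mono ennreal_leI) (auto simp: m_def intro!: divide_right_mono powr_mono2)
        finally show ?thesis
          using True C D b by (simp add: m_def ennreal_mult'[symmetric])
      qed (simp add: E_def)
      then have "(\<integral>\<^sup>+t. \<integral>\<^sup>+s. E t s \<partial>lborel \<partial>lborel) \<le> (\<integral>\<^sup>+t. ennreal (C * D * m) * indicator {0..T} t \<partial>lborel)"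
        by (intro nn_integral_mono)
      also have "\<dots> < \<infinity>"
        using T by (simp add: nn_integral_cmult ennreal_mult_less_top emeasure_lborel_Icc_eq)
      finally show ?thesis .
    qed
    ultimately show ?thesis by simp
  qed
  finally show ?thesis
    using m 1 by (simp add: W2_def norm_W2_def)
qed

section \<open>Gaussian regression\<close>

lemma norm_iexp_of_real [simp]: "norm (iexp x) = 1"
  by (simp add: norm_exp_i_times)

section \<open>Uniqueness of joint laws from characteristic functions\<close>

lemma (in prob_space) integrable_bounded_measurable:
  fixes f :: "'a \<Rightarrow> 'b::{banach, second_countable_topology}"
  assumes "f \<in> borel_measurable M" "\<And>x. norm (f x) \<le> c"
  shows "integrable M f"
  using assms by (intro integrable_const_bound[where B = c]) auto

text \<open>Weights bounded below by 1 can be normalised to probability densities, with equal total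
  masses by \<open>\<mu> = 0\<close>. The weighted transforms become characteristic functions of the
  image laws, and Levy's uniqueness theorem applies.\<close>

lemma weighted_char_uniqueness_pos:
  fixes w1 :: "'a \<Rightarrow> real" and w2 :: "'b \<Rightarrow> real"
  assumes M1: "prob_space M1" and M2: "prob_space M2"
    and [measurable]: "w1 \<in> borel_measurable M1" "w2 \<in> borel_measurable M2" "Y1 \<in> borel_measurable M1" "Y2 \<in> borel_measurable M2"
    and w1: "\<And>x. 1 \<le> w1 x" "\<And>x. w1 x \<le> c" and w2: "\<And>x. 1 \<le> w2 x" "\<And>x. w2 x \<le> c"
    and eq: "\<And>\<mu>. (CLINT x|M1. w1 x * iexp (\<mu> * Y1 x)) = (CLINT x|M2. w2 x * iexp (\<mu> * Y2 x))"
    and A [measurable]: "A \<in> sets borel"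
  shows "(LINT x|M1. w1 x * indicator A (Y1 x)) = (LINT x|M2. w2 x * indicator A (Y2 x))"
proof -
  interpret M1: prob_space M1 by fact
  interpret M2: prob_space M2 by fact
  define m where "m = (LINT x|M1. w1 x)"
  have "norm (w1 x) \<le> c" for x using w1(1)[of x] w1(2)[of x] by simp
  then have i1: "integrable M1 w1" by (intro M1.integrable_bounded_measurable[of _ c]) simp_all
  have "norm (w2 x) \<le> c" for x using w2(1)[of x] w2(2)[of x] by simp
  then have i2: "integrable M2 w2" by (intro M2.integrable_bounded_measurable[of _ c]) simp_all
  have w1n: "0 \<le> w1 x" for x using w1(1)[of x] by linarith
  have w2n: "0 \<le> w2 x" for x using w2(1)[of x] by linarith
  have m2: "m = (LINT x|M2. w2 x)"
    using eq[of 0] by (simp add: m_def)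
  have "1 \<le> m"
    using integral_mono[of M1 "\<lambda>_. 1" w1] i1 w1 by (simp add: m_def M1.prob_space)
  then have m: "0 < m" by simp
  define N1 where "N1 = distr (density M1 (\<lambda>x. ennreal (w1 x / m))) borel Y1"
  define N2 where "N2 = distr (density M2 (\<lambda>x. ennreal (w2 x / m))) borel Y2"
  have p1: "prob_space (density M1 (\<lambda>x. ennreal (w1 x / m)))"
    using i1 w1n m by (intro prob_spaceI) (simp add: emeasure_density nn_integral_eq_integral m_def cong: nn_integral_cong_simp)
  have p2: "prob_space (density M2 (\<lambda>x. ennreal (w2 x / m)))"
    using i2 w2n m by (intro prob_spaceI) (simp add: emeasure_density nn_integral_eq_integral m2 cong: nn_integral_cong_simp)
  have r1: "real_distribution N1"
    unfolding N1_def by (rule prob_space.real_distribution_distr[OF p1]) simp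
  have r2: "real_distribution N2"
    unfolding N2_def by (rule prob_space.real_distribution_distr[OF p2]) simp
  have "char N1 l = (CLINT x|M1. w1 x * iexp (l * Y1 x)) / m" for l
    using w1n m by (simp add: char_def N1_def integral_distr integral_density scaleR_conv_of_real)
  moreover have "char N2 l = (CLINT x|M2. w2 x * iexp (l * Y2 x)) / m" for l
    using w2n m by (simp add: char_def N2_def integral_distr integral_density scaleR_conv_of_real)
  ultimately have "char N1 = char N2"
    using eq by auto
  then have N: "N1 = N2" by (rule Levy_uniqueness[OF r1 r2])
  have "(LINT y|N1. indicator A y) = (LINT x|M1. w1 x * indicator A (Y1 x)) / m"
    unfolding N1_def using w1n m by (subst integral_distr, simp, simp, subst integral_density) simp_all
  moreover have "(LINT y|N2. indicator A y) = (LINT x|M2. w2 x * indicator A (Y2 x)) / m"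
    unfolding N2_def using w2n m by (subst integral_distr, simp, simp, subst integral_density) simp_all
  ultimately show ?thesis using N m by simp
qed

text \<open>Conjugation turns \<open>\<mu>\<close> into \<open>- \<mu>\<close>, so the transform
  with the real weight \<open>Re (c * W x)\<close> is determined by the complex-weighted transforms
  at \<open>\<mu>\<close> and \<open>- \<mu>\<close>.\<close>

lemma (in prob_space) expectation_Re_iexp:
  assumes [measurable]: "W \<in> borel_measurable M" "Y \<in> borel_measurable M" and W: "\<And>x. norm (W x) \<le> 1"
  shows "(CLINT x|M. Re (c * W x) * iexp (\<mu> * Y x)) =
    (c * (CLINT x|M. W x * iexp (\<mu> * Y x)) + cnj (c * (CLINT x|M. W x * iexp (- \<mu> * Y x)))) / 2"
proof -
  have [measurable]: "cnj \<in> borel_measurable borel"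
    by (intro borel_measurable_continuous_onI continuous_intros)
  have i: "integrable M (\<lambda>x. W x * iexp (\<nu> * Y x))" for \<nu>
    using W by (intro integrable_bounded_measurable[of _ 1]) (auto simp: norm_mult)
  have Re: "complex_of_real (Re z) = (z + cnj z) / 2" for z
    by (simp add: complex_add_cnj)
  have pt: "complex_of_real (Re (c * W x)) * iexp (\<mu> * Y x) =
      (c * (W x * iexp (\<mu> * Y x)) + cnj (c * (W x * iexp (- \<mu> * Y x)))) / 2" for x
    unfolding Re by (simp add: exp_cnj distrib_right)
  have "(CLINT x|M. cnj (c * (W x * iexp (- \<mu> * Y x)))) = cnj (c * (CLINT x|M. W x * iexp (- \<mu> * Y x)))"
    by (simp only: integral_bounded_linear[OF bounded_linear_cnj integrable_mult_right[OF i]] integral_mult_right_zero)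
  then show ?thesis
    unfolding pt integral_divide_zero
    by (subst Bochner_Integration.integral_add)
      (simp_all only: integral_mult_right_zero integrable_mult_right[OF i] integrable_bounded_linear[OF bounded_linear_cnj integrable_mult_right[OF i]])
qed

lemma (in prob_space) expectation_shifted_weight:
  fixes V :: "'a \<Rightarrow> 'b::{banach, second_countable_topology}" and r :: "'a \<Rightarrow> real"
  assumes [measurable]: "r \<in> borel_measurable M" "V \<in> borel_measurable M"
    and "\<And>x. \<bar>r x\<bar> \<le> 1" "\<And>x. norm (V x) \<le> 1"
  shows "(LINT x|M. (r x + 2) *\<^sub>R V x) = (LINT x|M. r x *\<^sub>R V x) + 2 *\<^sub>R (LINT x|M. V x)"
proof -
  have "integrable M (\<lambda>x. r x *\<^sub>R V x)" "integrable M V"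
    using assms(3,4) by (auto intro!: integrable_bounded_measurable[of _ 1] mult_le_one)
  then show ?thesis
    unfolding scaleR_left_distrib by simp
qed

text \<open>A complex weight of modulus at most 1 reduces to positive ones:
  \<open>Re (c * W) + 2\<close> lies between 1 and 3, and \<open>char\<close> accounts for the added
  constant. The choices \<open>c = 1\<close> and \<open>c = - \<i>\<close> give the real and the
  imaginary part.\<close>

lemma weighted_char_uniqueness:
  fixes W1 :: "'a \<Rightarrow> complex" and W2 :: "'b \<Rightarrow> complex"
  assumes M1: "prob_space M1" and M2: "prob_space M2"
    and [measurable]: "W1 \<in> borel_measurable M1" "W2 \<in> borel_measurable M2" "Y1 \<in> borel_measurable M1" "Y2 \<in> borel_measurable M2"
    and W1: "\<And>x. norm (W1 x) \<le> 1" and W2: "\<And>x. norm (W2 x) \<le> 1"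
    and char: "\<And>\<mu>. (CLINT x|M1. iexp (\<mu> * Y1 x)) = (CLINT x|M2. iexp (\<mu> * Y2 x))"
    and eq: "\<And>\<mu>. (CLINT x|M1. W1 x * iexp (\<mu> * Y1 x)) = (CLINT x|M2. W2 x * iexp (\<mu> * Y2 x))"
    and A [measurable]: "A \<in> sets borel"
  shows "(CLINT x|M1. W1 x * indicator A (Y1 x)) = (CLINT x|M2. W2 x * indicator A (Y2 x))"
proof -
  interpret M1: prob_space M1 by fact
  interpret M2: prob_space M2 by fact
  have Re_eq: "(LINT x|M1. Re (c * W1 x) * indicator A (Y1 x)) = (LINT x|M2. Re (c * W2 x) * indicator A (Y2 x))"
    if c: "norm c = 1" for c
  proof -
    have b: "\<bar>Re (c * W1 x)\<bar> \<le> 1" "\<bar>Re (c * W2 y)\<bar> \<le> 1" for x y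
      using W1[of x] W2[of y] abs_Re_le_cmod[of "c * W1 x"] abs_Re_le_cmod[of "c * W2 y"] c by (auto simp: norm_mult)
    have two: "1 \<le> Re (c * W1 x) + 2 \<and> Re (c * W1 x) + 2 \<le> 3" "1 \<le> Re (c * W2 y) + 2 \<and> Re (c * W2 y) + 2 \<le> 3" for x y
      using b(1)[of x] b(2)[of y] by linarith+
    have Re: "(CLINT x|M1. Re (c * W1 x) * iexp (\<mu> * Y1 x)) = (CLINT x|M2. Re (c * W2 x) * iexp (\<mu> * Y2 x))" for \<mu>
      using W1 W2 eq by (simp only: M1.expectation_Re_iexp M2.expectation_Re_iexp assms(3-6))
    have sc: "(LINT x|M1. (Re (c * W1 x) + 2) *\<^sub>R iexp (\<mu> * Y1 x)) = (LINT x|M2. (Re (c * W2 x) + 2) *\<^sub>R iexp (\<mu> * Y2 x))" for \<mu>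
    proof -
      have "(LINT x|M1. (Re (c * W1 x) + 2) *\<^sub>R iexp (\<mu> * Y1 x)) = (LINT x|M1. Re (c * W1 x) *\<^sub>R iexp (\<mu> * Y1 x)) + 2 *\<^sub>R (LINT x|M1. iexp (\<mu> * Y1 x))"
      proof (rule M1.expectation_shifted_weight)
        show "\<bar>Re (c * W1 x)\<bar> \<le> 1" for x by (rule b)
        show "norm (iexp (\<mu> * Y1 x)) \<le> 1" for x by (simp only: norm_iexp_of_real)
      qed measurable
      moreover have "(LINT x|M2. (Re (c * W2 x) + 2) *\<^sub>R iexp (\<mu> * Y2 x)) = (LINT x|M2. Re (c * W2 x) *\<^sub>R iexp (\<mu> * Y2 x)) + 2 *\<^sub>R (LINT x|M2. iexp (\<mu> * Y2 x))"
      proof (rule M2.expectation_shifted_weight)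
        show "\<bar>Re (c * W2 x)\<bar> \<le> 1" for x by (rule b)
        show "norm (iexp (\<mu> * Y2 x)) \<le> 1" for x by (simp only: norm_iexp_of_real)
      qed measurable
      ultimately show ?thesis by (simp only: scaleR_conv_of_real Re char)
    qed
    have "(LINT x|M1. (Re (c * W1 x) + 2) * indicator A (Y1 x)) = (LINT x|M2. (Re (c * W2 x) + 2) * indicator A (Y2 x))"
      using two sc by (intro weighted_char_uniqueness_pos[OF M1 M2, where c = 3])
        (simp_all add: scaleR_conv_of_real del: times_complex.sel)
    moreover have "(LINT x|M1. 1 * indicator A (Y1 x) :: real) = (LINT x|M2. 1 * indicator A (Y2 x))"
      by (rule weighted_char_uniqueness_pos[OF M1 M2, where c = 3]) (use char in simp_all)
    ultimately show ?thesis
      using M1.expectation_shifted_weight[of "\<lambda>x. Re (c * W1 x)" "\<lambda>x. indicator A (Y1 x) :: real"]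
        M2.expectation_shifted_weight[of "\<lambda>x. Re (c * W2 x)" "\<lambda>x. indicator A (Y2 x) :: real"] b
      by (simp del: times_complex.sel)
  qed
  have i1: "integrable M1 (\<lambda>x. W1 x * indicator A (Y1 x))"
    using W1 by (intro M1.integrable_bounded_measurable[of _ 1]) (auto simp: norm_mult indicator_def)
  have i2: "integrable M2 (\<lambda>x. W2 x * indicator A (Y2 x))"
    using W2 by (intro M2.integrable_bounded_measurable[of _ 1]) (auto simp: norm_mult indicator_def)
  have part: "Re (z * indicator A y) = Re z * indicator A y" "Im (z * indicator A y) = Re (- \<i> * z) * indicator A y" for z and y :: real
    by (simp_all add: indicator_def)
  show ?thesis
    using Re_eq[of 1] Re_eq[of "- \<i>"]
    by (intro complex_eqI) (simp_all only: integral_Re[OF i1, symmetric] integral_Re[OF i2, symmetric]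
        integral_Im[OF i1, symmetric] integral_Im[OF i2, symmetric] part mult_1 norm_one norm_minus_cancel norm_ii)
qed

text \<open>Exponentials are exchanged for indicators one coordinate at a time. At each stage the
  indicators already obtained and the remaining exponentials form a complex weight of modulus at
  most 1, so the one-dimensional \<open>weighted_char_uniqueness\<close> suffices. In the end all
  rectangles have equal measure.\<close>

lemma char_uniqueness_PiM:
  fixes V1 :: "'i \<Rightarrow> 'a \<Rightarrow> real" and V2 :: "'i \<Rightarrow> 'b \<Rightarrow> real"
  assumes M1: "prob_space M1" and M2: "prob_space M2" and J: "finite J"
    and V1 [measurable]: "\<And>j. V1 j \<in> borel_measurable M1" and V2 [measurable]: "\<And>j. V2 j \<in> borel_measurable M2"
    and eq: "\<And>\<mu>. (CLINT x|M1. iexp (\<Sum>j\<in>J. \<mu> j * V1 j x)) = (CLINT x|M2. iexp (\<Sum>j\<in>J. \<mu> j * V2 j x))"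
  shows "distr M1 (\<Pi>\<^sub>M j\<in>J. borel) (\<lambda>x. \<lambda>j\<in>J. V1 j x) = distr M2 (\<Pi>\<^sub>M j\<in>J. borel) (\<lambda>x. \<lambda>j\<in>J. V2 j x)"
proof -
  interpret M1: prob_space M1 by fact
  interpret M2: prob_space M2 by fact
  have rect: "(CLINT x|M1. (\<Prod>j\<in>A. indicator (S j) (V1 j x)) * iexp (\<Sum>j\<in>J - A. \<mu> j * V1 j x)) =
      (CLINT x|M2. (\<Prod>j\<in>A. indicator (S j) (V2 j x)) * iexp (\<Sum>j\<in>J - A. \<mu> j * V2 j x))"
    if S [measurable]: "\<And>j. S j \<in> sets borel" and "A \<subseteq> J" for A S \<mu>
    using finite_subset[OF \<open>A \<subseteq> J\<close> J] \<open>A \<subseteq> J\<close>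
  proof (induction A arbitrary: \<mu> rule: finite_induct)
    case empty
    then show ?case using eq[of \<mu>] by simp
  next
    case (insert k A)
    have JA: "J - A = insert k (J - insert k A)" "finite (J - insert k A)" "k \<notin> J - insert k A"
      using insert J by auto
    define W1 where "W1 x = (\<Prod>j\<in>A. indicator (S j) (V1 j x)) * iexp (\<Sum>j\<in>J - insert k A. \<mu> j * V1 j x)" for x
    define W2 where "W2 x = (\<Prod>j\<in>A. indicator (S j) (V2 j x)) * iexp (\<Sum>j\<in>J - insert k A. \<mu> j * V2 j x)" for x
    have le: "norm (\<Prod>j\<in>A. indicator (S j) (y j) :: complex) \<le> 1" for y :: "'i \<Rightarrow> real"
      by (subst prod_norm[symmetric], rule prod_le_1) (auto simp: indicator_def)
    have "(CLINT x|M1. W1 x * indicator (S k) (V1 k x)) = (CLINT x|M2. W2 x * indicator (S k) (V2 k x))"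
    proof (rule weighted_char_uniqueness[OF M1 M2])
      show "W1 \<in> borel_measurable M1" "W2 \<in> borel_measurable M2"
        unfolding W1_def[abs_def] W2_def[abs_def] by measurable
      show "norm (W1 x) \<le> 1" for x using le by (simp add: W1_def norm_mult)
      show "norm (W2 x) \<le> 1" for x using le by (simp add: W2_def norm_mult)
      fix l
      show "(CLINT x|M1. iexp (l * V1 k x)) = (CLINT x|M2. iexp (l * V2 k x))"
        using eq[of "\<lambda>j. if j = k then l else 0"] insert.prems J by (simp add: if_distrib[of "\<lambda>x. x * _"] sum.delta cong: if_cong)
      have s1: "(\<Sum>j\<in>J - A. (\<mu>(k := l)) j * V1 j x) = l * V1 k x + (\<Sum>j\<in>J - insert k A. \<mu> j * V1 j x)" for x
        unfolding JA(1) using JA(2,3) by (subst sum.insert) (auto intro!: sum.cong)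
      have s2: "(\<Sum>j\<in>J - A. (\<mu>(k := l)) j * V2 j x) = l * V2 k x + (\<Sum>j\<in>J - insert k A. \<mu> j * V2 j x)" for x
        unfolding JA(1) using JA(2,3) by (subst sum.insert) (auto intro!: sum.cong)
      show "(CLINT x|M1. W1 x * iexp (l * V1 k x)) = (CLINT x|M2. W2 x * iexp (l * V2 k x))"
        using insert.IH[of "\<mu>(k := l)"] insert.prems unfolding s1 s2
        by (simp add: W1_def W2_def exp_add distrib_left mult_ac)
    qed simp_all
    then show ?case using insert.hyps by (simp add: W1_def W2_def mult_ac)
  qed
  have em: "emeasure (distr M (\<Pi>\<^sub>M j\<in>J. borel) (\<lambda>x. \<lambda>j\<in>J. V j x)) (Pi\<^sub>E J S) = ennreal (LINT x|M. (\<Prod>j\<in>J. indicator (S j) (V j x)))"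
    if "prob_space M" and [measurable]: "\<And>j. V j \<in> borel_measurable M" and S: "\<And>j. j \<in> J \<Longrightarrow> S j \<in> sets borel" for M :: "'c measure" and V S
  proof -
    interpret prob_space M by fact
    have PS: "Pi\<^sub>E J S \<in> sets (\<Pi>\<^sub>M j\<in>J. borel)" using S J by (intro sets_PiM_I_finite) auto
    have "emeasure (distr M (\<Pi>\<^sub>M j\<in>J. borel) (\<lambda>x. \<lambda>j\<in>J. V j x)) (Pi\<^sub>E J S) = emeasure M ((\<lambda>x. \<lambda>j\<in>J. V j x) -` Pi\<^sub>E J S \<inter> space M)"
      using PS by (subst emeasure_distr) auto
    also have "\<dots> = ennreal (measure M ((\<lambda>x. \<lambda>j\<in>J. V j x) -` Pi\<^sub>E J S \<inter> space M))"
      by (rule emeasure_eq_measure)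
    also have "measure M ((\<lambda>x. \<lambda>j\<in>J. V j x) -` Pi\<^sub>E J S \<inter> space M) = (LINT x|M. indicator ((\<lambda>x. \<lambda>j\<in>J. V j x) -` Pi\<^sub>E J S \<inter> space M) x)"
      by simp
    also have "\<dots> = (LINT x|M. (\<Prod>j\<in>J. indicator (S j) (V j x)))"
      using J by (intro Bochner_Integration.integral_cong refl) (auto simp: indicator_def PiE_iff prod_eq_1_iff)
    finally show ?thesis .
  qed
  show ?thesis
  proof (rule measure_eqI_PiM_finite[OF J, where A = "\<lambda>_. space (\<Pi>\<^sub>M j\<in>J. borel)"])
    fix S :: "'i \<Rightarrow> real set" assume S: "\<And>j. j \<in> J \<Longrightarrow> S j \<in> sets borel"
    \<comment> \<open>\<open>rect\<close> asks for a Borel set at every index; the empty set fills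
      those outside \<open>J\<close>.\<close>
    define S' where "S' j = (if j \<in> J then S j else {})" for j
    have S': "S' j \<in> sets borel" for j using S by (auto simp: S'_def)
    have h: "(\<Prod>j\<in>J. indicator (S' j) (y j)) = complex_of_real (\<Prod>j\<in>J. indicator (S j) (y j))" for y :: "'i \<Rightarrow> real"
      by (auto simp: S'_def indicator_def intro!: prod.cong)
    have "complex_of_real (LINT x|M1. (\<Prod>j\<in>J. indicator (S j) (V1 j x))) = (CLINT x|M1. (\<Prod>j\<in>J. indicator (S' j) (V1 j x)))"
      by (simp only: h integral_complex_of_real)
    also have "\<dots> = (CLINT x|M2. (\<Prod>j\<in>J. indicator (S' j) (V2 j x)))"
      using rect[OF S' order_refl] by simp
    also have "\<dots> = complex_of_real (LINT x|M2. (\<Prod>j\<in>J. indicator (S j) (V2 j x)))"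
      by (simp only: h integral_complex_of_real)
    finally show "emeasure (distr M1 (\<Pi>\<^sub>M j\<in>J. borel) (\<lambda>x. \<lambda>j\<in>J. V1 j x)) (Pi\<^sub>E J S) =
        emeasure (distr M2 (\<Pi>\<^sub>M j\<in>J. borel) (\<lambda>x. \<lambda>j\<in>J. V2 j x)) (Pi\<^sub>E J S)"
      using em[OF M1 V1 S] em[OF M2 V2 S] by simp
  next
    show "range (\<lambda>_. space (\<Pi>\<^sub>M j\<in>J. borel :: real measure)) \<subseteq> prod_algebra J (\<lambda>_. borel)"
      using J by (auto simp: space_PiM intro!: prod_algebraI_finite)
    have "prob_space (distr M1 (\<Pi>\<^sub>M j\<in>J. borel) (\<lambda>x. \<lambda>j\<in>J. V1 j x))"
      by (rule M1.prob_space_distr) simp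
    then show "emeasure (distr M1 (\<Pi>\<^sub>M j\<in>J. borel) (\<lambda>x. \<lambda>j\<in>J. V1 j x)) (space (\<Pi>\<^sub>M j\<in>J. borel)) \<noteq> \<infinity>"
      using prob_space.emeasure_space_1[of "distr M1 (\<Pi>\<^sub>M j\<in>J. borel) (\<lambda>x. \<lambda>j\<in>J. V1 j x)"] by simp
  qed simp_all
qed

text \<open>Constants obey the same formula with variance 0, so degenerate linear combinations need
  no separate treatment later.\<close>

lemma (in prob_space) gaussian_rv_square_integrable:
  assumes "gaussian_rv M X"
  shows "X \<in> borel_measurable M" "integrable M X" "integrable M (\<lambda>\<omega>. (X \<omega> - expectation X)\<^sup>2)"
    and gaussian_rv_char: "(CLINT \<omega>|M. iexp (X \<omega>)) = iexp (expectation X) * exp (- variance X / 2)"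
proof -
  show [measurable]: "X \<in> borel_measurable M" using assms by (simp add: gaussian_rv_def)
  consider \<mu> where "AE \<omega> in M. X \<omega> = \<mu>"
    | \<mu> \<sigma> where "0 < \<sigma>" "distributed M lborel X (normal_density \<mu> \<sigma>)"
    using assms by (auto simp: gaussian_rv_def)
  then have "integrable M X \<and> integrable M (\<lambda>\<omega>. (X \<omega> - expectation X)\<^sup>2) \<and>
      (CLINT \<omega>|M. iexp (X \<omega>)) = iexp (expectation X) * exp (- variance X / 2)"
  proof cases
    case 1
    have e: "expectation X = \<mu>"
      using integral_cong_AE[of X M "\<lambda>_. \<mu>"] 1 by (simp add: prob_space)
    have "integrable M X"
      using 1 integrable_cong_AE[of X M "\<lambda>_. \<mu>"] by simp
    moreover have "AE \<omega> in M. (X \<omega> - \<mu>)\<^sup>2 = 0" using 1 by eventually_elim simp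
    then have "integrable M (\<lambda>\<omega>. (X \<omega> - \<mu>)\<^sup>2)" "variance X = 0"
      using integrable_cong_AE[of "\<lambda>\<omega>. (X \<omega> - \<mu>)\<^sup>2" M "\<lambda>_. 0"] integral_cong_AE[of "\<lambda>\<omega>. (X \<omega> - \<mu>)\<^sup>2" M "\<lambda>_. 0"] e by simp_all
    moreover have "(CLINT \<omega>|M. iexp (X \<omega>)) = (CLINT \<omega>|M. iexp \<mu>)"
      using 1 by (intro integral_cong_AE) (auto elim: eventually_mono)
    ultimately show ?thesis by (simp add: e prob_space)
  next
    case 2
    note D = 2(2) and [arith] = 2(1)
    have e: "expectation X = \<mu>" by (rule normal_distributed_expectation[OF 2])
    have v: "variance X = \<sigma>\<^sup>2" by (rule normal_distributed_variance[OF 2])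
    have "integrable M X"
      using distributed_integrable[OF D, of "\<lambda>x. x"] integrable_normal_moment_nz_1[of \<sigma> \<mu>] by simp
    moreover have "integrable M (\<lambda>\<omega>. (X \<omega> - expectation X)\<^sup>2)"
      using distributed_integrable[OF D, of "\<lambda>x. (x - \<mu>)\<^sup>2"] integrable_normal_moment[of \<sigma> \<mu> 2] by (simp add: e)
    moreover have "(CLINT \<omega>|M. iexp (X \<omega>)) = iexp (expectation X) * exp (- variance X / 2)"
    proof -
      define Y where "Y \<omega> = (X \<omega> - \<mu>) / \<sigma>" for \<omega>
      have "distributed M lborel Y std_normal_density"
        unfolding Y_def using D normal_standard_normal_convert[of \<sigma> X \<mu>] by simp
      then have Yd: "distr M lborel Y = std_normal_distribution"
        by (rule distributed_distr_eq_density)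
      have [measurable]: "Y \<in> borel_measurable M" unfolding Y_def by measurable
      have "(CLINT \<omega>|M. iexp (\<sigma> * Y \<omega>)) = char (distr M lborel Y) \<sigma>"
        by (simp add: char_def integral_distr)
      also have "\<dots> = complex_of_real (exp (- (\<sigma>\<^sup>2) / 2))"
        by (simp only: Yd char_std_normal_distribution)
      finally have Yc: "(CLINT \<omega>|M. iexp (\<sigma> * Y \<omega>)) = complex_of_real (exp (- (\<sigma>\<^sup>2) / 2))" .
      have "iexp (X \<omega>) = iexp \<mu> * iexp (\<sigma> * Y \<omega>)" for \<omega>
      proof -
        have "X \<omega> = \<mu> + \<sigma> * Y \<omega>" by (simp add: Y_def)
        then show ?thesis by (simp only: of_real_add distrib_left exp_add)
      qed
      then have "(CLINT \<omega>|M. iexp (X \<omega>)) = iexp \<mu> * (CLINT \<omega>|M. iexp (\<sigma> * Y \<omega>))"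
        by (simp only: integral_mult_right_zero)
      then show ?thesis unfolding v by (simp only: Yc e)
    qed
    ultimately show ?thesis by blast
  qed
  then show "integrable M X" "integrable M (\<lambda>\<omega>. (X \<omega> - expectation X)\<^sup>2)"
    "(CLINT \<omega>|M. iexp (X \<omega>)) = iexp (expectation X) * exp (- variance X / 2)" by auto
qed

section \<open>Regression of a Gaussian process on its value at one time\<close>

lemma integrable_mult_square_integrable:
  fixes f g :: "'a \<Rightarrow> real"
  assumes [measurable]: "f \<in> borel_measurable M" "g \<in> borel_measurable M"
    and "integrable M (\<lambda>x. (f x)\<^sup>2)" "integrable M (\<lambda>x. (g x)\<^sup>2)"
  shows "integrable M (\<lambda>x. f x * g x)"
proof (rule Bochner_Integration.integrable_bound)
  show "integrable M (\<lambda>x. (f x)\<^sup>2 + (g x)\<^sup>2)" using assms by simp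
  have "norm (f x * g x) \<le> norm ((f x)\<^sup>2 + (g x)\<^sup>2)" for x
  proof -
    have "2 * (\<bar>f x\<bar> * \<bar>g x\<bar>) \<le> (f x)\<^sup>2 + (g x)\<^sup>2"
      using sum_squares_bound[of "\<bar>f x\<bar>" "\<bar>g x\<bar>"] by (simp add: mult.assoc)
    moreover have "0 \<le> \<bar>f x\<bar> * \<bar>g x\<bar>" by simp
    ultimately have "\<bar>f x\<bar> * \<bar>g x\<bar> \<le> (f x)\<^sup>2 + (g x)\<^sup>2" by linarith
    then show ?thesis by (simp add: abs_mult)
  qed
  then show "AE x in M. norm (f x * g x) \<le> norm ((f x)\<^sup>2 + (g x)\<^sup>2)" by simp
qed simp

text \<open>The hypothesis on \<open>\<rho>\<close> makes \<open>B u - \<rho> u * B s\<close> uncorrelated with \<open>B s\<close>; by Gaussianity these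
  residuals are then jointly independent of \<open>B s\<close>.\<close>

locale gaussian_regression = prob_space M for M :: "'a measure" +
  fixes B :: "real \<Rightarrow> 'a \<Rightarrow> real" and s :: real and U :: "real set" and \<rho> :: "real \<Rightarrow> real"
  assumes gaussian: "gaussian_process M B" and s_nonneg: "0 \<le> s"
    and finite_U: "finite U" and U_nonneg: "\<And>u. u \<in> U \<Longrightarrow> 0 \<le> u" and s_notin_U: "s \<notin> U"
    and \<rho>: "\<And>u. u \<in> U \<Longrightarrow> covariance M (B u) (B s) = \<rho> u * covariance M (B s) (B s)"
begin

definition residual :: "real \<Rightarrow> 'a \<Rightarrow> real" where
  "residual u \<omega> = B u \<omega> - \<rho> u * B s \<omega>"

lemma gaussian_combination:
  "gaussian_rv M (\<lambda>\<omega>. a * B s \<omega> + (\<Sum>u\<in>U. b u * residual u \<omega>))"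
proof -
  \<comment> \<open>Expanding the residuals moves \<open>- (\<Sum>u\<in>U. b u * \<rho> u)\<close>
    onto the coefficient of \<open>B s\<close>, which is separate from the others because
    \<open>s \<notin> U\<close>.\<close>
  define c where "c u = (if u = s then a - (\<Sum>u\<in>U. b u * \<rho> u) else b u)" for u
  have "gaussian_rv M (\<lambda>\<omega>. \<Sum>u\<in>insert s U. c u * B u \<omega>)"
    using gaussian[unfolded gaussian_process_def, rule_format, of "insert s U" c] finite_U U_nonneg s_nonneg by auto
  moreover have "(\<Sum>u\<in>insert s U. c u * B u \<omega>) = a * B s \<omega> + (\<Sum>u\<in>U. b u * residual u \<omega>)" for \<omega>
  proof -
    have "(\<Sum>u\<in>U. c u * B u \<omega>) = (\<Sum>u\<in>U. b u * B u \<omega>)"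
      using s_notin_U by (intro sum.cong) (auto simp: c_def)
    moreover have "(\<Sum>u\<in>U. b u * residual u \<omega>) = (\<Sum>u\<in>U. b u * B u \<omega>) - (\<Sum>u\<in>U. b u * \<rho> u) * B s \<omega>"
      by (simp add: residual_def right_diff_distrib sum_subtractf sum_distrib_right mult.assoc)
    ultimately show ?thesis
      using finite_U s_notin_U by (simp add: c_def algebra_simps)
  qed
  ultimately show ?thesis by simp
qed

lemma gaussian_B: "u \<in> insert s U \<Longrightarrow> gaussian_rv M (B u)"
  using gaussian[unfolded gaussian_process_def, rule_format, of "{u}" "\<lambda>_. 1"] s_nonneg U_nonneg by auto

lemma measurable_B: "u \<in> insert s U \<Longrightarrow> B u \<in> borel_measurable M"
  using gaussian_B by (simp add: gaussian_rv_def)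

lemma measurable_residual: "u \<in> U \<Longrightarrow> residual u \<in> borel_measurable M"
  using measurable_B[of u] measurable_B[of s] unfolding residual_def[abs_def] by simp

text \<open>The condition on \<open>\<rho>\<close> makes the covariance of the two summands vanish,
  so variances add. Mean and variance determine a Gaussian characteristic function, which therefore
  factorises.\<close>

lemma char_combination:
  "(CLINT \<omega>|M. iexp (a * B s \<omega> + (\<Sum>u\<in>U. b u * residual u \<omega>))) =
   (CLINT \<omega>|M. iexp (a * B s \<omega>)) * (CLINT \<omega>|M. iexp (\<Sum>u\<in>U. b u * residual u \<omega>))"
proof -
  define Z where "Z \<omega> = a * B s \<omega>" for \<omega>
  define L where "L \<omega> = (\<Sum>u\<in>U. b u * residual u \<omega>)" for \<omega>
  have gZ: "gaussian_rv M Z"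
    using gaussian[unfolded gaussian_process_def, rule_format, of "{s}" "\<lambda>_. a"] s_nonneg by (auto simp: Z_def[abs_def])
  have gL: "gaussian_rv M L" using gaussian_combination[of 0 b] by (simp add: L_def[abs_def])
  have gS: "gaussian_rv M (\<lambda>\<omega>. Z \<omega> + L \<omega>)" using gaussian_combination[of a b] by (simp add: Z_def L_def)
  note Zi = gaussian_rv_square_integrable[OF gZ] and Li = gaussian_rv_square_integrable[OF gL]
  have [measurable]: "Z \<in> borel_measurable M" "L \<in> borel_measurable M" using Zi Li by auto
  have e: "expectation (\<lambda>\<omega>. Z \<omega> + L \<omega>) = expectation Z + expectation L"
    using Zi Li by simp
  define Bc where "Bc u \<omega> = B u \<omega> - expectation (B u)" for u \<omega>
  have Bci: "integrable M (\<lambda>\<omega>. Bc u \<omega> * Bc s \<omega>)" if "u \<in> insert s U" for u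
    using that gaussian_rv_square_integrable[OF gaussian_B[of u]] gaussian_rv_square_integrable[OF gaussian_B[of s]]
    unfolding Bc_def by (intro integrable_mult_square_integrable) auto
  have Bi: "integrable M (B u)" if "u \<in> insert s U" for u
    using that gaussian_rv_square_integrable[OF gaussian_B[of u]] by simp
  have Zc: "Z \<omega> - expectation Z = a * Bc s \<omega>" for \<omega>
    by (simp add: Z_def[abs_def] Bc_def algebra_simps)
  have eL: "expectation L = (\<Sum>u\<in>U. b u * (expectation (B u) - \<rho> u * expectation (B s)))"
    unfolding L_def[abs_def] residual_def by (simp add: Bi)
  have Lc: "L \<omega> - expectation L = (\<Sum>u\<in>U. b u * (Bc u \<omega> - \<rho> u * Bc s \<omega>))" for \<omega>
    unfolding eL by (simp add: L_def residual_def Bc_def sum_subtractf[symmetric] algebra_simps)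
  have cov: "expectation (\<lambda>\<omega>. Bc u \<omega> * Bc s \<omega>) = covariance M (B u) (B s)" for u
    by (simp add: covariance_def Bc_def)
  have zl: "(Z \<omega> - expectation Z) * (L \<omega> - expectation L) = (\<Sum>u\<in>U. a * b u * (Bc u \<omega> * Bc s \<omega> - \<rho> u * (Bc s \<omega> * Bc s \<omega>)))" for \<omega>
    unfolding Zc Lc by (simp add: sum_distrib_left algebra_simps)
  have "expectation (\<lambda>\<omega>. (Z \<omega> - expectation Z) * (L \<omega> - expectation L)) =
      (\<Sum>u\<in>U. a * b u * (covariance M (B u) (B s) - \<rho> u * covariance M (B s) (B s)))"
    unfolding zl by (simp add: Bci cov)
  then have z0: "expectation (\<lambda>\<omega>. (Z \<omega> - expectation Z) * (L \<omega> - expectation L)) = 0"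
    using \<rho> by simp
  have intZL: "integrable M (\<lambda>\<omega>. (Z \<omega> - expectation Z) * (L \<omega> - expectation L))"
    using Zi Li by (intro integrable_mult_square_integrable) auto
  have "variance (\<lambda>\<omega>. Z \<omega> + L \<omega>) = expectation (\<lambda>\<omega>. (Z \<omega> - expectation Z)\<^sup>2 + (L \<omega> - expectation L)\<^sup>2
      + 2 * ((Z \<omega> - expectation Z) * (L \<omega> - expectation L)))"
    unfolding e by (intro Bochner_Integration.integral_cong) (auto simp: power2_eq_square algebra_simps)
  also have "\<dots> = variance Z + variance L"
    using Zi(3) Li(3) intZL z0 by simp
  finally have v: "variance (\<lambda>\<omega>. Z \<omega> + L \<omega>) = variance Z + variance L" .
  have "(CLINT \<omega>|M. iexp (Z \<omega> + L \<omega>)) = (CLINT \<omega>|M. iexp (Z \<omega>)) * (CLINT \<omega>|M. iexp (L \<omega>))"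
    unfolding gaussian_rv_char[OF gS] gaussian_rv_char[OF gZ] gaussian_rv_char[OF gL]
    unfolding v unfolding e
    by (simp add: exp_add[symmetric] exp_of_real[symmetric] algebra_simps add_divide_distrib diff_divide_distrib)
  then show ?thesis by (simp only: Z_def L_def)
qed

text \<open>Independence expressed through an independent copy: \<open>B s\<close> and the residuals
  have the same joint law under \<open>M\<close> as \<open>B s \<omega>\<close> and the residuals at
  \<open>\<omega>'\<close> under \<open>M \<Otimes>\<^sub>M M\<close>, since the characteristic
  functions agree by \<open>char_combination\<close>. The inner integral then plays the part of
  conditioning on the residuals.\<close>

lemma nn_integral_regression:
  assumes Q [measurable]: "case_prod Q \<in> borel_measurable (borel \<Otimes>\<^sub>M (\<Pi>\<^sub>M u\<in>U. borel))"
  shows "(\<integral>\<^sup>+\<omega>. Q (B s \<omega>) (\<lambda>u\<in>U. residual u \<omega>) \<partial>M) =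
    (\<integral>\<^sup>+\<omega>'. (\<integral>\<^sup>+\<omega>. Q (B s \<omega>) (\<lambda>u\<in>U. residual u \<omega>') \<partial>M) \<partial>M)"
proof -
  interpret pair_prob_space M M ..
  let ?J = "insert s U" and ?P = "\<Pi>\<^sub>M u\<in>insert s U. (borel :: real measure)"
  \<comment> \<open>The value 0 off \<open>insert s U\<close> makes the families measurable at every
    index, as \<open>char_uniqueness_PiM\<close> demands.\<close>
  define V1 where "V1 u \<omega> = (if u = s then B s \<omega> else if u \<in> U then residual u \<omega> else 0)" for u \<omega>
  define V2 where "V2 u p = (if u = s then B s (fst p) else if u \<in> U then residual u (snd p) else 0)" for u and p :: "'a \<times> 'a"
  have [measurable]: "B s \<in> borel_measurable M" by (rule measurable_B) simp
  have V1m [measurable]: "V1 u \<in> borel_measurable M" for u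
    unfolding V1_def[abs_def] by (cases "u = s"; cases "u \<in> U") (simp_all add: measurable_residual)
  have V2m [measurable]: "V2 u \<in> borel_measurable (M \<Otimes>\<^sub>M M)" for u
    unfolding V2_def[abs_def] by (cases "u = s"; cases "u \<in> U")
      (simp_all add: measurable_compose[OF measurable_snd measurable_residual])
  have sum1: "(\<Sum>u\<in>?J. l u * V1 u \<omega>) = l s * B s \<omega> + (\<Sum>u\<in>U. l u * residual u \<omega>)" for l \<omega>
    using finite_U s_notin_U by (subst sum.insert) (auto simp: V1_def intro!: sum.cong)
  have sum2: "(\<Sum>u\<in>?J. l u * V2 u p) = l s * B s (fst p) + (\<Sum>u\<in>U. l u * residual u (snd p))" for l p
    using finite_U s_notin_U by (subst sum.insert) (auto simp: V2_def intro!: sum.cong)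
  have D: "distr M ?P (\<lambda>\<omega>. \<lambda>u\<in>?J. V1 u \<omega>) = distr (M \<Otimes>\<^sub>M M) ?P (\<lambda>p. \<lambda>u\<in>?J. V2 u p)"
  proof (rule char_uniqueness_PiM)
    show "prob_space M" "prob_space (M \<Otimes>\<^sub>M M)" by unfold_locales
    fix l
    have [measurable]: "(\<lambda>\<omega>. \<Sum>u\<in>U. l u * residual u \<omega>) \<in> borel_measurable M"
      by (intro borel_measurable_sum borel_measurable_times borel_measurable_const measurable_residual)
    have "(CLINT p|M \<Otimes>\<^sub>M M. iexp (\<Sum>u\<in>?J. l u * V2 u p)) =
        (CLINT p|M \<Otimes>\<^sub>M M. (case p of (x, y) \<Rightarrow> iexp (l s * B s x) * iexp (\<Sum>u\<in>U. l u * residual u y)))"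
      unfolding sum2 by (intro Bochner_Integration.integral_cong) (auto simp: exp_add distrib_left)
    also have "\<dots> = (CLINT x|M. CLINT y|M. iexp (l s * B s x) * iexp (\<Sum>u\<in>U. l u * residual u y))"
    proof (rule integral_fst[symmetric], rule P.integrable_bounded_measurable)
      show "(\<lambda>(x, y). iexp (l s * B s x) * iexp (\<Sum>u\<in>U. l u * residual u y)) \<in> borel_measurable (M \<Otimes>\<^sub>M M)"
        by measurable
      show "norm (case p of (x, y) \<Rightarrow> iexp (l s * B s x) * iexp (\<Sum>u\<in>U. l u * residual u y)) \<le> 1" for p
        by (cases p) (simp add: norm_mult del: of_real_sum of_real_mult)
    qed
    also have "\<dots> = (CLINT x|M. iexp (l s * B s x)) * (CLINT y|M. iexp (\<Sum>u\<in>U. l u * residual u y))"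
      by simp
    finally show "(CLINT \<omega>|M. iexp (\<Sum>u\<in>?J. l u * V1 u \<omega>)) = (CLINT p|M \<Otimes>\<^sub>M M. iexp (\<Sum>u\<in>?J. l u * V2 u p))"
      unfolding sum1 by (simp only: char_combination)
  qed (use finite_U in auto)
  define Q' where "Q' y = Q (y s) (restrict y U)" for y
  have "(\<lambda>y. (y s, restrict y U)) \<in> measurable ?P (borel \<Otimes>\<^sub>M (\<Pi>\<^sub>M u\<in>U. borel))"
    by (intro measurable_Pair measurable_component_singleton measurable_restrict_subset) auto
  from measurable_compose[OF this Q] have Q'm [measurable]: "Q' \<in> borel_measurable ?P"
    by (simp add: Q'_def[abs_def])
  have r1: "Q' (\<lambda>u\<in>?J. V1 u \<omega>) = Q (B s \<omega>) (\<lambda>u\<in>U. residual u \<omega>)" for \<omega>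
    using s_notin_U by (auto simp: Q'_def V1_def restrict_def intro!: arg_cong2[where f = Q])
  have r2: "Q' (\<lambda>u\<in>?J. V2 u p) = Q (B s (fst p)) (\<lambda>u\<in>U. residual u (snd p))" for p
    using s_notin_U by (auto simp: Q'_def V2_def restrict_def intro!: arg_cong2[where f = Q])
  have V2r: "(\<lambda>p. \<lambda>u\<in>?J. V2 u p) \<in> measurable (M \<Otimes>\<^sub>M M) ?P" by simp
  have "(\<integral>\<^sup>+\<omega>. Q (B s \<omega>) (\<lambda>u\<in>U. residual u \<omega>) \<partial>M) = (\<integral>\<^sup>+y. Q' y \<partial>distr M ?P (\<lambda>\<omega>. \<lambda>u\<in>?J. V1 u \<omega>))"
    by (subst nn_integral_distr) (simp_all add: r1)
  also have "\<dots> = (\<integral>\<^sup>+p. Q' (\<lambda>u\<in>?J. V2 u p) \<partial>(M \<Otimes>\<^sub>M M))"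
    unfolding D by (subst nn_integral_distr) simp_all
  also have "\<dots> = (\<integral>\<^sup>+\<omega>'. (\<integral>\<^sup>+\<omega>. Q' (\<lambda>u\<in>?J. V2 u (\<omega>, \<omega>')) \<partial>M) \<partial>M)"
    using measurable_compose[OF V2r Q'm] by (rule nn_integral_snd[symmetric])
  finally show ?thesis by (simp add: r2)
qed

end

section \<open>Crossing estimate\<close>

text \<open>For \<open>s > 0\<close> a left-endpoint sum involves only finitely many times strictly
  before \<open>s\<close>, so the regression on \<open>B s\<close> applies to it. The error is
  uniform over all paths with the same \<open>K\<close> and \<open>L\<close>.\<close>

lemma (in bounded_holder_path) averaged_price_riemann_sum:
  fixes n :: nat
  assumes s: "0 \<le> s" "s \<le> T" and n: "0 < n"
  shows "\<bar>averaged_price T g s - ((T - s) / T * exp (g s) + 1 / T * (\<Sum>i<n. s / n * exp (g (s * real i / n))))\<bar>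
    \<le> exp K * L * (T / n) powr \<eta>"
proof -
  define I where "I z = integral {0..z} (\<lambda>u. exp (g u))" for z
  define u where "u i = s * real i / n" for i
  have u: "0 \<le> u i" "u i \<le> T" if "i \<le> n" for i
  proof -
    have "s * real i / n \<le> s * real n / n"
      using s that by (intro divide_right_mono mult_left_mono) auto
    then show "u i \<le> T" using s n by (simp add: u_def)
  qed (use s in \<open>simp add: u_def\<close>)
  have step: "\<bar>I (u (Suc i)) - I (u i) - s / n * exp (g (u i))\<bar> \<le> exp K * L * (T / n) powr \<eta> * (s / n)" if "i < n" for i
  proof -
    have d: "u (Suc i) - u i = s / n" by (simp add: u_def add_divide_distrib distrib_left)
    then have d': "u i - u (Suc i) = - (s / n)" by linarith
    \<comment> \<open>\<open>integral_exp_remainder\<close> compares with the value at its second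
      point, so the left endpoint \<open>u i\<close> is put there and the increment becomes
      negative.\<close>
    have "\<bar>I (u i) - I (u (Suc i)) - (u i - u (Suc i)) * exp (g (u i))\<bar> \<le> exp K * L * \<bar>u i - u (Suc i)\<bar> powr \<eta> * \<bar>u i - u (Suc i)\<bar>"
      unfolding I_def using u[of i] u[of "Suc i"] that by (intro integral_exp_remainder) auto
    also have "\<dots> = exp K * L * (s / n) powr \<eta> * (s / n)"
      unfolding d' using s by simp
    also have "\<dots> \<le> exp K * L * (T / n) powr \<eta> * (s / n)"
      using s L_nonneg \<eta>_pos by (intro mult_right_mono mult_left_mono powr_mono2 divide_right_mono) auto
    also have "\<bar>I (u i) - I (u (Suc i)) - (u i - u (Suc i)) * exp (g (u i))\<bar> = \<bar>I (u (Suc i)) - I (u i) - s / n * exp (g (u i))\<bar>"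
      unfolding d' by (simp add: abs_minus_commute algebra_simps)
    finally show ?thesis .
  qed
  have "(\<Sum>i<n. I (u (Suc i)) - I (u i)) = I (u n) - I (u 0)"
    by (rule sum_lessThan_telescope)
  then have "I s = (\<Sum>i<n. I (u (Suc i)) - I (u i))"
    using n by (simp only:) (simp add: u_def I_def)
  then have "\<bar>I s - (\<Sum>i<n. s / n * exp (g (u i)))\<bar> = \<bar>\<Sum>i<n. I (u (Suc i)) - I (u i) - s / n * exp (g (u i))\<bar>"
    by (simp add: sum_subtractf)
  also have "\<dots> \<le> (\<Sum>i<n. exp K * L * (T / n) powr \<eta> * (s / n))"
    using step by (intro order_trans[OF sum_abs] sum_mono) auto
  also have "\<dots> = exp K * L * (T / n) powr \<eta> * s"
    using n by simp
  also have "\<dots> \<le> exp K * L * (T / n) powr \<eta> * T"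
    using s L_nonneg by (intro mult_left_mono) auto
  finally have "\<bar>I s - (\<Sum>i<n. s / n * exp (g (u i)))\<bar> / T \<le> exp K * L * (T / n) powr \<eta>"
    using T_pos by (simp add: divide_le_eq)
  moreover have "averaged_price T g s - ((T - s) / T * exp (g s) + 1 / T * (\<Sum>i<n. s / n * exp (g (u i)))) =
      (I s - (\<Sum>i<n. s / n * exp (g (u i)))) / T"
    using s by (simp add: averaged_price_def integral_exp I_def diff_divide_distrib)
  ultimately show ?thesis
    using T_pos by (simp add: u_def)
qed

text \<open>The two terms are integrals of \<open>q\<close> over shifted copies of
  \<open>{a..b}\<close>. After cancellation of the common part, what is left lies in
  \<open>{b - m..b + m}\<close> and \<open>{a - m..a + m}\<close>, each of length
  \<open>2 * m\<close>, where \<open>\<bar>q\<bar> \<le> C\<close>. Jumps of \<open>q\<close> do no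
  harm.\<close>

lemma nn_integral_mono_difference_le:
  fixes q :: "real \<Rightarrow> real"
  assumes q: "mono q" "\<And>x. \<bar>q x\<bar> \<le> C" and m: "0 \<le> m" and ab: "a \<le> b"
  shows "(\<integral>\<^sup>+z. ennreal ((q (z + m) - q (z - m)) * indicator {a..b} z) \<partial>lborel) \<le> ennreal (4 * m * C)"
proof -
  have [measurable]: "q \<in> borel_measurable borel" using q(1) by (rule borel_measurable_mono)
  have C: "0 \<le> C" using q(2)[of 0] by linarith
  have iI: "integrable lborel (\<lambda>z. indicator {c..d} z :: real)" for c d :: real
    by (simp add: integrable_indicator_iff emeasure_lborel_Icc_eq)
  have i: "integrable lborel (\<lambda>z. q z * indicator {c..d} z)" for c d
  proof (rule Bochner_Integration.integrable_bound[OF integrable_mult_right[OF iI[of c d], of C]])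
    show "AE z in lborel. norm (q z * indicator {c..d} z) \<le> norm (C * indicator {c..d} z)"
      using q(2) C by (intro AE_I2) (auto simp: indicator_def)
  qed simp
  have shift: "integrable lborel (\<lambda>z. q (z + e) * indicator {a..b} z)"
    "(LINT z|lborel. q (z + e) * indicator {a..b} z) = (LINT z|lborel. q z * indicator {a + e..b + e} z)" for e
  proof -
    have eq: "(\<lambda>z. q (z + e) * indicator {a..b} z) = (\<lambda>z. q (e + 1 * z) * indicator {a + e..b + e} (e + 1 * z))"
      by (auto simp: indicator_def add.commute)
    show "integrable lborel (\<lambda>z. q (z + e) * indicator {a..b} z)"
      unfolding eq by (rule lborel_integrable_real_affine[OF i]) simp
    show "(LINT z|lborel. q (z + e) * indicator {a..b} z) = (LINT z|lborel. q z * indicator {a + e..b + e} z)"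
      unfolding eq using lborel_integral_real_affine[of 1 "\<lambda>z. q z * indicator {a + e..b + e} z" e] by simp
  qed
  have int: "integrable lborel (\<lambda>z. q (z + m) * indicator {a..b} z - q (z + - m) * indicator {a..b} z)"
    by (intro Bochner_Integration.integrable_diff shift(1))
  have "(LINT z|lborel. q (z + m) * indicator {a..b} z - q (z + - m) * indicator {a..b} z) =
      (LINT z|lborel. q z * indicator {a + m..b + m} z - q z * indicator {a + - m..b + - m} z)"
    by (subst (1 2) Bochner_Integration.integral_diff) (simp_all only: shift i)
  also have "\<dots> \<le> (LINT z|lborel. C * (indicator {b - m..b + m} z + indicator {a - m..a + m} z))"
  proof (rule integral_mono)
    fix z
    have qz: "q z \<le> C" "- C \<le> q z" using q(2)[of z] by linarith+
    show "q z * indicator {a + m..b + m} z - q z * indicator {a + - m..b + - m} z \<le> C * (indicator {b - m..b + m} z + indicator {a - m..a + m} z)"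
      using qz m ab C by (auto simp: indicator_def split: if_splits)
  qed (intro Bochner_Integration.integrable_diff i, intro integrable_mult_right Bochner_Integration.integrable_add iI)
  also have "\<dots> = 4 * m * C"
    using m by (simp add: iI)
  finally have le: "(LINT z|lborel. q (z + m) * indicator {a..b} z - q (z + - m) * indicator {a..b} z) \<le> 4 * m * C" .
  have "(\<integral>\<^sup>+z. ennreal ((q (z + m) - q (z - m)) * indicator {a..b} z) \<partial>lborel) =
      (\<integral>\<^sup>+z. ennreal (q (z + m) * indicator {a..b} z - q (z + - m) * indicator {a..b} z) \<partial>lborel)"
    by (intro nn_integral_cong) (simp add: left_diff_distrib)
  also have "\<dots> = ennreal (LINT z|lborel. q (z + m) * indicator {a..b} z - q (z + - m) * indicator {a..b} z)"
  proof (rule nn_integral_eq_integral[OF int], intro AE_I2)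
    fix z
    have "q (z + - m) \<le> q (z + m)" using m by (intro monoD[OF q(1)]) auto
    then show "0 \<le> q (z + m) * indicator {a..b} z - q (z + - m) * indicator {a..b} z"
      by (simp add: indicator_def)
  qed
  finally show ?thesis using le by (simp add: ennreal_leI)
qed

lemma normal_density_le: "0 < \<sigma> \<Longrightarrow> normal_density \<mu> \<sigma> x \<le> 1 / \<sigma>"
proof -
  assume \<sigma>: "0 < \<sigma>"
  have "\<sigma>\<^sup>2 \<le> 2 * pi * \<sigma>\<^sup>2"
    using pi_ge_two \<sigma> by (simp add: mult_le_cancel_right1) 
  then have "\<sigma> \<le> sqrt (2 * pi * \<sigma>\<^sup>2)"
    using \<sigma> by (intro real_le_rsqrt) auto
  then have "1 / sqrt (2 * pi * \<sigma>\<^sup>2) \<le> 1 / \<sigma>"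
    using \<sigma> by (intro divide_left_mono mult_pos_pos) auto
  moreover have "exp (- (x - \<mu>)\<^sup>2 / (2 * \<sigma>\<^sup>2)) \<le> 1" by simp
  ultimately have "1 / sqrt (2 * pi * \<sigma>\<^sup>2) * exp (- (x - \<mu>)\<^sup>2 / (2 * \<sigma>\<^sup>2)) \<le> 1 / \<sigma> * 1"
    using \<sigma> by (intro mult_mono) auto
  then show ?thesis by (simp add: normal_density_def)
qed

text \<open>Positive variance excludes the constant case, and a normal density is at most
  \<open>1 / \<sigma>\<close>. With \<open>\<sigma> = s powr H\<close> this is the origin of the
  factor \<open>s powr (- H)\<close> in the crossing bound.\<close>

lemma (in prob_space) nn_integral_gaussian_le:
  assumes X: "gaussian_rv M X" and var: "variance X = \<sigma>\<^sup>2" and \<sigma>: "0 < \<sigma>"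
    and [measurable]: "Q \<in> borel_measurable borel"
  shows "(\<integral>\<^sup>+\<omega>. Q (X \<omega>) \<partial>M) \<le> ennreal (1 / \<sigma>) * (\<integral>\<^sup>+z. Q z \<partial>lborel)"
proof -
  have [measurable]: "X \<in> borel_measurable M" using X by (simp add: gaussian_rv_def)
  have "\<not> (AE \<omega> in M. X \<omega> = \<mu>)" for \<mu>
  proof
    assume ae: "AE \<omega> in M. X \<omega> = \<mu>"
    have "expectation X = \<mu>"
      using integral_cong_AE[of X M "\<lambda>_. \<mu>"] ae by (simp add: prob_space)
    then have "variance X = 0"
      using ae by (intro integral_eq_zero_AE) (auto elim: eventually_mono)
    then show False using var \<sigma> by simp
  qed
  then obtain \<mu> \<sigma>' where \<sigma>': "0 < \<sigma>'" and D: "distributed M lborel X (normal_density \<mu> \<sigma>')"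
    using X by (auto simp: gaussian_rv_def)
  have "\<sigma>'\<^sup>2 = \<sigma>\<^sup>2" using normal_distributed_variance[OF \<sigma>' D] var by simp
  then have [simp]: "\<sigma>' = \<sigma>" using \<sigma> \<sigma>' by (simp add: power2_eq_iff_nonneg)
  have "(\<integral>\<^sup>+\<omega>. Q (X \<omega>) \<partial>M) = (\<integral>\<^sup>+z. ennreal (normal_density \<mu> \<sigma> z) * Q z \<partial>lborel)"
    using distributed_nn_integral[OF D, of Q] by simp
  also have "\<dots> \<le> (\<integral>\<^sup>+z. ennreal (1 / \<sigma>) * Q z \<partial>lborel)"
    using normal_density_le[OF \<sigma>] by (intro nn_integral_mono mult_right_mono ennreal_leI) auto
  also have "\<dots> = ennreal (1 / \<sigma>) * (\<integral>\<^sup>+z. Q z \<partial>lborel)"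
    by (rule nn_integral_cmult) simp
  finally show ?thesis .
qed

definition weighted_increment :: "real \<Rightarrow> (real \<Rightarrow> real) \<Rightarrow> (real \<Rightarrow> real) \<Rightarrow> real \<Rightarrow> real \<Rightarrow> real" where
  "weighted_increment T h g s t = price_weight T g s * \<bar>h (averaged_price T g t) - h (averaged_price T g s)\<bar>"

text \<open>Conditionally on the residuals, the (discretised) averaged price is an increasing function
  of \<open>B s\<close> whose slope is at least \<open>c = (T - s) / T * exp (- K - 1)\<close> as long as \<open>B s\<close> exceeds
  \<open>- K - 1\<close>. A window of width \<open>2 * l\<close> around the price is therefore a window of width \<open>m = 2 * l / c\<close>
  around \<open>B s\<close>, and the integral over \<open>B s\<close> telescopes.\<close>

lemma (in prob_space) averaged_price_crossing_bound:
  fixes B :: "real \<Rightarrow> 'a \<Rightarrow> real"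
  assumes gaussian: "gaussian_process M B" and H: "0 < H"
    and cov: "\<And>u v. 0 \<le> u \<Longrightarrow> 0 \<le> v \<Longrightarrow> covariance M (B u) (B v) = 1 / 2 * (u powr (2 * H) + v powr (2 * H) - \<bar>u - v\<bar> powr (2 * H))"
    and h: "mono h" "\<And>x. \<bar>h x\<bar> \<le> C" and st: "0 < s" "s < t" "t \<le> T"
    and K: "0 < K" and \<Omega>: "\<And>\<omega>. \<omega> \<in> \<Omega> \<Longrightarrow> bounded_holder_path (\<lambda>t. B t \<omega>) T K K \<eta>"
  shows "(\<integral>\<^sup>+\<omega>. indicator \<Omega> \<omega> * ennreal (weighted_increment T h (\<lambda>t. B t \<omega>) s t) \<partial>M)
    \<le> ennreal (16 * C * K * exp (3 * K + 1) * (1 + T powr H) * (t - s) powr \<eta> * s powr - H)" (is "?I \<le> ennreal ?R")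
proof (cases "\<Omega> = {}")
  case False
  then obtain \<omega>0 where "\<omega>0 \<in> \<Omega>" by blast
  then have \<eta>: "0 < \<eta>" using \<Omega> bounded_holder_path.\<eta>_pos by blast
  have T: "0 < T" and sT: "s < T" using st by auto
  have C: "0 \<le> C" using h(2)[of 0] by linarith
  \<comment> \<open>The bound of \<open>averaged_price_holder\<close> for the increment from
    \<open>s\<close> to \<open>t\<close>. The Riemann sum error is pushed below it too, so both
    prices stay within \<open>2 * l\<close> of the discretised one.\<close>
  define l where "l = 2 * exp K * K * (t - s) powr \<eta>"
  have l: "0 < l" using K st by (simp add: l_def)
  define m where "m = 2 * l * T * exp (K + 1) / (T - s)"
  have m: "0 < m" using l T sT by (simp add: m_def)
  define w where "w = (T - s) / T * exp K"
  have w: "0 < w" using T sT by (simp add: w_def)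
  \<comment> \<open>This identity yields the constant 16: the window estimate contributes the 4 of
    \<open>4 * m * C\<close>, the right-hand side a factor 2, and \<open>l\<close> itself another
    2.\<close>
  have wm: "w * m = 2 * l * exp (2 * K + 1)"
    using T sT by (simp add: w_def m_def mult_exp_exp field_simps)
  have weight: "0 \<le> price_weight T (\<lambda>t. B t \<omega>) s \<and> price_weight T (\<lambda>t. B t \<omega>) s \<le> w" if "\<omega> \<in> \<Omega>" for \<omega>
  proof -
    interpret bounded_holder_path "\<lambda>t. B t \<omega>" T K K \<eta> by (rule \<Omega>[OF that])
    show ?thesis
      unfolding price_weight_def w_def using weight_le_1[of s] exp_le[of s] st
      by (intro conjI mult_nonneg_nonneg mult_left_mono) auto
  qed
  \<comment> \<open>The factor \<open>1 + T powr H\<close> allows \<open>s powr (- H)\<close> to be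
    inserted where an estimate does not produce it.\<close>
  have s1: "1 \<le> (1 + T powr H) * s powr - H"
  proof -
    have "1 = s powr H * s powr - H" using st by (simp add: powr_add[symmetric])
    also have "\<dots> \<le> (1 + T powr H) * s powr - H"
      using st H powr_mono2[of H s T] by (intro mult_right_mono) auto
    finally show ?thesis .
  qed
  show ?thesis
  \<comment> \<open>If \<open>m \<le> 1\<close>, then \<open>z \<ge> - K\<close> implies
    \<open>z - m \<ge> - K - 1\<close>, so the slope bound covers the whole window. Otherwise the
    trivial bound \<open>2 * C\<close> for the increment of \<open>h\<close> suffices, since it may
    be multiplied by \<open>m > 1\<close>.\<close>
  proof (cases "m \<le> 1")
    case False
    have "w * (2 * C) \<le> w * (2 * C) * m"
      using False w C mult_left_mono[of 1 m "w * (2 * C)"] by simp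
    also have "\<dots> = 2 * C * (w * m)" by simp
    also have "\<dots> = 8 * C * K * (exp K * exp (2 * K + 1)) * (t - s) powr \<eta>"
      unfolding wm by (simp add: l_def)
    also have "exp K * exp (2 * K + 1) = exp (3 * K + 1)"
      by (simp add: mult_exp_exp)
    also have "8 * C * K * exp (3 * K + 1) * (t - s) powr \<eta> \<le>
        (16 * C * K * exp (3 * K + 1) * (t - s) powr \<eta>) * ((1 + T powr H) * s powr - H)"
      using C K s1 by (intro order_trans[OF _ mult_left_mono[OF s1]]) auto
    finally have "w * (2 * C) \<le> ?R"
      by (simp add: mult_ac)
    then have le: "ennreal (w * (2 * C)) \<le> ennreal (?R)"
      by (rule ennreal_leI)
    have "?I \<le> (\<integral>\<^sup>+\<omega>. ennreal (w * (2 * C)) \<partial>M)"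
    proof (rule nn_integral_mono)
      fix \<omega>
      show "indicator \<Omega> \<omega> * ennreal (weighted_increment T h (\<lambda>t. B t \<omega>) s t) \<le> ennreal (w * (2 * C))"
      proof (cases "\<omega> \<in> \<Omega>")
        case True
        have "\<bar>h x - h y\<bar> \<le> 2 * C" for x y using h(2)[of x] h(2)[of y] by linarith
        then show ?thesis using weight[OF True] True C w
          by (auto simp: weighted_increment_def intro!: ennreal_leI mult_mono)
      qed simp
    qed
    also have "\<dots> = ennreal (w * (2 * C))"
      by (simp add: emeasure_space_1)
    finally show ?thesis using le by (rule order_trans)
  next
    case True
    have "(\<lambda>n. exp K * K * (T * inverse (real n)) powr \<eta>) \<longlonglongrightarrow> exp K * K * 0"
      using \<eta> T tendsto_mult[OF tendsto_const[of T] lim_inverse_n] by (intro tendsto_mult_left tendsto_zero_powrI) auto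
    then have "\<forall>\<^sub>F n in sequentially. exp K * K * (T * inverse (real n)) powr \<eta> < l"
      using l by (intro order_tendstoD) auto
    then have "\<exists>n. exp K * K * (T * inverse (real n)) powr \<eta> < l \<and> 0 < n"
      by (intro eventually_happens'[OF sequentially_bot] eventually_conj eventually_gt_at_top)
    then obtain n :: nat where n: "exp K * K * (T / n) powr \<eta> < l" "0 < n"
      by (auto simp: divide_inverse)
    define u where "u i = s * real i / n" for i
    define U where "U = u ` {..<n}"
    have u: "0 \<le> u i" "u i < s" if "i < n" for i
      using st that by (auto simp: u_def divide_less_eq mult_strict_left_mono)
    have var_s: "covariance M (B s) (B s) = (s powr H)\<^sup>2"
      using cov[of s s] st by (simp add: power2_eq_square powr_add[symmetric])
    have var_pos: "0 < (s powr H)\<^sup>2" using st by simp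
    define \<rho> where "\<rho> v = covariance M (B v) (B s) / covariance M (B s) (B s)" for v
    \<comment> \<open>\<open>\<bar>u i - s\<bar> \<le> s\<close> makes the covariance nonnegative.
      This sign is what makes each summand of \<open>P\<close> below nondecreasing in
      \<open>z\<close>.\<close>
    have \<rho>_nonneg: "0 \<le> \<rho> (u i)" if "i < n" for i
    proof -
      have "\<bar>u i - s\<bar> powr (2 * H) \<le> s powr (2 * H)"
        using u[OF that] H by (intro powr_mono2) auto
      moreover have "0 \<le> 1 / 2 * (x + y - z)" if "z \<le> y" "0 \<le> x" for x y z :: real
        using that by simp
      moreover have "covariance M (B (u i)) (B s) = 1 / 2 * (u i powr (2 * H) + s powr (2 * H) - \<bar>u i - s\<bar> powr (2 * H))"
        using u[OF that] st by (intro cov) auto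
      ultimately have "0 \<le> covariance M (B (u i)) (B s)"
        by (simp only: powr_ge_zero)
      then show ?thesis
        using var_s unfolding \<rho>_def by (intro divide_nonneg_nonneg) simp_all
    qed
    interpret gaussian_regression M B s U \<rho>
    proof
      show "covariance M (B u) (B s) = \<rho> u * covariance M (B s) (B s)" for u
        using var_s var_pos by (simp add: \<rho>_def)
    qed (use gaussian st u in \<open>auto simp: U_def\<close>)
    \<comment> \<open>The discretised price when \<open>B s = z\<close> and the residuals are
      \<open>y\<close>. The slope bound comes from the first summand alone; the others only have to
      be monotone.\<close>
    define P where "P z y = (T - s) / T * exp z + 1 / T * (\<Sum>i<n. s / n * exp (\<rho> (u i) * z + y (u i)))" for z and y :: "real \<Rightarrow> real"
    have P_mono: "P x y + (T - s) / T * (exp z - exp x) \<le> P z y" if "x \<le> z" for x z y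
    proof -
      have "(\<Sum>i<n. s / n * exp (\<rho> (u i) * x + y (u i))) \<le> (\<Sum>i<n. s / n * exp (\<rho> (u i) * z + y (u i)))"
        using that \<rho>_nonneg st by (intro sum_mono mult_left_mono) (auto intro!: mult_left_mono)
      then have "1 / T * (\<Sum>i<n. s / n * exp (\<rho> (u i) * x + y (u i))) \<le> 1 / T * (\<Sum>i<n. s / n * exp (\<rho> (u i) * z + y (u i)))"
        using T by (intro mult_left_mono) auto
      then show ?thesis by (simp add: P_def right_diff_distrib)
    qed
    have mono_P: "mono (\<lambda>z. P z y)" for y
    proof (rule monoI)
      fix x z :: real assume "x \<le> z"
      moreover have "0 \<le> (T - s) / T * (exp z - exp x)" using \<open>x \<le> z\<close> T sT by (intro mult_nonneg_nonneg) auto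
      ultimately show "P x y \<le> P z y" using P_mono[of x z y] by linarith
    qed
    have exp_slope: "d * exp x \<le> exp (x + d) - exp x" for x d :: real
    proof -
      have "exp x * (1 + d) \<le> exp x * exp d" by (intro mult_left_mono exp_ge_add_one_self) auto
      then show ?thesis by (simp add: exp_add algebra_simps)
    qed
    have cm: "(T - s) / T * (m * exp (- K - 1)) = 2 * l"
    proof -
      have "exp (K + 1) * exp (- K - 1) = 1" by (simp add: mult_exp_exp)
      then show ?thesis using T sT by (simp add: m_def field_simps)
    qed
    have slope: "P z y + 2 * l \<le> P (z + m) y" "P (z - m) y \<le> P z y - 2 * l" if "- K \<le> z" for z y
    proof -
      have "m * exp (- K - 1) \<le> m * exp z" using that m by (intro mult_left_mono) auto
      also have "\<dots> \<le> exp (z + m) - exp z" by (rule exp_slope)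
      finally have "(T - s) / T * (m * exp (- K - 1)) \<le> (T - s) / T * (exp (z + m) - exp z)"
        using T sT by (intro mult_left_mono) auto
      then show "P z y + 2 * l \<le> P (z + m) y" using P_mono[of z "z + m" y] m unfolding cm by linarith
      have "m * exp (- K - 1) \<le> m * exp (z - m)" using that m True by (intro mult_left_mono) auto
      also have "\<dots> \<le> exp z - exp (z - m)" using exp_slope[of m "z - m"] by simp
      finally have "(T - s) / T * (m * exp (- K - 1)) \<le> (T - s) / T * (exp z - exp (z - m))"
        using T sT by (intro mult_left_mono) auto
      then show "P (z - m) y \<le> P z y - 2 * l" using P_mono[of "z - m" z y] m unfolding cm by linarith
    qed
    \<comment> \<open>On \<open>\<Omega>\<close> this bounds the weighted increment, yet it is a
      function of \<open>B s\<close> and the residuals alone, as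
      \<open>nn_integral_regression\<close> requires. The indicator records that \<open>B s\<close>
      stays in \<open>{- K..K}\<close> there.\<close>
    define Q where "Q z y = ennreal w * ennreal ((h (P (z + m) y) - h (P (z - m) y)) * indicator {- K..K} z)" for z y
    have hm [measurable]: "h \<in> borel_measurable borel" using h(1) by (rule borel_measurable_mono)
    have Qm: "case_prod Q \<in> borel_measurable (borel \<Otimes>\<^sub>M (\<Pi>\<^sub>M v\<in>U. borel))"
    proof -
      have [measurable]: "(\<lambda>p. snd p (u i)) \<in> borel_measurable (borel \<Otimes>\<^sub>M (\<Pi>\<^sub>M v\<in>U. borel))" if "i < n" for i
        using that by (intro measurable_compose[OF measurable_snd measurable_component_singleton]) (auto simp: U_def)
      have Pm [measurable]: "(\<lambda>p. P (fst p + e) (snd p)) \<in> borel_measurable (borel \<Otimes>\<^sub>M (\<Pi>\<^sub>M v\<in>U. borel))" for e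
        unfolding P_def
        by (intro borel_measurable_add borel_measurable_times borel_measurable_sum borel_measurable_const
            measurable_compose[OF _ borel_measurable_exp]) (simp_all, measurable)
      have "(\<lambda>p. Q (fst p) (snd p)) \<in> borel_measurable (borel \<Otimes>\<^sub>M (\<Pi>\<^sub>M v\<in>U. borel))"
        unfolding Q_def using Pm[of m] Pm[of "- m"] by simp
      then show ?thesis by (simp add: case_prod_beta')
    qed
    have Q_le: "(\<integral>\<^sup>+z. Q z y \<partial>lborel) \<le> ennreal (w * (4 * m * C))" for y
    proof -
      have q: "mono (\<lambda>z. h (P z y))" using mono_P[of y] h(1) by (simp add: mono_def)
      have qm [measurable]: "(\<lambda>z. h (P z y)) \<in> borel_measurable borel" using q by (rule borel_measurable_mono)
      have "(\<integral>\<^sup>+z. Q z y \<partial>lborel) = ennreal w * (\<integral>\<^sup>+z. ennreal ((h (P (z + m) y) - h (P (z - m) y)) * indicator {- K..K} z) \<partial>lborel)"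
        unfolding Q_def
        using measurable_compose[OF _ qm, of "\<lambda>z. z + m" lborel] measurable_compose[OF _ qm, of "\<lambda>z. z - m" lborel]
        by (intro nn_integral_cmult) simp
      also have "\<dots> \<le> ennreal w * ennreal (4 * m * C)"
        using nn_integral_mono_difference_le[OF q h(2), of m "- K" K] m K by (intro mult_left_mono) auto
      finally show ?thesis using w by (simp add: ennreal_mult')
    qed
    have "1 / s powr H * (w * (4 * m * C)) = 4 * C * (w * m) * s powr - H"
      by (simp add: powr_minus_divide)
    also have "\<dots> = 16 * C * K * (exp K * exp (2 * K + 1)) * (t - s) powr \<eta> * s powr - H"
      unfolding wm by (simp add: l_def)
    also have "exp K * exp (2 * K + 1) = exp (3 * K + 1)"
      by (simp add: mult_exp_exp)
    also have "16 * C * K * exp (3 * K + 1) * (t - s) powr \<eta> * s powr - H \<le>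
      (16 * C * K * exp (3 * K + 1) * (t - s) powr \<eta> * s powr - H) * (1 + T powr H)"
      using C K mult_left_mono[of 1 "1 + T powr H" "16 * C * K * exp (3 * K + 1) * (t - s) powr \<eta> * s powr - H"] by simp
    finally have "1 / s powr H * (w * (4 * m * C)) \<le> ?R"
      by (simp add: mult_ac)
    then have le: "ennreal (1 / s powr H * (w * (4 * m * C))) \<le> ennreal (?R)"
      by (rule ennreal_leI)
    have "?I \<le>
      (\<integral>\<^sup>+\<omega>. Q (B s \<omega>) (\<lambda>v\<in>U. residual v \<omega>) \<partial>M)"
    proof (rule nn_integral_mono)
      fix \<omega>
      show "indicator \<Omega> \<omega> * ennreal (weighted_increment T h (\<lambda>t. B t \<omega>) s t) \<le> Q (B s \<omega>) (\<lambda>v\<in>U. residual v \<omega>)"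
      proof (cases "\<omega> \<in> \<Omega>")
        case \<omega>: True
        let ?y = "\<lambda>v\<in>U. residual v \<omega>"
        let ?X = "averaged_price T (\<lambda>t. B t \<omega>)"
        interpret path: bounded_holder_path "\<lambda>t. B t \<omega>" T K K \<eta> by (rule \<Omega>[OF \<omega>])
        have "P (B s \<omega>) ?y = (T - s) / T * exp (B s \<omega>) + 1 / T * (\<Sum>i<n. s / n * exp (B (s * real i / n) \<omega>))"
          unfolding P_def by (intro arg_cong2[where f = "(+)"] arg_cong2[where f = "(*)"] sum.cong refl)
            (auto simp: U_def residual_def u_def)
        then have "\<bar>?X s - P (B s \<omega>) ?y\<bar> \<le> l"
          using path.averaged_price_riemann_sum[of s n] n st by simp
        moreover have "\<bar>?X t - ?X s\<bar> \<le> l"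
          using path.averaged_price_holder[of s t] st by (simp add: l_def)
        moreover have Bs: "- K \<le> B s \<omega>" "B s \<omega> \<le> K" using path.bounded[of s] st by auto
        \<comment> \<open>\<open>?X s\<close> is within \<open>l\<close> and \<open>?X t\<close>
          within \<open>2 * l\<close> of the discretised price, while moving \<open>B s\<close> by
          \<open>m\<close> changes that price by at least \<open>2 * l\<close>.\<close>
        ultimately have "P (B s \<omega> - m) ?y \<le> ?X t \<and> ?X t \<le> P (B s \<omega> + m) ?y \<and> P (B s \<omega> - m) ?y \<le> ?X s \<and> ?X s \<le> P (B s \<omega> + m) ?y"
          using slope[OF Bs(1), of ?y] l by linarith
        then have "h (P (B s \<omega> - m) ?y) \<le> h (?X t) \<and> h (?X t) \<le> h (P (B s \<omega> + m) ?y) \<and> h (P (B s \<omega> - m) ?y) \<le> h (?X s) \<and> h (?X s) \<le> h (P (B s \<omega> + m) ?y)"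
          using h(1) by (auto simp: mono_def)
        then have "\<bar>h (?X t) - h (?X s)\<bar> \<le> h (P (B s \<omega> + m) ?y) - h (P (B s \<omega> - m) ?y)" by linarith
        then have "price_weight T (\<lambda>t. B t \<omega>) s * \<bar>h (?X t) - h (?X s)\<bar> \<le> w * (h (P (B s \<omega> + m) ?y) - h (P (B s \<omega> - m) ?y))"
          using weight[OF \<omega>] w by (intro mult_mono) auto
        then show ?thesis
          using \<omega> Bs w by (simp add: Q_def weighted_increment_def ennreal_mult'[symmetric] ennreal_leI)
      qed simp
    qed
    also have "\<dots> = (\<integral>\<^sup>+\<omega>'. (\<integral>\<^sup>+\<omega>. Q (B s \<omega>) (\<lambda>v\<in>U. residual v \<omega>') \<partial>M) \<partial>M)"
      by (rule nn_integral_regression[OF Qm])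
    also have "\<dots> \<le> (\<integral>\<^sup>+\<omega>'. ennreal (1 / s powr H) * ennreal (w * (4 * m * C)) \<partial>M)"
    proof (rule nn_integral_mono)
      fix \<omega>' assume \<omega>': "\<omega>' \<in> space M"
      have "(\<integral>\<^sup>+\<omega>. Q (B s \<omega>) (\<lambda>v\<in>U. residual v \<omega>') \<partial>M) \<le> ennreal (1 / s powr H) * (\<integral>\<^sup>+z. Q z (\<lambda>v\<in>U. residual v \<omega>') \<partial>lborel)"
      proof (rule nn_integral_gaussian_le)
        show "gaussian_rv M (B s)" by (rule gaussian_B) simp
        show "variance (B s) = (s powr H)\<^sup>2" using var_s by (simp add: covariance_def power2_eq_square)
        show "0 < s powr H" using st by simp
        have "(\<lambda>v\<in>U. residual v \<omega>') \<in> space (\<Pi>\<^sub>M v\<in>U. borel)" by (simp add: space_PiM)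
        from measurable_compose[OF measurable_Pair2'[OF this] Qm]
        show "(\<lambda>z. Q z (\<lambda>v\<in>U. residual v \<omega>')) \<in> borel_measurable borel"
          by simp
      qed
      also have "\<dots> \<le> ennreal (1 / s powr H) * ennreal (w * (4 * m * C))"
        using Q_le by (intro mult_left_mono) auto
      finally show "(\<integral>\<^sup>+\<omega>. Q (B s \<omega>) (\<lambda>v\<in>U. residual v \<omega>') \<partial>M) \<le> ennreal (1 / s powr H) * ennreal (w * (4 * m * C))" .
    qed
    also have "\<dots> = ennreal (1 / s powr H * (w * (4 * m * C)))"
    proof -
      have "0 \<le> 1 / s powr H" by simp
      then show ?thesis by (simp only: nn_integral_const emeasure_space_1 mult_1_right ennreal_mult')
    qed
    finally show ?thesis using le by (rule order_trans)
  qed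
qed simp

section \<open>Passage from mean estimates to almost every path\<close>

lemma W2_cong:
  assumes "\<And>s. 0 \<le> s \<Longrightarrow> s \<le> T \<Longrightarrow> F s = G s"
  shows "F \<in> W2 T b \<longleftrightarrow> G \<in> W2 T b"
proof -
  have "F \<in> borel_measurable (restrict_space borel {0..T}) \<longleftrightarrow> G \<in> borel_measurable (restrict_space borel {0..T})"
    using assms by (intro measurable_cong) (auto simp: space_restrict_space)
  moreover have "norm_W2 T b F = norm_W2 T b G"
    unfolding norm_W2_def
  proof (intro arg_cong2[where f = "(+)"] nn_integral_cong)
    show "ennreal (\<bar>F t\<bar> / t powr b) * indicator {0..T} t = ennreal (\<bar>G t\<bar> / t powr b) * indicator {0..T} t" for t
      using assms by (auto simp: indicator_def)
    fix t
    show "(\<integral>\<^sup>+s\<in>{0..t}. ennreal (\<bar>F t - F s\<bar> / (t - s) powr (b + 1)) \<partial>lborel) * indicator {0..T} t =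
        (\<integral>\<^sup>+s\<in>{0..t}. ennreal (\<bar>G t - G s\<bar> / (t - s) powr (b + 1)) \<partial>lborel) * indicator {0..T} t"
    proof (cases "t \<in> {0..T}")
      case True
      then have "(\<integral>\<^sup>+s\<in>{0..t}. ennreal (\<bar>F t - F s\<bar> / (t - s) powr (b + 1)) \<partial>lborel) =
        (\<integral>\<^sup>+s\<in>{0..t}. ennreal (\<bar>G t - G s\<bar> / (t - s) powr (b + 1)) \<partial>lborel)"
        using assms by (intro nn_integral_cong) (auto simp: indicator_def)
      then show ?thesis by simp
    qed simp
  qed
  ultimately show ?thesis by (simp add: W2_def)
qed

lemma W1_holder:
  assumes "g \<in> W1 T \<eta>" and \<eta>: "0 < \<eta>"
  obtains L where "0 \<le> L"
    "\<And>u v. 0 \<le> u \<Longrightarrow> u \<le> T \<Longrightarrow> 0 \<le> v \<Longrightarrow> v \<le> T \<Longrightarrow> \<bar>g u - g v\<bar> \<le> L * \<bar>u - v\<bar> powr \<eta>"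
proof
  define L where "L = enn2real (norm_W1 T \<eta> g)"
  show "0 \<le> L" by (simp add: L_def)
  have L: "norm_W1 T \<eta> g = ennreal L"
    using assms by (simp add: W1_def L_def)
  have less: "\<bar>g v - g u\<bar> \<le> L * (v - u) powr \<eta>" if "0 \<le> u" "u < v" "v \<le> T" for u v
  proof -
    have "ennreal (\<bar>g v - g u\<bar> / (v - u) powr \<eta>) \<le>
        ennreal (\<bar>g v - g u\<bar> / (v - u) powr \<eta>) + (\<integral>\<^sup>+w\<in>{u..v}. ennreal (\<bar>g w - g u\<bar> / (w - u) powr (\<eta> + 1)) \<partial>lborel)"
      by simp
    also have "\<dots> \<le> norm_W1 T \<eta> g"
      unfolding norm_W1_def using that by (intro SUP_upper2[of "(u, v)"]) auto
    finally have "\<bar>g v - g u\<bar> / (v - u) powr \<eta> \<le> L"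
      unfolding L using \<open>0 \<le> L\<close> by (subst (asm) ennreal_le_iff) auto
    then show ?thesis using that by (simp add: divide_le_eq)
  qed
  show "\<bar>g u - g v\<bar> \<le> L * \<bar>u - v\<bar> powr \<eta>" if "0 \<le> u" "u \<le> T" "0 \<le> v" "v \<le> T" for u v
    using less[of u v] less[of v u] that by (cases u v rule: linorder_cases) (auto simp: abs_minus_commute)
qed

text \<open>A countable dense set of times, clamped so that each index gives a point of
  \<open>{0..T}\<close>. Conditions at all times become countable ones, hence events, and
  \<open>grid T \<lfloor>real n * u\<rfloor> n\<close> approximates \<open>u\<close> while depending
  measurably on it.\<close>

definition grid :: "real \<Rightarrow> int \<Rightarrow> nat \<Rightarrow> real" where
  "grid T k n = max 0 (min T (of_int k / real n))"

lemma grid_bounds: "0 \<le> T \<Longrightarrow> 0 \<le> grid T k n \<and> grid T k n \<le> T"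
  by (simp add: grid_def)

lemma grid_tendsto:
  assumes "0 \<le> u" "u \<le> T"
  shows "(\<lambda>n. grid T \<lfloor>real n * u\<rfloor> n) \<longlonglongrightarrow> u"
proof -
  have "(\<lambda>n. of_int \<lfloor>real n * u\<rfloor> / real n) \<longlonglongrightarrow> u"
  proof (rule tendsto_sandwich)
    show "(\<lambda>n. u - inverse (real n)) \<longlonglongrightarrow> u"
      using tendsto_diff[OF tendsto_const lim_inverse_n, of u] by simp
    show "\<forall>\<^sub>F n in sequentially. u - inverse (real n) \<le> of_int \<lfloor>real n * u\<rfloor> / real n"
      using eventually_gt_at_top[of 0]
    proof eventually_elim
      case (elim n)
      have "real n * u - 1 \<le> of_int \<lfloor>real n * u\<rfloor>" by linarith
      then have "(real n * u - 1) / real n \<le> of_int \<lfloor>real n * u\<rfloor> / real n" by (intro divide_right_mono) auto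
      then show ?case using elim by (simp add: diff_divide_distrib inverse_eq_divide)
    qed
    show "\<forall>\<^sub>F n in sequentially. of_int \<lfloor>real n * u\<rfloor> / real n \<le> u"
      using eventually_gt_at_top[of 0]
    proof eventually_elim
      case (elim n)
      have "of_int \<lfloor>real n * u\<rfloor> \<le> real n * u" by linarith
      then show ?case using elim by (simp add: divide_le_eq mult.commute)
    qed
  qed simp
  then have "(\<lambda>n. max 0 (min T (of_int \<lfloor>real n * u\<rfloor> / real n))) \<longlonglongrightarrow> max 0 (min T u)"
    by (intro tendsto_max tendsto_min tendsto_const)
  then show ?thesis using assms by (simp add: grid_def)
qed

lemma bounded_holder_path_grid:
  assumes T: "0 < T" and \<eta>: "0 < \<eta>" "\<eta> < 1" and K: "0 \<le> K" and g: "continuous_on {0..T} g"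
    and bounded: "\<And>k n. \<bar>g (grid T k n)\<bar> \<le> K"
    and holder: "\<And>k n k' n'. \<bar>g (grid T k n) - g (grid T k' n')\<bar> \<le> K * \<bar>grid T k n - grid T k' n'\<bar> powr \<eta>"
  shows "bounded_holder_path g T K K \<eta>"
proof
  have lim: "(\<lambda>n. g (grid T \<lfloor>real n * u\<rfloor> n)) \<longlonglongrightarrow> g u" if "0 \<le> u" "u \<le> T" for u
    using grid_bounds[of T] T that
    by (intro continuous_on_tendsto_compose[OF g grid_tendsto]) auto
  show "\<bar>g u\<bar> \<le> K" if "0 \<le> u" "u \<le> T" for u
    by (rule LIMSEQ_le_const2[OF tendsto_rabs[OF lim[OF that]]]) (use bounded in auto)
  show "\<bar>g u - g v\<bar> \<le> K * \<bar>u - v\<bar> powr \<eta>" if u: "0 \<le> u" "u \<le> T" and v: "0 \<le> v" "v \<le> T" for u v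
  proof (rule LIMSEQ_le[OF tendsto_rabs[OF tendsto_diff[OF lim[OF u] lim[OF v]]]])
    show "(\<lambda>n. K * \<bar>grid T \<lfloor>real n * u\<rfloor> n - grid T \<lfloor>real n * v\<rfloor> n\<bar> powr \<eta>) \<longlonglongrightarrow> K * \<bar>u - v\<bar> powr \<eta>"
      using \<eta> by (intro tendsto_intros grid_tendsto u v tendsto_powr') auto
  qed (use holder in auto)
qed (use T \<eta> K in auto)

text \<open>Integrating in \<open>t\<close> first meets
  \<open>(t - s) powr (\<eta> - b - 1)\<close>, integrable at \<open>t = s\<close> because
  \<open>b < \<eta>\<close>; what remains is \<open>s powr (- H)\<close>, integrable at 0 because
  \<open>H < 1\<close>.\<close>

lemma nn_integral_double_kernel_finite:
  assumes H: "0 < H" "H < 1" and b: "b < \<eta>" and T: "0 < T" and A: "0 \<le> A"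
  shows "(\<integral>\<^sup>+t. \<integral>\<^sup>+s. ennreal (A * (t - s) powr \<eta> * s powr - H * power_kernel (b + 1) (t - s) * indicator {0<..T} s * indicator {0..T} t) \<partial>lborel \<partial>lborel) < \<infinity>"
proof -
  let ?f = "\<lambda>t s. A * (t - s) powr \<eta> * s powr - H * power_kernel (b + 1) (t - s) * indicator {0<..T} s * indicator {0..T} t"
  have "(\<integral>\<^sup>+t. \<integral>\<^sup>+s. ennreal (?f t s) \<partial>lborel \<partial>lborel) =
     (\<integral>\<^sup>+s. \<integral>\<^sup>+t. ennreal (?f t s) \<partial>lborel \<partial>lborel)"
    by (rule lborel_pair.Fubini') measurable
  also have "\<dots> \<le> (\<integral>\<^sup>+s. ennreal (A * (T powr (\<eta> - b) / (\<eta> - b))) * ennreal (power_kernel H s * indicator {..T} s) \<partial>lborel)"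
  proof (rule nn_integral_mono)
    fix s
    show "(\<integral>\<^sup>+t. ennreal (?f t s) \<partial>lborel) \<le>
      ennreal (A * (T powr (\<eta> - b) / (\<eta> - b))) * ennreal (power_kernel H s * indicator {..T} s)"
    proof (cases "s \<in> {0<..T}")
      case True
      have "(\<integral>\<^sup>+t. ennreal (?f t s) \<partial>lborel) \<le>
        (\<integral>\<^sup>+t. ennreal (A * s powr - H) * ennreal (power_kernel (1 + b - \<eta>) (t - s) * indicator {..T} (t - s)) \<partial>lborel)"
      proof (rule nn_integral_mono)
        fix t
        have "(t - s) powr \<eta> * power_kernel (b + 1) (t - s) = power_kernel (1 + b - \<eta>) (t - s)"
          by (simp add: power_kernel_def powr_add[symmetric] algebra_simps)
        moreover have "?f t s =
            A * s powr - H * ((t - s) powr \<eta> * power_kernel (b + 1) (t - s)) * indicator {0<..T} s * indicator {0..T} t"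
          by (simp only: mult_ac)
        ultimately have "?f t s =
            A * s powr - H * power_kernel (1 + b - \<eta>) (t - s) * indicator {0<..T} s * indicator {0..T} t"
          by (simp only:)
        also have "\<dots> \<le> A * s powr - H * (power_kernel (1 + b - \<eta>) (t - s) * indicator {..T} (t - s))"
          using True A by (auto simp: indicator_def)
        finally show "ennreal (?f t s) \<le>
            ennreal (A * s powr - H) * ennreal (power_kernel (1 + b - \<eta>) (t - s) * indicator {..T} (t - s))"
          using A by (subst ennreal_mult'[symmetric]) (auto intro!: ennreal_leI)
      qed
      also have "\<dots> = ennreal (A * s powr - H) * (\<integral>\<^sup>+t. ennreal (power_kernel (1 + b - \<eta>) (t - s) * indicator {..T} (t - s)) \<partial>lborel)"
        by (rule nn_integral_cmult) simp
      also have "(\<integral>\<^sup>+t. ennreal (power_kernel (1 + b - \<eta>) (t - s) * indicator {..T} (t - s)) \<partial>lborel) =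
          (\<integral>\<^sup>+r. ennreal (power_kernel (1 + b - \<eta>) r * indicator {..T} r) \<partial>lborel)"
        by (subst nn_integral_real_affine[of _ 1 s]) auto
      also have "\<dots> = ennreal (T powr (\<eta> - b) / (\<eta> - b))"
        using b T by (subst nn_integral_power_kernel_atMost) auto
      finally show ?thesis
        using True A by (simp add: power_kernel_def ennreal_mult'[symmetric] mult_ac)
    qed simp
  qed
  also have "\<dots> = ennreal (A * (T powr (\<eta> - b) / (\<eta> - b))) * ennreal (T powr (1 - H) / (1 - H))"
    using H T by (subst nn_integral_cmult) (auto simp: nn_integral_power_kernel_atMost)
  also have "\<dots> < \<infinity>"
    by (simp add: ennreal_mult_less_top)
  finally show ?thesis .
qed

text \<open>The quantity whose finiteness \<open>W2_product\<close> asks for, with the factors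
  \<open>h \<circ> averaged_price T g\<close> and \<open>price_weight T g\<close>.\<close>

definition crossing_integral :: "real \<Rightarrow> real \<Rightarrow> (real \<Rightarrow> real) \<Rightarrow> (real \<Rightarrow> real) \<Rightarrow> ennreal" where
  "crossing_integral T b h g = (\<integral>\<^sup>+t. \<integral>\<^sup>+s. ennreal (\<bar>price_weight T g s\<bar> *
      \<bar>h (averaged_price T g t) - h (averaged_price T g s)\<bar> * power_kernel (b + 1) (t - s)) *
      indicator {0..T} s * indicator {0..T} t \<partial>lborel \<partial>lborel)"

text \<open>The mean over \<open>\<Omega>\<close> is finite by Tonelli, the crossing bound at fixed
  \<open>s < t\<close> and \<open>nn_integral_double_kernel_finite\<close>. Tonelli requires joint
  measurability in path and time, which is not among the assumptions on \<open>B\<close> and has to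
  be constructed.\<close>

lemma (in prob_space) AE_finite_crossings:
  fixes B :: "real \<Rightarrow> 'a \<Rightarrow> real"
  assumes gaussian: "gaussian_process M B" and H: "0 < H" "H < 1"
    and cov: "\<And>u v. 0 \<le> u \<Longrightarrow> 0 \<le> v \<Longrightarrow> covariance M (B u) (B v) = 1 / 2 * (u powr (2 * H) + v powr (2 * H) - \<bar>u - v\<bar> powr (2 * H))"
    and h: "mono h" "\<And>x. \<bar>h x\<bar> \<le> C" and T: "0 < T" and K: "0 < K" and b: "b < \<eta>"
    and \<Omega> [measurable]: "\<Omega> \<in> sets M"
    and path: "\<And>\<omega>. \<omega> \<in> \<Omega> \<Longrightarrow> bounded_holder_path (\<lambda>t. B t \<omega>) T K K \<eta>"
  shows "AE \<omega> in M. \<omega> \<in> \<Omega> \<longrightarrow> crossing_integral T b h (\<lambda>t. B t \<omega>) < \<infinity>"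
proof -
  have C: "0 \<le> C" using h(2)[of 0] by linarith
  have hm [measurable]: "h \<in> borel_measurable borel" using h(1) by (rule borel_measurable_mono)
  have Bm: "B u \<in> borel_measurable M" if "0 \<le> u" for u
    using gaussian[unfolded gaussian_process_def, rule_format, of "{u}" "\<lambda>_. 1"] that by (simp add: gaussian_rv_def)
  \<comment> \<open>A jointly measurable version: on \<open>\<Omega>\<close> the paths are
    continuous on \<open>{0..T}\<close>, so the grid limit is \<open>B u \<omega>\<close> there; off
    \<open>\<Omega>\<close> the indicator makes it 0.\<close>
  define B' where "B' u \<omega> = lim (\<lambda>n. indicator \<Omega> \<omega> * B (grid T \<lfloor>real n * u\<rfloor> n) \<omega>)" for u \<omega>
  have step: "(\<lambda>p. indicator \<Omega> (snd p) * B (grid T \<lfloor>real n * fst p\<rfloor> n) (snd p)) \<in> borel_measurable (borel \<Otimes>\<^sub>M M)" for n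
  proof -
    have "(\<lambda>p. B (grid T k n) (snd p)) \<in> borel_measurable (borel \<Otimes>\<^sub>M M)" for k
      using grid_bounds[of T k n] T by (intro measurable_compose[OF measurable_snd Bm]) auto
    then have "(\<lambda>p. B (grid T \<lfloor>real n * fst p\<rfloor> n) (snd p)) \<in> borel_measurable (borel \<Otimes>\<^sub>M M)"
      by (rule measurable_compose_countable) measurable
    then show ?thesis by measurable
  qed
  have B'm [measurable]: "(\<lambda>p. B' (fst p) (snd p)) \<in> borel_measurable (borel \<Otimes>\<^sub>M M)"
    unfolding B'_def using step by (rule borel_measurable_lim_metric)
  have B'_eq: "B' u \<omega> = B u \<omega>" if "\<omega> \<in> \<Omega>" "0 \<le> u" "u \<le> T" for u \<omega>
  proof -
    interpret bounded_holder_path "\<lambda>t. B t \<omega>" T K K \<eta> by (rule path[OF that(1)])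
    have "(\<lambda>n. B (grid T \<lfloor>real n * u\<rfloor> n) \<omega>) \<longlonglongrightarrow> B u \<omega>"
      using grid_bounds[of T] T that
      by (intro continuous_on_tendsto_compose[OF continuous_g grid_tendsto]) auto
    then show ?thesis using that by (simp add: B'_def limI)
  qed
  define X where "X s \<omega> = (T - s) / T * exp (B' s \<omega>) + 1 / T * (LINT u|lborel. (if 0 \<le> u \<and> u \<le> s then exp (B' u \<omega>) else 0))" for s \<omega>
  define w where "w s \<omega> = (T - s) / T * exp (B' s \<omega>)" for s \<omega>
  have Im: "(\<lambda>p. LINT u|lborel. (if 0 \<le> u \<and> u \<le> fst p then exp (B' u (snd p)) else 0)) \<in> borel_measurable (borel \<Otimes>\<^sub>M M)"
  proof (rule sigma_finite_measure.borel_measurable_lebesgue_integral[OF sigma_finite_lborel])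
    have [measurable]: "(\<lambda>q. B' (snd q) (snd (fst q))) \<in> borel_measurable ((borel \<Otimes>\<^sub>M M) \<Otimes>\<^sub>M lborel)"
      using measurable_compose[OF _ B'm, of "\<lambda>q. (snd q, snd (fst q))" "(borel \<Otimes>\<^sub>M M) \<Otimes>\<^sub>M lborel"] by simp
    show "(\<lambda>(p, u). if 0 \<le> u \<and> u \<le> fst p then exp (B' u (snd p)) else 0) \<in> borel_measurable ((borel \<Otimes>\<^sub>M M) \<Otimes>\<^sub>M lborel)"
      unfolding case_prod_beta' by measurable
  qed
  have Xm: "(\<lambda>p. X (fst p) (snd p)) \<in> borel_measurable (borel \<Otimes>\<^sub>M M)"
    unfolding X_def using Im by measurable
  have wm: "(\<lambda>p. w (fst p) (snd p)) \<in> borel_measurable (borel \<Otimes>\<^sub>M M)"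
    unfolding w_def by measurable
  have X_eq: "X s \<omega> = averaged_price T (\<lambda>t. B t \<omega>) s" and w_eq: "w s \<omega> = price_weight T (\<lambda>t. B t \<omega>) s"
    if "\<omega> \<in> \<Omega>" "0 \<le> s" "s \<le> T" for s \<omega>
  proof -
    have "(LINT u|lborel. (if 0 \<le> u \<and> u \<le> s then exp (B' u \<omega>) else 0)) = (LINT u:{0..s}|lborel. exp (B u \<omega>))"
      unfolding set_lebesgue_integral_def using B'_eq that
      by (intro Bochner_Integration.integral_cong) (auto simp: indicator_def)
    then show "X s \<omega> = averaged_price T (\<lambda>t. B t \<omega>) s"
      using B'_eq[OF that] by (simp add: X_def averaged_price_def)
    show "w s \<omega> = price_weight T (\<lambda>t. B t \<omega>) s"
      using B'_eq[OF that] by (simp add: w_def price_weight_def)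
  qed
  define f where "f \<omega> t s = indicator \<Omega> \<omega> * ennreal (\<bar>w s \<omega>\<bar> * \<bar>h (X t \<omega>) - h (X s \<omega>)\<bar> * power_kernel (b + 1) (t - s)) * indicator {0..T} s * indicator {0..T} t" for \<omega> t s
  define A where "A = 16 * C * K * exp (3 * K + 1) * (1 + T powr H)"
  let ?k = "\<lambda>t s. A * (t - s) powr \<eta> * s powr - H * power_kernel (b + 1) (t - s) * indicator {0<..T} s * indicator {0..T} t"
  have A: "0 \<le> A" using C K by (simp add: A_def)
  \<comment> \<open>Stated for arbitrary measurable arguments, so that it serves every product order
    arising in the two exchanges of integrals.\<close>
  have fm: "(\<lambda>q. f (g1 q) (g2 q) (g3 q)) \<in> borel_measurable N"
    if [measurable]: "g1 \<in> measurable N M" "g2 \<in> measurable N borel" "g3 \<in> measurable N borel" for g1 g2 g3 and N :: "'c measure"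
  proof -
    have [measurable]: "(\<lambda>q. X (g2 q) (g1 q)) \<in> borel_measurable N" "(\<lambda>q. X (g3 q) (g1 q)) \<in> borel_measurable N" "(\<lambda>q. w (g3 q) (g1 q)) \<in> borel_measurable N"
      using measurable_compose[OF _ Xm, of "\<lambda>q. (g2 q, g1 q)" N] measurable_compose[OF _ Xm, of "\<lambda>q. (g3 q, g1 q)" N]
        measurable_compose[OF _ wm, of "\<lambda>q. (g3 q, g1 q)" N] by simp_all
    show ?thesis unfolding f_def by measurable
  qed
  have fm2: "(\<lambda>q. \<integral>\<^sup>+s. f (g1 q) (g2 q) s \<partial>lborel) \<in> borel_measurable N"
    if [measurable]: "g1 \<in> measurable N M" "g2 \<in> measurable N borel" for g1 g2 and N :: "'c measure"
    by (rule sigma_finite_measure.borel_measurable_nn_integral[OF sigma_finite_lborel])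
      (simp add: case_prod_beta' fm)
  have fm3: "(\<lambda>\<omega>. \<integral>\<^sup>+t. \<integral>\<^sup>+s. f \<omega> t s \<partial>lborel \<partial>lborel) \<in> borel_measurable M"
    by (rule sigma_finite_measure.borel_measurable_nn_integral[OF sigma_finite_lborel])
      (simp add: case_prod_beta' fm2)
  \<comment> \<open>At \<open>s = 0\<close> the right-hand side is 0 because of its indicator, while
    \<open>f\<close> need not vanish; this time is left out as a null set.\<close>
  have pt: "(\<integral>\<^sup>+\<omega>. f \<omega> t s \<partial>M) \<le> ennreal (?k t s)"
    if "s \<noteq> 0" for t s
  proof (cases "0 < s \<and> s < t \<and> t \<le> T")
    case True
    have "(\<integral>\<^sup>+\<omega>. f \<omega> t s \<partial>M) \<le> (\<integral>\<^sup>+\<omega>. ennreal (power_kernel (b + 1) (t - s)) * (indicator \<Omega> \<omega> * ennreal (weighted_increment T h (\<lambda>t. B t \<omega>) s t)) \<partial>M)"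
    proof (rule nn_integral_mono)
      fix \<omega>
      show "f \<omega> t s \<le> ennreal (power_kernel (b + 1) (t - s)) * (indicator \<Omega> \<omega> * ennreal (weighted_increment T h (\<lambda>t. B t \<omega>) s t))"
      proof (cases "\<omega> \<in> \<Omega>")
        case \<omega>: True
        interpret bounded_holder_path "\<lambda>t. B t \<omega>" T K K \<eta> by (rule path[OF \<omega>])
        show ?thesis
          using True \<omega> price_weight_bounds(1)[of s]
          by (simp add: f_def weighted_increment_def X_eq w_eq ennreal_mult'[symmetric] mult_ac)
      qed (simp add: f_def)
    qed
    also have "\<dots> = ennreal (power_kernel (b + 1) (t - s)) * (\<integral>\<^sup>+\<omega>. indicator \<Omega> \<omega> * ennreal (weighted_increment T h (\<lambda>t. B t \<omega>) s t) \<partial>M)"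
    proof (rule nn_integral_cmult)
      have "(\<lambda>\<omega>. indicator \<Omega> \<omega> * ennreal (weighted_increment T h (\<lambda>t. B t \<omega>) s t)) =
          (\<lambda>\<omega>. indicator \<Omega> \<omega> * ennreal (w s \<omega> * \<bar>h (X t \<omega>) - h (X s \<omega>)\<bar>))"
        using True by (auto simp: weighted_increment_def X_eq w_eq indicator_def)
      also have "\<dots> \<in> borel_measurable M"
      proof -
        have [measurable]: "(\<lambda>\<omega>. X r \<omega>) \<in> borel_measurable M" "(\<lambda>\<omega>. w r \<omega>) \<in> borel_measurable M" for r
          using measurable_compose[OF _ Xm, of "\<lambda>\<omega>. (r, \<omega>)" M] measurable_compose[OF _ wm, of "\<lambda>\<omega>. (r, \<omega>)" M] by simp_all
        show ?thesis by measurable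
      qed
      finally show "(\<lambda>\<omega>. indicator \<Omega> \<omega> * ennreal (weighted_increment T h (\<lambda>t. B t \<omega>) s t)) \<in> borel_measurable M" .
    qed
    also have "\<dots> \<le> ennreal (power_kernel (b + 1) (t - s)) * ennreal (A * (t - s) powr \<eta> * s powr - H)"
      unfolding A_def using True
      by (intro mult_left_mono averaged_price_crossing_bound[OF gaussian H(1) cov h _ _ _ K path]) auto
    also have "\<dots> = ennreal (?k t s)"
      using True by (simp add: ennreal_mult'[symmetric] mult_ac)
    finally show ?thesis .
  next
    case False
    have "f \<omega> t s = 0" for \<omega>
      using False that by (auto simp: f_def indicator_def not_less)
    then show ?thesis by simp
  qed
  have "(\<integral>\<^sup>+\<omega>. \<integral>\<^sup>+t. \<integral>\<^sup>+s. f \<omega> t s \<partial>lborel \<partial>lborel \<partial>M) = (\<integral>\<^sup>+t. \<integral>\<^sup>+\<omega>. \<integral>\<^sup>+s. f \<omega> t s \<partial>lborel \<partial>M \<partial>lborel)"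
  proof -
    interpret pair_sigma_finite lborel M ..
    show ?thesis
      by (rule Fubini') (simp add: case_prod_beta' fm2)
  qed
  also have "\<dots> = (\<integral>\<^sup>+t. \<integral>\<^sup>+s. \<integral>\<^sup>+\<omega>. f \<omega> t s \<partial>M \<partial>lborel \<partial>lborel)"
  proof -
    interpret pair_sigma_finite lborel M ..
    show ?thesis
      by (intro nn_integral_cong Fubini') (simp add: case_prod_beta' fm)
  qed
  also have "\<dots> \<le> (\<integral>\<^sup>+t. \<integral>\<^sup>+s. ennreal (?k t s) \<partial>lborel \<partial>lborel)"
    by (intro nn_integral_mono nn_integral_mono_AE eventually_mono[OF AE_lborel_singleton[of 0]] pt)
  also have "\<dots> < \<infinity>"
    by (rule nn_integral_double_kernel_finite[OF H b T A])
  finally have "(\<integral>\<^sup>+\<omega>. \<integral>\<^sup>+t. \<integral>\<^sup>+s. f \<omega> t s \<partial>lborel \<partial>lborel \<partial>M) \<noteq> \<infinity>"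
    by simp
  then have "AE \<omega> in M. (\<integral>\<^sup>+t. \<integral>\<^sup>+s. f \<omega> t s \<partial>lborel \<partial>lborel) \<noteq> \<infinity>"
    by (intro nn_integral_PInf_AE fm3)
  then show ?thesis
  proof eventually_elim
    case (elim \<omega>)
    show ?case
    proof
      assume \<omega>: "\<omega> \<in> \<Omega>"
      have "crossing_integral T b h (\<lambda>t. B t \<omega>) = (\<integral>\<^sup>+t. \<integral>\<^sup>+s. f \<omega> t s \<partial>lborel \<partial>lborel)"
        unfolding crossing_integral_def using \<omega> by (intro nn_integral_cong) (auto simp: f_def X_eq w_eq indicator_def)
      then show "crossing_integral T b h (\<lambda>t. B t \<omega>) < \<infinity>"
        using elim by (simp add: top.not_eq_extremum)
    qed
  qed
qed

section \<open>The change of variables formula\<close>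

text \<open>The deterministic half: for a single path, finiteness of the crossing integral is the
  one probabilistic input. Clamping the argument of \<open>f'\<close> to
  \<open>{0..2 * exp K}\<close>, which contains all values of the averaged price, keeps
  \<open>f'\<close> monotone and changes nothing along the path.\<close>

lemma has_gls_integral_averaged_price:
  fixes f f' :: "real \<Rightarrow> real"
  assumes f: "convex_on UNIV f" and f': "\<And>x. (f has_real_derivative f' x) (at_left x)"
    and g: "g \<in> W1 T (1 - b)" and b: "0 < b" "b < 1" "b < \<eta>" "1 - b < \<eta>" "1 / 2 < \<eta>" and t: "0 \<le> t" "t \<le> T"
    and path: "bounded_holder_path g T K K \<eta>"
    and C: "\<And>x. \<bar>f' (max 0 (min (2 * exp K) x))\<bar> \<le> C"
    and fin: "crossing_integral T b (\<lambda>x. f' (max 0 (min (2 * exp K) x))) g < \<infinity>"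
  shows "has_gls_integral T t (\<lambda>s. f' (averaged_price T g s) * price_weight T g s) g (f (averaged_price T g t) - f (averaged_price T g 0))"
proof -
  interpret bounded_holder_path g T K K \<eta> by fact
  define h where "h x = f' (max 0 (min (2 * exp K) x))" for x
  have h_eq: "h (averaged_price T g s) = f' (averaged_price T g s)" if "0 \<le> s" "s \<le> T" for s
    using averaged_price_bounds[OF that] by (simp add: h_def)
  have hm [measurable]: "h \<in> borel_measurable borel"
    using convex_left_derivative_mono[OF f f'] unfolding h_def[abs_def]
    by (intro borel_measurable_mono) (auto simp: mono_def intro!: max.mono min.mono)
  have "(\<lambda>s. h (averaged_price T g s) * price_weight T g s) \<in> W2 T b"
  proof (rule W2_product[OF T_pos b(1,3,2)])
    have [measurable]: "(\<lambda>s. indicator {0..T} s * averaged_price T g s) \<in> borel_measurable borel"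
      using borel_measurable_continuous_on_indicator[OF _ continuous_averaged_price] by simp
    have "(\<lambda>s. indicator {0..T} s * h (averaged_price T g s)) = (\<lambda>s. indicator {0..T} s * h (indicator {0..T} s * averaged_price T g s))"
      by (auto simp: indicator_def)
    also have "\<dots> \<in> borel_measurable borel" by measurable
    finally show "(\<lambda>s. indicator {0..T} s * h (averaged_price T g s)) \<in> borel_measurable borel" .
    show "(\<lambda>s. indicator {0..T} s * price_weight T g s) \<in> borel_measurable borel"
      using borel_measurable_continuous_on_indicator[OF _ continuous_price_weight] by simp
    show "\<bar>h (averaged_price T g s)\<bar> \<le> C" for s using C by (simp add: h_def)
    show "\<bar>price_weight T g s\<bar> \<le> exp K" if "0 \<le> s" "s \<le> T" for s
      using price_weight_bounds[OF that] by simp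
    show "0 \<le> exp K * K + exp K * T powr (1 - \<eta>) / T"
      using L_nonneg T_pos by simp
    show "\<bar>price_weight T g t - price_weight T g s\<bar> \<le> (exp K * K + exp K * T powr (1 - \<eta>) / T) * \<bar>t - s\<bar> powr \<eta>"
      if "0 \<le> s" "s \<le> T" "0 \<le> t" "t \<le> T" for s t
      by (rule price_weight_holder[OF that])
  qed (use fin in \<open>simp add: h_def crossing_integral_def\<close>)
  then have F: "(\<lambda>s. f' (averaged_price T g s) * price_weight T g s) \<in> W2 T b"
    by (subst W2_cong) (auto simp: h_eq)
  show ?thesis
  proof (cases "t = 0")
    case True
    then show ?thesis
      unfolding has_gls_integral_def using F g b by (intro exI[of _ b]) simp
  next
    case False
    then have t': "0 < t" using t by simp
    show ?thesis
    proof (rule gls_chain_rule_convex[OF f f' F g b(1,2) t' t(2) _ _ L_nonneg b(4,5) holder continuous_averaged_price])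
      show "\<bar>f' (averaged_price T g s)\<bar> \<le> C" if "0 \<le> s" "s \<le> T" for s
        using C[of "averaged_price T g s"] h_eq[OF that] by (simp add: h_def)
      show "\<bar>price_weight T g s\<bar> \<le> exp K" if "0 \<le> s" "s \<le> T" for s
        using price_weight_bounds[OF that] by simp
      show "0 \<le> exp K * K\<^sup>2 + exp K * K * T powr (1 - \<eta>) / T"
        using L_nonneg T_pos by simp
      show "\<bar>averaged_price T g v - averaged_price T g u - price_weight T g u * (g v - g u)\<bar> \<le>
          (exp K * K\<^sup>2 + exp K * K * T powr (1 - \<eta>) / T) * \<bar>v - u\<bar> powr (2 * \<eta>)"
        if "0 \<le> u" "u \<le> T" "0 \<le> v" "v \<le> T" for u v
        by (rule averaged_price_remainder[OF that])
    qed
  qed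
qed

theorem theorem2p10:
  fixes M :: "'a measure" and \<F> :: "real \<Rightarrow> 'a measure"
    and B S :: "real \<Rightarrow> 'a \<Rightarrow> real" and H T t :: real and f f' :: "real \<Rightarrow> real"
  assumes "complete_filtered_prob_space M \<F>"
    and "1 / 2 < H" and "H < 1"
    and "fractional_brownian_motion M H B"
    and "S = geometric_fbm B"
    and "0 < T" and "0 \<le> t" and "t \<le> T"
    and "convex_on UNIV f"
    and "\<And>x. (f has_real_derivative f' x) (at_left x)"
  shows "AE \<omega> in M. \<exists>I.
           has_gls_integral T t
             (\<lambda>s. f' ((T - s) / T * S s \<omega> + 1 / T * (LINT u:{0..s}|lborel. S u \<omega>))
                  * ((T - s) / T) * S s \<omega>)
             (\<lambda>s. B s \<omega>) I \<and>
           f ((T - t) / T * S t \<omega> + 1 / T * (LINT s:{0..t}|lborel. S s \<omega>)) = f (S 0 \<omega>) + I"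
proof -
  note H = assms(2,3) and T = assms(6) and f = assms(9) and f' = assms(10)
  interpret prob_space M using assms(1) by (simp add: complete_filtered_prob_space_def)
  have gaussian: "gaussian_process M B"
    and cov: "\<And>u v. 0 \<le> u \<Longrightarrow> 0 \<le> v \<Longrightarrow> covariance M (B u) (B v) = 1 / 2 * (u powr (2 * H) + v powr (2 * H) - \<bar>u - v\<bar> powr (2 * H))"
    and W1: "\<And>\<beta>. 0 < \<beta> \<Longrightarrow> \<beta> < H \<Longrightarrow> AE \<omega> in M. (\<lambda>t. B t \<omega>) \<in> W1 T \<beta>"
    using assms(4) T by (simp_all add: fractional_brownian_motion_def)
  \<comment> \<open>\<open>\<eta>\<close> is the midpoint of 1/2 and \<open>H\<close>; then
    \<open>b\<close> is the midpoint of \<open>1 - \<eta>\<close> and 1/2.\<close>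
  define \<eta> where "\<eta> = (1 / 2 + H) / 2"
  define b where "b = 3 / 4 - \<eta> / 2"
  have \<eta>: "1 / 2 < \<eta>" "\<eta> < H" "0 < \<eta>" "\<eta> < 1" using H by (auto simp: \<eta>_def)
  have b: "0 < b" "b < 1" "b < \<eta>" "1 - b < \<eta>" "0 < 1 - b" "1 - b < H" using \<eta> by (auto simp: b_def)
  have ae: "AE \<omega> in M. (\<lambda>t. B t \<omega>) \<in> W1 T \<eta> \<and> (\<lambda>t. B t \<omega>) \<in> W1 T (1 - b)"
    using W1[OF \<eta>(3,2)] W1[OF b(5,6)] by eventually_elim simp
  obtain N where N: "\<And>\<omega>. \<omega> \<in> space M - N \<Longrightarrow> (\<lambda>t. B t \<omega>) \<in> W1 T \<eta> \<and> (\<lambda>t. B t \<omega>) \<in> W1 T (1 - b)" "N \<in> null_sets M"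
    by (rule AE_E3[OF ae], rule that)
  have Bm [measurable]: "B (grid T k n) \<in> borel_measurable M" for k n
    using gaussian[unfolded gaussian_process_def, rule_format, of "{grid T k n}" "\<lambda>_. 1"] grid_bounds[of T k n] T
    by (simp add: gaussian_rv_def)
  \<comment> \<open>Only countably many conditions, so these are events. Excluding \<open>N\<close>
    ensures continuity of the path, through which the grid conditions extend to all times.\<close>
  define \<Omega> where "\<Omega> K = {\<omega> \<in> space M. \<omega> \<notin> N \<and> (\<forall>k n. \<bar>B (grid T k n) \<omega>\<bar> \<le> real K) \<and>
      (\<forall>k n k' n'. \<bar>B (grid T k n) \<omega> - B (grid T k' n') \<omega>\<bar> \<le> real K * \<bar>grid T k n - grid T k' n'\<bar> powr \<eta>)}" for K
  have N_sets [measurable]: "N \<in> sets M" using N(2) by auto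
  have \<Omega>_sets: "\<Omega> K \<in> sets M" for K
    unfolding \<Omega>_def by measurable
  have holder: "\<exists>L\<ge>0. \<forall>u v. 0 \<le> u \<longrightarrow> u \<le> T \<longrightarrow> 0 \<le> v \<longrightarrow> v \<le> T \<longrightarrow> \<bar>B u \<omega> - B v \<omega>\<bar> \<le> L * \<bar>u - v\<bar> powr \<eta>"
    if "\<omega> \<in> space M - N" for \<omega>
    using W1_holder[of "\<lambda>t. B t \<omega>" T \<eta>] N(1)[OF that] \<eta>(3) by metis
  have path: "bounded_holder_path (\<lambda>t. B t \<omega>) T (real K) (real K) \<eta>" if \<omega>: "\<omega> \<in> \<Omega> K" for K \<omega>
  proof (rule bounded_holder_path_grid[OF T \<eta>(3,4)])
    \<comment> \<open>The constant \<open>L\<close> depends on the path and serves to prove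
      continuity; the uniform constant \<open>K\<close> then comes from the grid.\<close>
    obtain L where L: "0 \<le> L" "\<And>u v. 0 \<le> u \<Longrightarrow> u \<le> T \<Longrightarrow> 0 \<le> v \<Longrightarrow> v \<le> T \<Longrightarrow> \<bar>B u \<omega> - B v \<omega>\<bar> \<le> L * \<bar>u - v\<bar> powr \<eta>"
      using holder[of \<omega>] \<omega> unfolding \<Omega>_def by auto
    have "bounded_holder_path (\<lambda>t. B t \<omega>) T (\<bar>B 0 \<omega>\<bar> + L * T powr \<eta>) L \<eta>"
    proof
      fix u assume u: "0 \<le> u" "u \<le> T"
      have "\<bar>B u \<omega> - B 0 \<omega>\<bar> \<le> L * \<bar>u - 0\<bar> powr \<eta>" using u T by (intro L(2)) auto
      also have "\<dots> \<le> L * T powr \<eta>" using u L(1) \<eta> by (intro mult_left_mono powr_mono2) auto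
      finally show "\<bar>B u \<omega>\<bar> \<le> \<bar>B 0 \<omega>\<bar> + L * T powr \<eta>" by linarith
    qed (use T L \<eta> in auto)
    then show "continuous_on {0..T} (\<lambda>t. B t \<omega>)" by (rule bounded_holder_path.continuous_g)
  qed (use \<omega> in \<open>auto simp: \<Omega>_def\<close>)
  have cover: "\<exists>K>0. \<omega> \<in> \<Omega> K" if \<omega>: "\<omega> \<in> space M - N" for \<omega>
  proof -
    obtain L where L: "0 \<le> L" "\<And>u v. 0 \<le> u \<Longrightarrow> u \<le> T \<Longrightarrow> 0 \<le> v \<Longrightarrow> v \<le> T \<Longrightarrow> \<bar>B u \<omega> - B v \<omega>\<bar> \<le> L * \<bar>u - v\<bar> powr \<eta>"
      using holder[OF \<omega>] by auto
    define K where "K = nat \<lceil>max (\<bar>B 0 \<omega>\<bar> + L * T powr \<eta>) L\<rceil> + 1"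
    have K: "\<bar>B 0 \<omega>\<bar> + L * T powr \<eta> \<le> real K" "L \<le> real K"
      unfolding K_def by linarith+
    have grid: "0 \<le> grid T k n" "grid T k n \<le> T" for k n using grid_bounds[of T k n] T by auto
    have "\<bar>B (grid T k n) \<omega>\<bar> \<le> real K" for k n
    proof -
      have "\<bar>B (grid T k n) \<omega> - B 0 \<omega>\<bar> \<le> L * \<bar>grid T k n - 0\<bar> powr \<eta>" using grid T by (intro L(2)) auto
      also have "\<dots> \<le> L * T powr \<eta>" using grid[of k n] L(1) \<eta> by (intro mult_left_mono powr_mono2) auto
      finally show ?thesis using K(1) by linarith
    qed
    moreover have "\<bar>B (grid T k n) \<omega> - B (grid T k' n') \<omega>\<bar> \<le> real K * \<bar>grid T k n - grid T k' n'\<bar> powr \<eta>" for k n k' n'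
      using L(2)[OF grid grid] by (rule order_trans) (intro mult_right_mono K, simp)
    ultimately have "\<omega> \<in> \<Omega> K" using \<omega> by (simp add: \<Omega>_def)
    then show ?thesis by (intro exI[of _ K]) (simp add: K_def)
  qed
  \<comment> \<open>Monotonicity of \<open>f'\<close> bounds the clamped derivative by its values at
    the two ends 0 and \<open>2 * exp K\<close>.\<close>
  define h where "h K x = f' (max 0 (min (2 * exp (real K)) x))" for K :: nat and x
  have h_mono: "mono (h K)" for K
    using convex_left_derivative_mono[OF f f'] by (auto simp: h_def mono_def intro!: max.mono min.mono)
  define C where "C K = max \<bar>f' 0\<bar> \<bar>f' (2 * exp (real K))\<bar>" for K :: nat
  have h_le: "\<bar>h K x\<bar> \<le> C K" for K x
  proof -
    have "f' 0 \<le> h K x" "h K x \<le> f' (2 * exp (real K))"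
      unfolding h_def by (intro monoD[OF convex_left_derivative_mono[OF f f']]; simp)+
    then show ?thesis unfolding C_def by linarith
  qed
  \<comment> \<open>Natural numbers \<open>K\<close> suffice to exhaust almost all paths, so only
    countably many null sets are united.\<close>
  have "AE \<omega> in M. \<forall>K. 0 < K \<longrightarrow> \<omega> \<in> \<Omega> K \<longrightarrow> crossing_integral T b (h K) (\<lambda>t. B t \<omega>) < \<infinity>"
  proof (subst AE_all_countable, intro allI AE_impI)
    fix K :: nat assume K: "0 < K"
    show "AE \<omega> in M. \<omega> \<in> \<Omega> K \<longrightarrow> crossing_integral T b (h K) (\<lambda>t. B t \<omega>) < \<infinity>"
      by (rule AE_finite_crossings[OF gaussian _ H(2) cov h_mono h_le T _ b(3) \<Omega>_sets path]) (use H K in auto)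
  qed
  moreover have "AE \<omega> in M. \<omega> \<in> space M - N"
    using AE_not_in[OF N(2)] AE_space by eventually_elim simp
  ultimately show ?thesis
  proof eventually_elim
    case (elim \<omega>)
    let ?g = "\<lambda>s. B s \<omega>"
    obtain K where K: "0 < K" "\<omega> \<in> \<Omega> K" using cover[OF elim(2)] by blast
    have "has_gls_integral T t (\<lambda>s. f' (averaged_price T ?g s) * price_weight T ?g s) ?g
        (f (averaged_price T ?g t) - f (averaged_price T ?g 0))"
    proof (rule has_gls_integral_averaged_price[OF f f' _ b(1-4) \<eta>(1) assms(7,8) path[OF K(2)]])
      show "?g \<in> W1 T (1 - b)" using N(1)[OF elim(2)] by blast
      show "\<bar>f' (max 0 (min (2 * exp (real K)) x))\<bar> \<le> C K" for x using h_le[of K x] by (simp add: h_def)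
    qed (use elim(1) K in \<open>simp add: h_def[abs_def]\<close>)
    moreover have "averaged_price T ?g 0 = S 0 \<omega>"
    proof -
      have "(LINT u:{0..0::real}|lborel. exp (B u \<omega>)) = 0"
        unfolding set_lebesgue_integral_def
        by (intro integral_eq_zero_AE eventually_mono[OF AE_lborel_singleton[of 0]]) (simp add: indicator_def)
      then show ?thesis using T by (simp add: averaged_price_def assms(5) geometric_fbm_def)
    qed
    ultimately show ?case
      by (intro exI[of _ "f (averaged_price T ?g t) - f (averaged_price T ?g 0)"])
        (simp add: averaged_price_def price_weight_def assms(5) geometric_fbm_def mult.assoc)
  qed
qed

end
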